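(* Let $m\ge 1$ and $\theta\in\{-1,1\}$. If $\theta=1$, let $\mu>0$ be arbitrary; if $\theta=-1$, let $\mu$ be sufficiently large, i.e. $\mu\ge\mu_0$ where $\mu_0>0$ is a threshold depending on $m$, $C_\sigma$ and $A$ but not on $h$ (so, for $\theta=-1$, the assertion is that such a threshold $\mu_0$ exists for which the following holds for every $\mu\ge\mu_0$). Then there exists a constant $C>0$, independent of the mesh size $h$, such that $$\kappa\big(A_0^{-1}A_{m,\theta}\big)\le C\,\overline{\Lambda}_m^{2}.$$
   Context: **Mesh.** $\Omega\subset\mathbb{R}^d$ ($d=2,3$) is a bounded convex polygonal (polyhedral) domain, and $\mathcal{T}_h$ is a triangulation of $\Omega$ into simplices. $\mathcal{E}_h^I$ and $\mathcal{E}_h^B$ are the sets of interior and boundary $(d-1)$-dimensional faces, and $\mathcal{E}_h=\mathcal{E}_h^I\cup\mathcal{E}_h^B$. Put $h_K=\mathrm{diam}(K)$, $h_e=\mathrm{diam}(e)$, let $\rho_K$ be the radius of the largest ball inscribed in $K$, and set $h=\max_K h_K$, $\rho=\min_K\rho_K$. The mesh is quasi-uniform: $h\le C_\sigma\rho$ with a fixed constant $C_\sigma>0$. Let $n_e$ be the number of elements, enumerated $K_1,\dots,K_{n_e}$, and let $\boldsymbol{x}_K$ be the barycenter of $K$. $\mathbb{P}_m(D)$ is the space of polynomials of total degree at most $m$ on $D$. **Patches.** Fix an integer threshold $\#S$. For $K\in\mathcal{T}_h$ let $\Delta(K)=\{K'\in\mathcal{T}_h:\overline K\cap\overline{K'}\ne\varnothing\}$,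 $S_0(K)=\{K\}$, $S_t(K)=\bigcup_{K'\in S_{t-1}(K)}\Delta(K')$ for $t\ge1$, and let $S(K)=S_t(K)$ for the first $t$ such that the number of elements of $S_t(K)$ is at least $\#S$. $S(K)$ also denotes the region covered by its elements, and $\#S(K)$ is its number of elements. Let $I(K)=\{\boldsymbol{x}_{K'}:K'\in S(K)\}$. Standing assumption: for every $K\in\mathcal{T}_h$, if $p\in\mathbb{P}_m(S(K))$ vanishes at all points of $I(K)$, then $p=0$. **Reconstruction.** $U_h^0$ is the space of functions constant on each element of $\mathcal{T}_h$. For $v_h\in U_h^0$ and $K\in\mathcal{T}_h$, $\mathcal{R}_K^m v_h\in\mathbb{P}_m(S(K))$ is the unique minimizer of $\sum_{\boldsymbol{x}\in I(K)}(p(\boldsymbol{x})-v_h(\boldsymbol{x}))^2$ over $p\in\mathbb{P}_m(S(K))$ subject to $p(\boldsymbol{x}_K)=v_h(\boldsymbol{x}_K)$. The linear operator $\mathcal{R}^m$ is given by $(\mathcal{R}^m v_h)|_K=(\mathcal{R}_K^m v_h)|_K$ for all $K$, and $U_h^m=\mathcal{R}^mU_h^0$. Let $e_j\in U_h^0$ be the indicator function of $K_j$ and $\lambda_j=\mathcal{R}^m e_j$; the $\lambda_j$ form a basis of $U_h^m$. Define $$\Lambda(m,K)=\max_{0\ne p\in\mathbb{P}_m(S(K))}\frac{\max_{\boldsymbol{x}\in S(K)}|p(\boldsymbol{x})|}{\max_{\boldsymbol{x}\in I(K)}|p(\boldsymbol{x})|},\quad \Lambda_m=\max_{K\in\mathcal{T}_h}\Lambda(m,K),\quad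 \overline{\Lambda}_m=\max_{K\in\mathcal{T}_h}\big(1+\Lambda_m\sqrt{\#S(K)}\big).$$ **Trace operators.** On an interior face $e$ shared by $K^\pm$ with unit outward normals $\boldsymbol{n}^\pm$: $[\![v]\!]=v^+\boldsymbol{n}^++v^-\boldsymbol{n}^-$ for scalar $v$ and $\{\boldsymbol\tau\}=\frac12(\boldsymbol\tau^++\boldsymbol\tau^-)$ for vector $\boldsymbol\tau$. On a boundary face with unit outward normal $\boldsymbol{n}$: $[\![v]\!]=v\boldsymbol{n}$ and $\{\boldsymbol\tau\}=\boldsymbol\tau$. **Matrices.** $A\in\mathbb{R}^{d\times d}$ is a symmetric positive definite matrix, $\mu$ is the penalty parameter, and gradients are taken elementwise: $$a_{h,\theta}(u,v)=\sum_{K\in\mathcal{T}_h}\int_K A\nabla u\cdot\nabla v\,d\boldsymbol{x}-\sum_{e\in\mathcal{E}_h}\int_e\{A\nabla u\}\cdot[\![v]\!]\,ds+\theta\sum_{e\in\mathcal{E}_h}\int_e\{A\nabla v\}\cdot[\![u]\!]\,ds+\sum_{e\in\mathcal{E}_h}\int_e\mu h_e^{-1}[\![u]\!]\cdot[\![v]\!]\,ds.$$ $A_{m,\theta}\in\mathbb{R}^{n_e\times n_e}$ is the matrix of $a_{h,\theta}$ on $U_h^m$ in the basis $\{\lambda_j\}$, with $\boldsymbol{v}^TA_{m,\theta}\boldsymbol{w}=a_{h,\theta}(\mathcal{R}^mv_h,\mathcal{R}^mw_h)$ for $v_h=\sum_jv_je_j$, $w_h=\sum_jw_je_j$ (for $\theta=1$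 reversing the order of arguments transposes the matrix). $A_0\in\mathbb{R}^{n_e\times n_e}$ is the symmetric positive definite matrix of $a_h^0(v_h,w_h)=\sum_{e\in\mathcal{E}_h}\int_eh_e^{-1}[\![v_h]\!]\cdot[\![w_h]\!]\,ds$ on $U_h^0$ in the basis $\{e_j\}$, so $\boldsymbol{v}^TA_0\boldsymbol{w}=a_h^0(v_h,w_h)$. **Condition number.** For a preconditioned matrix $B=A_0^{-1}A_{m,\theta}$, $\kappa(B)=\|B\|_{A_0}\|B^{-1}\|_{A_0}$, with the operator norm induced by $\|\boldsymbol{v}\|_{A_0}=(\boldsymbol{v}^TA_0\boldsymbol{v})^{1/2}$; for $\theta=-1$ this is the ratio of the largest to the smallest eigenvalue of $B$. **Constants.** The data $\Omega,d,m,\#S,C_\sigma,A,\theta,\mu$ are fixed. The constant $C$ may depend on them but is the same for all triangulations $\mathcal{T}_h$ of $\Omega$ into simplices that are quasi-uniform with $h\le C_\sigma\rho$ and whose patches $S(K)$, built with threshold $\#S$, satisfy the standing assumption that, for every $K\in\mathcal{T}_h$, any $p\in\mathbb{P}_m(S(K))$ vanishing at all points of $I(K)$ is $0$; in particular $C$ is independent of $h$. *)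

theory Defs
  imports "HOL-Analysis.Analysis" "Jordan_Normal_Form.Gauss_Jordan_Elimination"
begin

(* The type real ^ 'd is used for geometry in R^d, and the carrier-based Matrix.mat for the
   system matrices, whose size varies with the mesh. The symbols shared by the two theories
   keep their geometric meaning. *)
no_notation vec_index (infixl "$" 100)
no_notation scalar_prod (infix "\<bullet>" 70)

section \<open>Polynomials\<close>

definition poly_space :: "nat \<Rightarrow> (real ^ 'd \<Rightarrow> real) set" where
  "poly_space m =
     {p. \<exists>c. p = (\<lambda>x. \<Sum>\<alpha> | (\<Sum>i\<in>UNIV. \<alpha> i) \<le> m. c \<alpha> * (\<Prod>i\<in>UNIV. (x $ i) ^ \<alpha> i))}"

definition grad :: "(real ^ 'd \<Rightarrow> real) \<Rightarrow> real ^ 'd \<Rightarrow> real ^ 'd" where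
  "grad f x = (THE D. GDERIV f x :> D)"

section \<open>Domain and mesh\<close>

definition polyhedral_domain :: "(real ^ 'd) set \<Rightarrow> bool" where
  "polyhedral_domain \<Omega> \<longleftrightarrow>
     open \<Omega> \<and> \<Omega> \<noteq> {} \<and> bounded \<Omega> \<and> convex \<Omega> \<and> polytope (closure \<Omega>)"

(* Elements are closed simplices. The library predicate triangulation includes that
   any two elements meet in a common face. *)
definition mesh_of :: "(real ^ 'd) set \<Rightarrow> (real ^ 'd) set set \<Rightarrow> bool" where
  "mesh_of \<Omega> T \<longleftrightarrow>
     triangulation T \<and> (\<forall>K\<in>T. int CARD('d) simplex K) \<and> \<Union>T = closure \<Omega>"

definition inradius :: "(real ^ 'd) set \<Rightarrow> real" where
  "inradius K = Sup {r. 0 \<le> r \<and> (\<exists>x. cball x r \<subseteq> K)}"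

definition quasi_uniform :: "real \<Rightarrow> (real ^ 'd) set set \<Rightarrow> bool" where
  "quasi_uniform C\<sigma> T \<longleftrightarrow> (MAX K\<in>T. diameter K) \<le> C\<sigma> * (MIN K\<in>T. inradius K)"

definition barycenter :: "(real ^ 'd) set \<Rightarrow> real ^ 'd" where
  "barycenter K =
     (\<Sum>v | v extreme_point_of K. v) /\<^sub>R real (card {v. v extreme_point_of K})"

section \<open>Faces\<close>

definition adjacent :: "(real ^ 'd) set set \<Rightarrow> (real ^ 'd) set \<Rightarrow> (real ^ 'd) set set" where
  "adjacent T e = {K\<in>T. e facet_of K}"

definition interior_faces :: "(real ^ 'd) set set \<Rightarrow> (real ^ 'd) set set" where
  "interior_faces T = {e. card (adjacent T e) = 2}"

definition boundary_faces :: "(real ^ 'd) set set \<Rightarrow> (real ^ 'd) set set" where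
  "boundary_faces T = {e. card (adjacent T e) = 1}"

definition faces :: "(real ^ 'd) set set \<Rightarrow> (real ^ 'd) set set" where
  "faces T = interior_faces T \<union> boundary_faces T"

definition outward_normal :: "(real ^ 'd) set \<Rightarrow> (real ^ 'd) set \<Rightarrow> real ^ 'd" where
  "outward_normal K e = (THE n. norm n = 1 \<and> (\<forall>x\<in>e. \<forall>y\<in>K. n \<bullet> (y - x) \<le> 0))"

(* Surface measure on a hyperplane H: the image of Lebesgue measure on the slab of
   thickness 1 centred at H under orthogonal projection to H. By Fubini this is
   (d-1)-dimensional Lebesgue measure on H; see surface_measure_box below. *)
definition surface_measure :: "(real ^ 'd) set \<Rightarrow> (real ^ 'd) measure" where
  "surface_measure H =
     distr (restrict_space lborel {y. infdist y H \<le> 1 / 2}) borel (closest_point H)"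

lemma surface_measure_box:
  fixes a b :: "real ^ 'd"
  assumes k: "a $ k = c" "b $ k = c" and ab: "\<And>i. a $ i \<le> b $ i"
  shows "emeasure (surface_measure {x. x $ k = c}) (cbox a b) =
         ennreal (\<Prod>i\<in>UNIV - {k}. b $ i - a $ i)"
proof -
  define H where "H = {x :: real ^ 'd. x $ k = c}"
  define P where "P y = (\<chi> i. if i = k then c else y $ i)" for y :: "real ^ 'd"
  have H: "H = {x. axis k 1 \<bullet> x = c}"
    by (auto simp: H_def inner_axis inner_commute)
  have clH: "closed H" and coH: "convex H"
    unfolding H by (rule closed_hyperplane, rule convex_hyperplane)
  have PH: "P y \<in> H" for y by (simp add: P_def H_def)
  have "y - P y = (y $ k - c) *\<^sub>R axis k 1" for y
    by (auto simp: P_def axis_def Finite_Cartesian_Product.vec_eq_iff)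
  then have dP: "dist y (P y) = \<bar>y $ k - c\<bar>" for y
    by (simp add: dist_norm norm_axis_1)
  have dH: "\<bar>y $ k - c\<bar> \<le> dist y z" if "z \<in> H" for y z
    using component_le_norm_cart[of "y - z" k] that by (simp add: H_def dist_norm)
  have cp: "closest_point H y = P y" for y
    using closest_point_unique[OF coH clH PH] dP dH by (metis (no_types, lifting))
  have ifd: "infdist y H = \<bar>y $ k - c\<bar>" for y
  proof (rule antisym)
    show "infdist y H \<le> \<bar>y $ k - c\<bar>"
      using infdist_le[OF PH, of y y] dP[of y] by simp
    show "\<bar>y $ k - c\<bar> \<le> infdist y H"
      using PH dH by (auto simp: infdist_def intro!: cINF_greatest)
  qed
  define a' b' where "a' = (\<chi> i. if i = k then c - 1 / 2 else a $ i)"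
    and "b' = (\<chi> i. if i = k then c + 1 / 2 else b $ i)"
  have pre: "P -` cbox a b \<inter> {y. \<bar>y $ k - c\<bar> \<le> 1 / 2} = cbox a' b'"
    using k by (auto simp: P_def a'_def b'_def mem_box_cart abs_le_iff split: if_splits)
       (smt (verit) field_sum_of_halves)+
  have slab: "{y. \<bar>y $ k - c\<bar> \<le> 1 / 2} \<in> sets lborel"
    by measurable
  have Pm: "P \<in> borel_measurable (restrict_space lborel {y. \<bar>y $ k - c\<bar> \<le> 1 / 2})"
  proof (rule measurable_restrict_space1)
    have "continuous_on UNIV P"
      unfolding P_def
    proof (rule continuous_on_vec_lambda)
      show "continuous_on UNIV (\<lambda>x. if i = k then c else x $ i)" for i
        by (cases "i = k") (auto intro!: continuous_intros)
    qed
    then show "P \<in> borel_measurable lborel"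
      by (simp add: borel_measurable_continuous_onI)
  qed
  have "emeasure (surface_measure H) (cbox a b) =
      emeasure (restrict_space lborel {y. \<bar>y $ k - c\<bar> \<le> 1 / 2})
        (P -` cbox a b \<inter> {y. \<bar>y $ k - c\<bar> \<le> 1 / 2})"
    unfolding surface_measure_def cp ifd
    using Pm by (subst emeasure_distr) (auto simp: space_restrict_space cp[abs_def])
  also have "\<dots> = emeasure lborel (cbox a' b')"
    using slab by (subst emeasure_restrict_space) (auto simp: pre[symmetric])
  also have "\<dots> = ennreal (\<Prod>i\<in>UNIV. b' $ i - a' $ i)"
  proof -
    have ab': "a' $ i \<le> b' $ i" for i using ab by (simp add: a'_def b'_def)
    then have "cbox a' b' \<noteq> {}" by (auto simp: interval_ne_empty_cart)
    then have "measure lborel (cbox a' b') = (\<Prod>i\<in>UNIV. b' $ i - a' $ i)"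
      using content_cbox_cart[of a' b'] by (simp add: measure_completion)
    then show ?thesis
      by (metis emeasure_eq_ennreal_measure emeasure_lborel_cbox_finite less_irrefl infinity_ennreal_def)
  qed
  also have "(\<Prod>i\<in>UNIV. b' $ i - a' $ i) = (\<Prod>i\<in>UNIV - {k}. b $ i - a $ i)"
    by (subst prod.remove[of _ k]) (auto simp: a'_def b'_def intro!: prod.cong)
  finally show ?thesis by (simp add: H_def)
qed

definition surface_integral :: "(real ^ 'd) set \<Rightarrow> (real ^ 'd \<Rightarrow> real) \<Rightarrow> real" where
  "surface_integral e f = (LINT x:e|surface_measure (affine hull e). f x)"

section \<open>Broken functions and trace operators\<close>

(* A piecewise polynomial is represented by the family of its polynomials u K on the
   elements K of the mesh. Its one-sided trace from K on a face of K is u K itself. *)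
type_synonym ('d, 'b) broken = "(real ^ 'd) set \<Rightarrow> real ^ 'd \<Rightarrow> 'b"

(* adjacent T e has two members on an interior face and one on a boundary face. *)
definition jump :: "(real ^ 'd) set set \<Rightarrow> (real ^ 'd) set \<Rightarrow> ('d, real) broken
    \<Rightarrow> real ^ 'd \<Rightarrow> real ^ 'd" where
  "jump T e v x = (\<Sum>K\<in>adjacent T e. v K x *\<^sub>R outward_normal K e)"

definition avg :: "(real ^ 'd) set set \<Rightarrow> (real ^ 'd) set \<Rightarrow> ('d, real ^ 'd) broken
    \<Rightarrow> real ^ 'd \<Rightarrow> real ^ 'd" where
  "avg T e \<tau> x =
     (if e \<in> interior_faces T then (1 / 2) *\<^sub>R (\<Sum>K\<in>adjacent T e. \<tau> K x)
      else (\<Sum>K\<in>adjacent T e. \<tau> K x))"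

section \<open>Patches and reconstruction\<close>

definition neighbours :: "(real ^ 'd) set set \<Rightarrow> (real ^ 'd) set \<Rightarrow> (real ^ 'd) set set" where
  "neighbours T K = {K'\<in>T. closure K \<inter> closure K' \<noteq> {}}"

primrec patch_iter :: "(real ^ 'd) set set \<Rightarrow> nat \<Rightarrow> (real ^ 'd) set \<Rightarrow> (real ^ 'd) set set" where
  "patch_iter T 0 K = {K}"
| "patch_iter T (Suc t) K = (\<Union>K'\<in>patch_iter T t K. neighbours T K')"

definition patch :: "(real ^ 'd) set set \<Rightarrow> nat \<Rightarrow> (real ^ 'd) set \<Rightarrow> (real ^ 'd) set set" where
  "patch T nS K = patch_iter T (LEAST t. nS \<le> card (patch_iter T t K)) K"

definition patch_points :: "(real ^ 'd) set set \<Rightarrow> nat \<Rightarrow> (real ^ 'd) set \<Rightarrow> (real ^ 'd) set" where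
  "patch_points T nS K = barycenter ` patch T nS K"

(* The first conjunct says that the iteration defining the patch stops. Polynomials on a
   patch, a set with nonempty interior, are identified with polynomials on the whole space. *)
definition unisolvent_patches :: "(real ^ 'd) set set \<Rightarrow> nat \<Rightarrow> nat \<Rightarrow> bool" where
  "unisolvent_patches T nS m \<longleftrightarrow>
     (\<forall>K\<in>T. (\<exists>t. nS \<le> card (patch_iter T t K)) \<and>
        (\<forall>p\<in>poly_space m. (\<forall>x\<in>patch_points T nS K. p x = 0) \<longrightarrow> p = (\<lambda>x. 0)))"

(* The sum over the points of I(K) is indexed by the elements of the patch, whose
   barycenters are pairwise distinct. *)
definition local_reconstruction :: "(real ^ 'd) set set \<Rightarrow> nat \<Rightarrow> nat \<Rightarrow> ('d, real) broken
    \<Rightarrow> (real ^ 'd) set \<Rightarrow> real ^ 'd \<Rightarrow> real" where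
  "local_reconstruction T nS m v K =
     (THE p. is_arg_min
        (\<lambda>p. \<Sum>K'\<in>patch T nS K. (p (barycenter K') - v K' (barycenter K'))\<^sup>2)
        (\<lambda>p. p \<in> poly_space m \<and> p (barycenter K) = v K (barycenter K)) p)"

definition reconstruction :: "(real ^ 'd) set set \<Rightarrow> nat \<Rightarrow> nat \<Rightarrow> ('d, real) broken
    \<Rightarrow> ('d, real) broken" where
  "reconstruction T nS m v = (\<lambda>K. local_reconstruction T nS m v K)"

(* Both suprema are attained under the unisolvence condition above. *)
definition Lambda_local :: "(real ^ 'd) set set \<Rightarrow> nat \<Rightarrow> nat \<Rightarrow> (real ^ 'd) set \<Rightarrow> real" where
  "Lambda_local T nS m K =
     (SUP p\<in>poly_space m - {\<lambda>x. 0}.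
        (SUP x\<in>\<Union>(patch T nS K). \<bar>p x\<bar>) / (MAX x\<in>patch_points T nS K. \<bar>p x\<bar>))"

definition Lambda :: "(real ^ 'd) set set \<Rightarrow> nat \<Rightarrow> nat \<Rightarrow> real" where
  "Lambda T nS m = (MAX K\<in>T. Lambda_local T nS m K)"

definition Lambda_bar :: "(real ^ 'd) set set \<Rightarrow> nat \<Rightarrow> nat \<Rightarrow> real" where
  "Lambda_bar T nS m = (MAX K\<in>T. 1 + Lambda T nS m * sqrt (real (card (patch T nS K))))"

section \<open>Bilinear forms and matrices\<close>

definition spd :: "real ^ 'd ^ 'd \<Rightarrow> bool" where
  "spd A \<longleftrightarrow> transpose A = A \<and> (\<forall>x. x \<noteq> 0 \<longrightarrow> x \<bullet> (A *v x) > 0)"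

definition flux :: "real ^ 'd ^ 'd \<Rightarrow> ('d, real) broken \<Rightarrow> ('d, real ^ 'd) broken" where
  "flux A u K x = A *v grad (u K) x"

definition dg_form :: "real ^ 'd ^ 'd \<Rightarrow> real \<Rightarrow> real \<Rightarrow> (real ^ 'd) set set
    \<Rightarrow> ('d, real) broken \<Rightarrow> ('d, real) broken \<Rightarrow> real" where
  "dg_form A \<theta> \<mu> T u v =
     (\<Sum>K\<in>T. LINT x:K|lborel. flux A u K x \<bullet> grad (v K) x)
     - (\<Sum>e\<in>faces T. surface_integral e (\<lambda>x. avg T e (flux A u) x \<bullet> jump T e v x))
     + \<theta> * (\<Sum>e\<in>faces T. surface_integral e (\<lambda>x. avg T e (flux A v) x \<bullet> jump T e u x))
     + (\<Sum>e\<in>faces T. surface_integral e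
          (\<lambda>x. \<mu> * inverse (diameter e) * (jump T e u x \<bullet> jump T e v x)))"

definition dg_form0 :: "(real ^ 'd) set set \<Rightarrow> ('d, real) broken \<Rightarrow> ('d, real) broken \<Rightarrow> real" where
  "dg_form0 T v w =
     (\<Sum>e\<in>faces T. surface_integral e
        (\<lambda>x. inverse (diameter e) * (jump T e v x \<bullet> jump T e w x)))"

definition element_indicator :: "(real ^ 'd) set \<Rightarrow> ('d, real) broken" where
  "element_indicator K0 = (\<lambda>K x. if K = K0 then 1 else 0)"

(* The list Ks enumerates the elements of the mesh. *)
definition matrix_dg :: "real ^ 'd ^ 'd \<Rightarrow> real \<Rightarrow> real \<Rightarrow> nat \<Rightarrow> nat \<Rightarrow> (real ^ 'd) set list
    \<Rightarrow> real Matrix.mat" where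
  "matrix_dg A \<theta> \<mu> nS m Ks = Matrix.mat (length Ks) (length Ks) (\<lambda>(i, j).
     dg_form A \<theta> \<mu> (set Ks)
       (reconstruction (set Ks) nS m (element_indicator (Ks ! i)))
       (reconstruction (set Ks) nS m (element_indicator (Ks ! j))))"

definition matrix_dg0 :: "(real ^ 'd) set list \<Rightarrow> real Matrix.mat" where
  "matrix_dg0 Ks = Matrix.mat (length Ks) (length Ks) (\<lambda>(i, j).
     dg_form0 (set Ks) (element_indicator (Ks ! i)) (element_indicator (Ks ! j)))"

section \<open>Condition number\<close>

definition energy_norm :: "real Matrix.mat \<Rightarrow> real Matrix.vec \<Rightarrow> real" where
  "energy_norm A0 v = sqrt (scalar_prod v (A0 *\<^sub>v v))"

definition energy_op_norm :: "real Matrix.mat \<Rightarrow> real Matrix.mat \<Rightarrow> real" where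
  "energy_op_norm A0 B =
     (SUP v\<in>carrier_vec (dim_row A0) - {0\<^sub>v (dim_row A0)}.
        energy_norm A0 (B *\<^sub>v v) / energy_norm A0 v)"

(* The inverse of B is meaningful only for invertible B. *)
definition condition_number :: "real Matrix.mat \<Rightarrow> real Matrix.mat \<Rightarrow> real" where
  "condition_number A0 B = energy_op_norm A0 B * energy_op_norm A0 (the (mat_inverse B))"

definition preconditioned :: "real Matrix.mat \<Rightarrow> real Matrix.mat \<Rightarrow> real Matrix.mat" where
  "preconditioned A0 M = the (mat_inverse A0) * M"

end

theory Submission
  imports Defs "Jordan_Normal_Form.Determinant"
begin

text \<open>
  The two matrices are compared through one mesh-dependent energy of broken polynomials, the sum
  of the squared \<open>L\<^sup>2\<close> norms of the elementwise gradients and of the \<open>h\<^sub>e\<^sup>-\<^sup>1\<close>-weighted squared jumps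
  (\<open>dg_energy\<close>). For a piecewise constant function \<open>v\<close> this energy is its jump part, which is the
  quadratic form of \<open>A\<^sub>0\<close>. Write \<open>u = R v\<close> for the reconstruction. Four facts, with constants that do
  not depend on the mesh, carry the theorem.

  The discontinuous Galerkin form is bounded by the energy (\<open>dg_form_bounded\<close>) and coercive
  (\<open>dg_form_coercive\<close>). Both rest on the trace inequality \<open>avg_flux_energy\<close>, which controls the
  consistency terms. In the skew case \<open>\<theta> = 1\<close> these terms cancel on the diagonal; for \<open>\<theta> = -1\<close> a
  large penalty absorbs them.

  The energy of \<open>v\<close> is bounded by that of \<open>u\<close> (\<open>const_energy_le\<close>): since \<open>u\<close> interpolates \<open>v\<close> at the
  barycenters, \<open>u\<close> and \<open>v\<close> differ on an element by at most its diameter times the largest gradient.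

  Conversely the energy of \<open>u\<close> is bounded by the square of \<open>Lambda_bar\<close> times that of \<open>v\<close>
  (\<open>reconstruction_energy_le\<close>). By the normal equations the reconstruction does not increase the
  discrete norm of \<open>v - v\<^sub>K\<close> over the patch of \<open>K\<close>, and \<open>\<Lambda>\<close> passes from sampling points to the whole
  patch (\<open>reconstruction_stable\<close>). The remaining differences of values of \<open>v\<close> in a patch are sums of
  jumps along a chain of elements. As the domain is convex, such a chain is read off a straight
  segment between two elements; a generic segment avoids all faces of codimension two, so that
  consecutive elements share a facet (\<open>element_chain\<close>). Counting disjoint inscribed balls bounds the
  length of the chains and their overlap (\<open>sum_patch_differences_le\<close>).

  No reference simplex is used. Quasi-uniformity places every element between two concentric balls
  of comparable radii, and the inverse inequalities for polynomials on balls
  (\<open>grad_inverse_L2\<close>, \<open>grad_inverse_sup\<close>) follow from scaling and finite dimension.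

  Finally, bounds of the two bilinear forms turn into a bound of the condition number by a purely
  algebraic argument (\<open>condition_number_le\<close>). That \<open>A\<^sub>0\<close> is definite is again a chain argument: a
  function without jumps is constant, and it vanishes at a boundary facet, which exists because the
  mesh is bounded (\<open>ex_boundary_face\<close>).
\<close>

(* The symbols shared by the geometric and the matrix theories keep their geometric meaning. *)
no_notation vec_index (infixl "$" 100)
no_notation scalar_prod (infix "\<bullet>" 70)

section \<open>Semidefinite forms on finitely generated function spaces\<close>

text \<open>
  The linear span, as a recursion on a list of generators, since the proofs below add one generator
  at a time.
\<close>

fun fspan :: "('a \<Rightarrow> real) list \<Rightarrow> ('a \<Rightarrow> real) set" where
  "fspan [] = {\<lambda>x. 0}"
| "fspan (f # fs) = {\<lambda>x. t * f x + q x | t q. q \<in> fspan fs}"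

text \<open>
  One abstract form serves three purposes: the \<open>L\<^sup>2\<close> inner products behind the inverse inequalities,
  the discrete inner product of the least squares fit, and the finiteness of the constant \<open>\<Lambda>\<close>.
\<close>

locale psd_form =
  fixes V :: "('a \<Rightarrow> real) set" and B :: "('a \<Rightarrow> real) \<Rightarrow> ('a \<Rightarrow> real) \<Rightarrow> real"
  assumes zero: "(\<lambda>x. 0) \<in> V"
    and comb: "\<And>p q t. p \<in> V \<Longrightarrow> q \<in> V \<Longrightarrow> (\<lambda>x. t * p x + q x) \<in> V"
    and B_comb: "\<And>p q s t. p \<in> V \<Longrightarrow> q \<in> V \<Longrightarrow> s \<in> V \<Longrightarrow> B (\<lambda>x. t * p x + q x) s = t * B p s + B q s"
    and sym: "\<And>p q. p \<in> V \<Longrightarrow> q \<in> V \<Longrightarrow> B p q = B q p"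
    and nonneg: "\<And>p. p \<in> V \<Longrightarrow> B p p \<ge> 0"
begin

lemma B_comb_right: "p \<in> V \<Longrightarrow> q \<in> V \<Longrightarrow> s \<in> V \<Longrightarrow> B s (\<lambda>x. t * p x + q x) = t * B s p + B s q"
  using B_comb[of p q s t] sym comb by metis

lemma fspan_subset: "set fs \<subseteq> V \<Longrightarrow> fspan fs \<subseteq> V"
  by (induction fs) (auto simp: zero intro!: comb)

text \<open>
  The degenerate case of the Cauchy-Schwarz inequality, which is all that is needed to project onto
  a space on which the form is only semidefinite.
\<close>

lemma null_orthogonal:
  assumes r: "r \<in> V" "B r r = 0" and x: "x \<in> V"
  shows "B x r = 0"
proof (rule ccontr)
  assume n: "B x r \<noteq> 0"
  \<comment> \<open>This value makes the quadratic form at \<open>t r + x\<close> equal to \<open>-1\<close>.\<close>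
  define t where "t = - (B x x + 1) / (2 * B x r)"
  have "0 \<le> B (\<lambda>y. t * r y + x y) (\<lambda>y. t * r y + x y)"
    by (intro nonneg comb r x)
  also have "\<dots> = t * (t * B r r + B x r) + (t * B x r + B x x)"
    using r x comb[OF r(1) x] by (simp add: B_comb B_comb_right sym)
  also have "\<dots> = 2 * t * B x r + B x x" by (simp add: r)
  also have "\<dots> = - 1" using n by (simp add: t_def field_simps)
  finally show False by simp
qed

end

lemma fspan_comb: "p \<in> fspan fs \<Longrightarrow> q \<in> fspan fs \<Longrightarrow> (\<lambda>x. t * p x + q x) \<in> fspan fs"
proof (induction fs arbitrary: p q)
  case Nil
  then show ?case by simp
next
  case (Cons f fs)
  from Cons.prems obtain a p' b q' where
    p: "p = (\<lambda>x. a * f x + p' x)" "p' \<in> fspan fs" and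
    q: "q = (\<lambda>x. b * f x + q' x)" "q' \<in> fspan fs" by auto
  have "(\<lambda>x. t * p x + q x) = (\<lambda>x. (t * a + b) * f x + (t * p' x + q' x))"
    by (auto simp: p q algebra_simps)
  with Cons.IH[OF p(2) q(2)] show ?case by auto
qed

lemma fspan_zero: "(\<lambda>x. 0) \<in> fspan fs"
proof (induction fs)
  case (Cons f fs)
  have "\<exists>t q. (\<lambda>x. 0) = (\<lambda>x. t * f x + q x) \<and> q \<in> fspan fs"
    by (intro exI[of _ 0] exI[of _ "\<lambda>x. 0"]) (simp add: Cons)
  then show ?case by simp
qed simp

context psd_form begin

text \<open>
  Gram-Schmidt: the new generator is replaced by its residual \<open>r\<close>, which is orthogonal to the old
  span; if \<open>r\<close> is null, it needs no correction at all.
\<close>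

lemma projection:
  assumes "set fs \<subseteq> V" "f \<in> V"
  shows "\<exists>g\<in>fspan fs. \<forall>q\<in>fspan fs. B (\<lambda>x. f x - g x) q = 0"
  using assms
proof (induction fs arbitrary: f)
  case Nil
  have "B f (\<lambda>x. 0 * f x + f x) = 0 * B f f + B f f" by (rule B_comb_right) (use Nil in auto)
  have "B f (\<lambda>x. -1 * f x + f x) = -1 * B f f + B f f" by (rule B_comb_right) (use Nil in auto)
  then show ?case by simp
next
  case (Cons b fs)
  have fsV: "fspan fs \<subseteq> V" using Cons.prems by (intro fspan_subset) auto
  obtain g where g: "g \<in> fspan fs" "\<And>q. q \<in> fspan fs \<Longrightarrow> B (\<lambda>x. f x - g x) q = 0"
    using Cons by (metis list.set_intros(2) subset_code(1))
  obtain gb where gb: "gb \<in> fspan fs" "\<And>q. q \<in> fspan fs \<Longrightarrow> B (\<lambda>x. b x - gb x) q = 0"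
    using Cons by (metis list.set_intros subset_code(1))
  define r where "r = (\<lambda>x. b x - gb x)"
  define w where "w = (\<lambda>x. f x - g x)"
  have rV: "r \<in> V" unfolding r_def using comb[of gb b "-1"] gb fsV Cons.prems by auto
  have wV: "w \<in> V" unfolding w_def using comb[of g f "-1"] g fsV Cons.prems by auto
  define s where "s = (if B r r = 0 then 0 else B w r / B r r)"
  have s: "B w r = s * B r r"
    using null_orthogonal[OF rV _ wV] by (auto simp: s_def)
  define h where "h = (\<lambda>x. s * b x + (- s * gb x + g x))"
  have hs: "h \<in> fspan (b # fs)"
    unfolding h_def using fspan_comb[OF gb(1) g(1), of "- s"] by auto
  have fh: "(\<lambda>x. f x - h x) = (\<lambda>x. - s * r x + w x)"
    by (auto simp: h_def r_def w_def algebra_simps)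
  have "B (\<lambda>x. f x - h x) q = 0" if q: "q \<in> fspan (b # fs)" for q
  proof -
    obtain t q' where q': "q = (\<lambda>x. t * b x + q' x)" "q' \<in> fspan fs" using q by auto
    define z where "z = (\<lambda>x. t * gb x + q' x)"
    have z: "z \<in> fspan fs" unfolding z_def by (intro fspan_comb gb q')
    then have zV: "z \<in> V" using fsV by auto
    have qz: "q = (\<lambda>x. t * r x + z x)" by (auto simp: q' z_def r_def algebra_simps)
    have 1: "B r z = 0" "B w z = 0" using gb(2)[OF z] g(2)[OF z] by (auto simp: r_def w_def)
    have "B (\<lambda>x. f x - h x) q = - s * B r q + B w q"
      unfolding fh by (rule B_comb) (use rV wV qz zV comb in auto)
    also have "\<dots> = - s * (t * B r r + B r z) + (t * B w r + B w z)"
      unfolding qz using rV wV zV by (simp only: B_comb_right)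
    also have "\<dots> = 0" using 1 s by (simp add: algebra_simps)
    finally show ?thesis .
  qed
  with hs show ?case by blast
qed

text \<open>
  Equivalence of norms in finite dimension, in a form that applies to several seminorms at once: a
  family of functionals, bounded on each generator and vanishing on the null space of the form, is
  uniformly bounded by the seminorm of the form. The induction over the generators splits off the
  component along the residual \<open>r\<close> and uses Pythagoras.
\<close>

lemma functionals_bounded:
  assumes "set fs \<subseteq> V"
    and lin: "\<And>l p q t. l \<in> L \<Longrightarrow> p \<in> V \<Longrightarrow> q \<in> V \<Longrightarrow> l (\<lambda>x. t * p x + q x) = t * l p + l q"
    and bdd: "\<And>f. f \<in> set fs \<Longrightarrow> \<exists>b. \<forall>l\<in>L. \<bar>l f :: real\<bar> \<le> b"
    and ker: "\<And>p l. p \<in> fspan fs \<Longrightarrow> B p p = 0 \<Longrightarrow> l \<in> L \<Longrightarrow> l p = 0"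
  shows "\<exists>C\<ge>0. \<forall>p\<in>fspan fs. \<forall>l\<in>L. \<bar>l p\<bar> \<le> C * sqrt (B p p)"
  using assms(1,3,4)
proof (induction fs)
  case Nil
  have "\<bar>l (\<lambda>x. 0)\<bar> \<le> 0 * sqrt (B (\<lambda>x. 0) (\<lambda>x. 0))" if "l \<in> L" for l
    using lin[OF that zero zero, of 1] by simp
  then show ?case by auto
next
  case (Cons b fs)
  have fsV: "fspan fs \<subseteq> V" using Cons.prems by (intro fspan_subset) auto
  have sub: "p \<in> fspan (b # fs)" if "p \<in> fspan fs" for p
  proof -
    have "(\<lambda>x. 0 * b x + p x) \<in> fspan (b # fs)" using that unfolding fspan.simps by blast
    then show ?thesis by simp
  qed
  have "\<exists>C\<ge>0. \<forall>p\<in>fspan fs. \<forall>l\<in>L. \<bar>l p\<bar> \<le> C * sqrt (B p p)"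
    by (rule Cons.IH) (use Cons.prems sub in auto)
  then obtain C where C: "C \<ge> 0" "\<And>p l. p \<in> fspan fs \<Longrightarrow> l \<in> L \<Longrightarrow> \<bar>l p\<bar> \<le> C * sqrt (B p p)" by blast
  obtain gb where gb: "gb \<in> fspan fs" "\<And>q. q \<in> fspan fs \<Longrightarrow> B (\<lambda>x. b x - gb x) q = 0"
    using projection[of fs b] Cons.prems by auto
  define r where "r = (\<lambda>x. b x - gb x)"
  have rV: "r \<in> V" unfolding r_def using comb[of gb b "-1"] gb fsV Cons.prems by auto
  have rs: "r \<in> fspan (b # fs)"
  proof -
    have "(\<lambda>x. - 1 * gb x + 0) \<in> fspan fs" by (intro fspan_comb gb fspan_zero)
    then have "\<exists>t q. (\<lambda>x. b x - gb x) = (\<lambda>x. t * b x + q x) \<and> q \<in> fspan fs"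
      by (intro exI[of _ 1] exI[of _ "\<lambda>x. - 1 * gb x + 0"]) simp
    then show ?thesis by (simp add: r_def)
  qed
  obtain b1 where b1: "\<And>l. l \<in> L \<Longrightarrow> \<bar>l b\<bar> \<le> b1" using Cons.prems(2)[of b] by auto
  define D where "D = b1 + C * sqrt (B gb gb)"
  have lr: "\<bar>l r\<bar> \<le> D" if l: "l \<in> L" for l
  proof -
    have "l r = l (\<lambda>x. - 1 * gb x + b x)" by (simp add: r_def)
    also have "\<dots> = - 1 * l gb + l b" by (rule lin[OF l]) (use gb fsV Cons.prems in auto)
    finally show ?thesis using b1[OF l] C(2)[OF gb(1) l] by (simp add: D_def)
  qed
  define E where "E = C + (if B r r = 0 then 0 else \<bar>D\<bar> / sqrt (B r r))"
  have "E \<ge> 0" using C nonneg[OF rV] by (simp add: E_def)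
  moreover have "\<bar>l p\<bar> \<le> E * sqrt (B p p)" if p: "p \<in> fspan (b # fs)" and l: "l \<in> L" for p l
  proof -
    obtain t q' where q': "p = (\<lambda>x. t * b x + q' x)" "q' \<in> fspan fs" using p by auto
    define z where "z = (\<lambda>x. t * gb x + q' x)"
    have z: "z \<in> fspan fs" unfolding z_def by (intro fspan_comb gb q')
    then have zV: "z \<in> V" using fsV by auto
    have pz: "p = (\<lambda>x. t * r x + z x)" by (auto simp: q' z_def r_def algebra_simps)
    have rz: "B r z = 0" using gb(2)[OF z] by (simp add: r_def)
    have "B p p = t * (t * B r r + B r z) + (t * B z r + B z z)"
      unfolding pz using rV zV comb[OF rV zV] by (simp only: B_comb B_comb_right)
    then have Bp: "B p p = t\<^sup>2 * B r r + B z z"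
      using rz sym[OF rV zV] by (simp add: power2_eq_square algebra_simps)
    have lp: "l p = t * l r + l z" unfolding pz by (rule lin[OF l rV zV])
    have s1: "sqrt (B z z) \<le> sqrt (B p p)" using nonneg[OF rV] by (simp add: Bp)
    show ?thesis
    proof (cases "B r r = 0")
      case True
      then have "l r = 0" using Cons.prems(3)[OF rs _ l] by simp
      then have "\<bar>l p\<bar> \<le> C * sqrt (B z z)" using C(2)[OF z l] by (simp add: lp)
      also have "\<dots> \<le> C * sqrt (B p p)" using s1 C(1) by (rule mult_left_mono)
      finally show ?thesis using True by (simp add: E_def)
    next
      case False
      then have pos: "B r r > 0" using nonneg[OF rV] by simp
      have "\<bar>t\<bar> * sqrt (B r r) = sqrt (t\<^sup>2 * B r r)" by (simp add: real_sqrt_mult)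
      also have "\<dots> \<le> sqrt (B p p)" using nonneg[OF zV] by (simp add: Bp)
      finally have t: "\<bar>t\<bar> \<le> sqrt (B p p) / sqrt (B r r)" using pos by (simp add: field_simps)
      have "\<bar>l p\<bar> \<le> \<bar>t\<bar> * \<bar>l r\<bar> + \<bar>l z\<bar>" by (simp add: lp abs_mult[symmetric])
      also have "\<dots> \<le> (sqrt (B p p) / sqrt (B r r)) * \<bar>D\<bar> + C * sqrt (B p p)"
      proof (intro add_mono mult_mono t)
        show "\<bar>l r\<bar> \<le> \<bar>D\<bar>" using lr[OF l] by simp
        have "\<bar>l z\<bar> \<le> C * sqrt (B z z)" by (rule C(2)[OF z l])
        also have "\<dots> \<le> C * sqrt (B p p)" using s1 C(1) by (rule mult_left_mono)
        finally show "\<bar>l z\<bar> \<le> C * sqrt (B p p)" .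
      next
        have "B p p \<ge> 0" using Bp nonneg[OF zV] pos by simp
        then show "0 \<le> sqrt (B p p) / sqrt (B r r)" using pos by simp
      qed simp
      also have "\<dots> = E * sqrt (B p p)" using False by (simp add: E_def field_simps)
      finally show ?thesis .
    qed
  qed
  ultimately show ?case by blast
qed

end

section \<open>Polynomials of several variables\<close>

definition monomial :: "('d \<Rightarrow> nat) \<Rightarrow> real ^ 'd \<Rightarrow> real" where
  "monomial \<alpha> x = (\<Prod>i\<in>UNIV. (x $ i) ^ \<alpha> i)"

lemma finite_multi_indices: "finite {\<alpha> :: 'd::finite \<Rightarrow> nat. (\<Sum>i\<in>UNIV. \<alpha> i) \<le> m}"
proof (rule finite_subset)
  show "{\<alpha> :: 'd \<Rightarrow> nat. (\<Sum>i\<in>UNIV. \<alpha> i) \<le> m} \<subseteq> PiE UNIV (\<lambda>_. {..m})"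
  proof
    fix \<alpha> :: "'d \<Rightarrow> nat" assume "\<alpha> \<in> {\<alpha>. (\<Sum>i\<in>UNIV. \<alpha> i) \<le> m}"
    then have "\<alpha> i \<le> m" for i
      using member_le_sum[of i UNIV \<alpha>] by auto
    then show "\<alpha> \<in> PiE UNIV (\<lambda>_. {..m})" by auto
  qed
qed (intro finite_PiE; simp)

lemma poly_space_alt:
  "p \<in> poly_space m \<longleftrightarrow> (\<exists>c. p = (\<lambda>x. \<Sum>\<alpha> | (\<Sum>i\<in>UNIV. \<alpha> i) \<le> m. c \<alpha> * monomial \<alpha> x))"
  by (simp add: poly_space_def monomial_def)

lemma poly_space_zero: "(\<lambda>x. 0) \<in> poly_space m"
  unfolding poly_space_alt by (rule exI[of _ "\<lambda>_. 0"]) simp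

lemma poly_space_comb:
  assumes "p \<in> poly_space m" "q \<in> poly_space m"
  shows "(\<lambda>x. t * p x + q x) \<in> poly_space m"
proof -
  obtain c d where "p = (\<lambda>x. \<Sum>\<alpha> | (\<Sum>i\<in>UNIV. \<alpha> i) \<le> m. c \<alpha> * monomial \<alpha> x)"
    "q = (\<lambda>x. \<Sum>\<alpha> | (\<Sum>i\<in>UNIV. \<alpha> i) \<le> m. d \<alpha> * monomial \<alpha> x)"
    using assms unfolding poly_space_alt by blast
  then show ?thesis unfolding poly_space_alt
    by (intro exI[of _ "\<lambda>\<alpha>. t * c \<alpha> + d \<alpha>"])
       (simp add: sum_distrib_left sum.distrib algebra_simps)
qed

lemma poly_space_scale: "p \<in> poly_space m \<Longrightarrow> (\<lambda>x. t * p x) \<in> poly_space m"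
  using poly_space_comb[OF _ poly_space_zero] by simp

lemma poly_space_sum:
  "finite J \<Longrightarrow> (\<And>j. j \<in> J \<Longrightarrow> f j \<in> poly_space m) \<Longrightarrow> (\<lambda>x. \<Sum>j\<in>J. c j * f j x) \<in> poly_space m"
proof (induction J rule: finite_induct)
  case (insert j J)
  then show ?case using poly_space_comb[of "f j" m "\<lambda>x. \<Sum>j\<in>J. c j * f j x" "c j"] by auto
qed (simp add: poly_space_zero)

lemma monomial_in_poly_space:
  assumes "(\<Sum>i\<in>UNIV. \<alpha> i) \<le> m" shows "monomial \<alpha> \<in> poly_space m"
  unfolding poly_space_alt
proof (intro exI ext)
  fix x
  have "(\<Sum>\<beta> | (\<Sum>i\<in>UNIV. \<beta> i) \<le> m. (if \<beta> = \<alpha> then 1 else 0) * monomial \<beta> x)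
      = (\<Sum>\<beta> | (\<Sum>i\<in>UNIV. \<beta> i) \<le> m. (if \<beta> = \<alpha> then monomial \<beta> x else 0))"
    by (rule sum.cong) auto
  also have "\<dots> = monomial \<alpha> x" using assms by (simp add: finite_multi_indices)
  finally show "monomial \<alpha> x = (\<Sum>\<beta> | (\<Sum>i\<in>UNIV. \<beta> i) \<le> m. (if \<beta> = \<alpha> then 1 else 0) * monomial \<beta> x)" ..
qed

lemma poly_space_const: "(\<lambda>x. c) \<in> poly_space m"
proof -
  have "(\<lambda>x. c * monomial (\<lambda>_. 0) x) \<in> poly_space m"
    by (intro poly_space_scale monomial_in_poly_space) simp
  then show ?thesis by (simp add: monomial_def)
qed

lemma poly_space_mult:
  assumes "p \<in> poly_space a" "q \<in> poly_space b"
  shows "(\<lambda>x. p x * q x) \<in> poly_space (a + b)"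
proof -
  obtain c d where p: "p = (\<lambda>x. \<Sum>\<alpha> | (\<Sum>i\<in>UNIV. \<alpha> i) \<le> a. c \<alpha> * monomial \<alpha> x)"
    and q: "q = (\<lambda>x. \<Sum>\<alpha> | (\<Sum>i\<in>UNIV. \<alpha> i) \<le> b. d \<alpha> * monomial \<alpha> x)"
    using assms unfolding poly_space_alt by blast
  have mm: "monomial \<alpha> x * monomial \<beta> x = monomial (\<lambda>i. \<alpha> i + \<beta> i) x" for \<alpha> \<beta> and x :: "real ^ 'a"
    by (simp add: monomial_def prod.distrib power_add)
  have "(\<lambda>x. p x * q x) = (\<lambda>x. \<Sum>\<alpha> | (\<Sum>i\<in>UNIV. \<alpha> i) \<le> a. c \<alpha> *
      (\<Sum>\<beta> | (\<Sum>i\<in>UNIV. \<beta> i) \<le> b. d \<beta> * monomial (\<lambda>i. \<alpha> i + \<beta> i) x))"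
    unfolding p q sum_distrib_left sum_distrib_right
    by (subst sum.swap, intro ext sum.cong refl, subst mm[symmetric], simp)
  also have "\<dots> \<in> poly_space (a + b)"
    by (intro poly_space_sum finite_multi_indices monomial_in_poly_space) (auto simp: sum.distrib)
  finally show ?thesis .
qed

lemma poly_space_affine:
  assumes "p \<in> poly_space m"
  shows "(\<lambda>x. p (c + r *\<^sub>R x)) \<in> poly_space m"
proof -
  have coord: "(\<lambda>x. (c + r *\<^sub>R x) $ i) \<in> poly_space 1" for i
  proof -
    have "(\<lambda>x. r * monomial (\<lambda>j. if j = i then 1 else 0) x + c $ i) \<in> poly_space 1"
      by (intro poly_space_comb monomial_in_poly_space poly_space_const) simp
    moreover have "monomial (\<lambda>j. if j = i then 1 else 0) x = x $ i" for x :: "real ^ 'a"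
    proof -
      have "monomial (\<lambda>j. if j = i then 1 else 0) x = (\<Prod>j\<in>UNIV. if j = i then x $ i else 1)"
        unfolding monomial_def by (rule prod.cong) auto
      then show ?thesis by simp
    qed
    ultimately show ?thesis by (simp add: add.commute)
  qed
  have pow: "(\<lambda>x. ((c + r *\<^sub>R x) $ i) ^ k) \<in> poly_space k" for i k
  proof (induction k)
    case (Suc k)
    then show ?case using poly_space_mult[OF coord[of i] Suc] by simp
  qed (simp add: poly_space_const)
  have prod: "(\<lambda>x. \<Prod>i\<in>I. ((c + r *\<^sub>R x) $ i) ^ \<alpha> i) \<in> poly_space (\<Sum>i\<in>I. \<alpha> i)" if "finite I" for I \<alpha>
    using that
  proof (induction I rule: finite_induct)
    case (insert i I)
    then show ?case using poly_space_mult[OF pow[of i "\<alpha> i"] insert.IH] by simp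
  qed (simp add: poly_space_const)
  have mono: "p \<in> poly_space m" if "p \<in> poly_space k" "k \<le> m" for p :: "real ^ 'a \<Rightarrow> real" and k
  proof -
    obtain d where p: "p = (\<lambda>x. \<Sum>\<alpha> | (\<Sum>i\<in>UNIV. \<alpha> i) \<le> k. d \<alpha> * monomial \<alpha> x)"
      using \<open>p \<in> poly_space k\<close> unfolding poly_space_alt by blast
    show ?thesis unfolding p
      by (intro poly_space_sum finite_multi_indices monomial_in_poly_space) (use \<open>k \<le> m\<close> in auto)
  qed
  obtain d where p: "p = (\<lambda>x. \<Sum>\<alpha> | (\<Sum>i\<in>UNIV. \<alpha> i) \<le> m. d \<alpha> * monomial \<alpha> x)"
    using assms unfolding poly_space_alt by blast
  have "(\<lambda>x. monomial \<alpha> (c + r *\<^sub>R x)) \<in> poly_space m" if "(\<Sum>i\<in>UNIV. \<alpha> i) \<le> m" for \<alpha>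
    unfolding monomial_def by (rule mono[OF prod[of UNIV \<alpha>] that]) simp
  then show ?thesis unfolding p
    by (intro poly_space_sum finite_multi_indices) auto
qed

lemma poly_space_fspan: "\<exists>fs. set fs \<subseteq> poly_space m \<and> fspan fs = poly_space m"
proof -
  obtain js where js: "set js = {\<alpha> :: 'a \<Rightarrow> nat. (\<Sum>i\<in>UNIV. \<alpha> i) \<le> m}" "distinct js"
    using finite_distinct_list[OF finite_multi_indices] by blast
  have gen: "fspan (map monomial ks) = {p. \<exists>c. p = (\<lambda>x. \<Sum>\<alpha>\<in>set ks. c \<alpha> * monomial \<alpha> x)}"
    if "distinct ks" for ks :: "('a \<Rightarrow> nat) list"
    using that
  proof (induction ks)
    case (Cons k ks)
    show ?case
    proof (intro subset_antisym subsetI)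
      fix p assume "p \<in> fspan (map monomial (k # ks))"
      then obtain t c where p: "p = (\<lambda>x. t * monomial k x + (\<Sum>\<alpha>\<in>set ks. c \<alpha> * monomial \<alpha> x))"
        using Cons by auto
      have "p = (\<lambda>x. \<Sum>\<alpha>\<in>set (k # ks). (c(k := t)) \<alpha> * monomial \<alpha> x)"
        using Cons.prems unfolding p by (auto intro!: ext sum.cong)
      then show "p \<in> {p. \<exists>c. p = (\<lambda>x. \<Sum>\<alpha>\<in>set (k # ks). c \<alpha> * monomial \<alpha> x)}" by blast
    next
      fix p assume "p \<in> {p. \<exists>c. p = (\<lambda>x. \<Sum>\<alpha>\<in>set (k # ks). c \<alpha> * monomial \<alpha> x)}"
      then obtain c where "p = (\<lambda>x. \<Sum>\<alpha>\<in>set (k # ks). c \<alpha> * monomial \<alpha> x)" by blast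
      then have "p = (\<lambda>x. c k * monomial k x + (\<Sum>\<alpha>\<in>set ks. c \<alpha> * monomial \<alpha> x))"
        using Cons.prems by auto
      then show "p \<in> fspan (map monomial (k # ks))"
        using Cons by (fastforce intro!: exI[of _ "c k"] exI[of _ "\<lambda>x. \<Sum>\<alpha>\<in>set ks. c \<alpha> * monomial \<alpha> x"])
    qed
  qed simp
  have "fspan (map monomial js) = poly_space m"
    unfolding gen[OF js(2)] using poly_space_alt js(1) by auto
  moreover have "set (map monomial js) \<subseteq> poly_space m"
    using js monomial_in_poly_space by auto
  ultimately show ?thesis by blast
qed

text \<open>
  Along every line through the centre the polynomial is a polynomial in one variable that vanishes
  on an interval.
\<close>

lemma poly_zero_on_ball:
  assumes p: "p \<in> poly_space m" and r: "r > 0" and z: "\<And>x. x \<in> ball c r \<Longrightarrow> p x = 0"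
  shows "p = (\<lambda>x. 0)"
proof
  fix x
  define q where "q = (\<lambda>x. p (c + 1 *\<^sub>R x))"
  have "q \<in> poly_space m" unfolding q_def by (rule poly_space_affine[OF p])
  then obtain d where q: "q = (\<lambda>x. \<Sum>\<alpha> | (\<Sum>i\<in>UNIV. \<alpha> i) \<le> m. d \<alpha> * monomial \<alpha> x)"
    unfolding poly_space_alt by blast
  define y where "y = x - c"
  define P where "P = (\<Sum>\<alpha> | (\<Sum>i\<in>UNIV. \<alpha> i) \<le> m. monom (d \<alpha> * monomial \<alpha> y) (\<Sum>i\<in>UNIV. \<alpha> i))"
  have P: "poly P t = q (t *\<^sub>R y)" for t
  proof -
    have "monomial \<alpha> (t *\<^sub>R y) = t ^ (\<Sum>i\<in>UNIV. \<alpha> i) * monomial \<alpha> y" for \<alpha>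
      by (simp add: monomial_def power_mult_distrib prod.distrib power_sum)
    then show ?thesis unfolding P_def q poly_sum
      by (intro sum.cong) (auto simp: poly_monom)
  qed
  define \<epsilon> where "\<epsilon> = r / (norm y + 1)"
  have "\<epsilon> > 0" using r by (simp add: \<epsilon>_def add_nonneg_pos)
  have "poly P t = 0" if "t \<in> {0<..<\<epsilon>}" for t
  proof -
    have "norm (t *\<^sub>R y) \<le> t * (norm y + 1)" using that by (simp add: algebra_simps)
    also have "\<dots> < \<epsilon> * (norm y + 1)" using that by (intro mult_strict_right_mono) (auto intro: add_nonneg_pos)
    also have "\<dots> = r" using add_nonneg_pos[of "norm y" 1] by (simp add: \<epsilon>_def)
    finally show ?thesis unfolding P q_def by (intro z) (simp add: dist_norm)
  qed
  then have "{0<..<\<epsilon>} \<subseteq> {t. poly P t = 0}" by auto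
  then have "infinite {t. poly P t = 0}" using \<open>\<epsilon> > 0\<close> infinite_Ioo infinite_super by blast
  then have "P = 0" using poly_roots_finite by blast
  then show "p x = 0" using P[of 1] by (simp add: q_def y_def)
qed

section \<open>Gradients\<close>

lemma grad_eq:
  assumes "GDERIV f x :> D" shows "grad f x = D"
  unfolding grad_def
proof (rule the_equality[where P = "\<lambda>D. GDERIV f x :> D", OF assms])
  fix E assume "GDERIV f x :> E"
  then have "(\<lambda>h. h \<bullet> E) = (\<lambda>h. h \<bullet> D)"
    using assms unfolding gderiv_def by (rule has_derivative_unique)
  then have "(E - D) \<bullet> E = (E - D) \<bullet> D" by meson
  then have "(E - D) \<bullet> (E - D) = 0" by (simp add: inner_diff_right)
  then show "E = D" by simp
qed

text \<open>
  The operator \<open>grad\<close> is a definite description, so differentiability has to be carried along for it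
  to be additive.
\<close>

definition C1_fun :: "(real ^ 'd \<Rightarrow> real) \<Rightarrow> bool" where
  "C1_fun f \<longleftrightarrow> (\<forall>x. GDERIV f x :> grad f x) \<and> continuous_on UNIV (grad f)"

lemma C1_funI:
  assumes "\<And>x. GDERIV f x :> D x" "continuous_on UNIV D" shows "C1_fun f"
proof -
  have "grad f = D" using grad_eq[OF assms(1)] by blast
  with assms show ?thesis by (simp add: C1_fun_def)
qed

lemma C1_fun_continuous: "C1_fun f \<Longrightarrow> continuous_on S f"
  unfolding C1_fun_def gderiv_def
  by (meson continuous_at_imp_continuous_on has_derivative_continuous)

lemma C1_fun_const: "C1_fun (\<lambda>x. c)"
  by (rule C1_funI[OF GDERIV_const]) (rule continuous_on_const)

lemma C1_fun_mult: "C1_fun f \<Longrightarrow> C1_fun g \<Longrightarrow> C1_fun (\<lambda>x. f x * g x)"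
  using C1_fun_continuous[of f UNIV] C1_fun_continuous[of g UNIV]
  by (intro C1_funI[OF GDERIV_mult]) (auto simp: C1_fun_def intro!: continuous_intros)

lemma C1_fun_add: "C1_fun f \<Longrightarrow> C1_fun g \<Longrightarrow> C1_fun (\<lambda>x. f x + g x)"
  by (intro C1_funI[OF GDERIV_add]) (auto simp: C1_fun_def intro!: continuous_intros)

lemma C1_fun_coord: "C1_fun (\<lambda>x. x $ i)"
proof (rule C1_funI)
  show "GDERIV (\<lambda>x. x $ i) x :> axis i 1" for x :: "real ^ 'a"
    unfolding gderiv_def inner_axis
    by (rule has_derivative_eq_rhs[OF bounded_linear.has_derivative[OF bounded_linear_vec_nth has_derivative_ident]]) simp
qed (rule continuous_on_const)

lemma C1_fun_comb: "C1_fun f \<Longrightarrow> C1_fun g \<Longrightarrow> C1_fun (\<lambda>x. t * f x + g x)"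
  by (intro C1_fun_add C1_fun_mult C1_fun_const)

lemma C1_fun_poly:
  assumes "p \<in> poly_space m" shows "C1_fun p"
proof -
  have "C1_fun (\<lambda>x. x $ i ^ k)" for i and k :: nat
    by (induction k) (auto intro: C1_fun_const C1_fun_mult[OF C1_fun_coord])
  note pow = this
  have "C1_fun (\<lambda>x. \<Prod>i\<in>I. x $ i ^ \<alpha> i)" if "finite I" for I :: "'a set" and \<alpha>
    using that by (induction I rule: finite_induct) (auto intro: C1_fun_const C1_fun_mult pow)
  then have mono: "C1_fun (monomial \<alpha>)" for \<alpha> :: "'a \<Rightarrow> nat"
    unfolding monomial_def[abs_def] by simp
  have "C1_fun (\<lambda>x. \<Sum>\<alpha>\<in>J. c \<alpha> * monomial \<alpha> x)" if "finite J" for J and c :: "('a \<Rightarrow> nat) \<Rightarrow> real"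
    using that by (induction J rule: finite_induct) (auto intro: C1_fun_const C1_fun_comb mono)
  then show ?thesis using assms finite_multi_indices unfolding poly_space_alt by auto
qed

lemma grad_comb:
  "C1_fun f \<Longrightarrow> C1_fun g \<Longrightarrow> grad (\<lambda>x. t * f x + g x) x = t *\<^sub>R grad f x + grad g x"
  by (rule grad_eq, rule GDERIV_subst[OF GDERIV_add[OF GDERIV_mult[OF GDERIV_const]]])
     (auto simp: C1_fun_def)

lemma grad_affine:
  assumes "C1_fun f" shows "grad (\<lambda>y. f (c + r *\<^sub>R y)) x = r *\<^sub>R grad f (c + r *\<^sub>R x)"
proof (rule grad_eq)
  have "((\<lambda>y. c + r *\<^sub>R y) has_derivative (\<lambda>h. r *\<^sub>R h)) (at x)"
    by (auto intro!: derivative_eq_intros)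
  moreover have "(f has_derivative (\<lambda>h. h \<bullet> grad f (c + r *\<^sub>R x))) (at (c + r *\<^sub>R x))"
    using assms by (simp add: C1_fun_def gderiv_def)
  ultimately have "((\<lambda>y. f (c + r *\<^sub>R y)) has_derivative (\<lambda>h. (r *\<^sub>R h) \<bullet> grad f (c + r *\<^sub>R x))) (at x)"
    by (rule has_derivative_compose)
  then show "GDERIV (\<lambda>y. f (c + r *\<^sub>R y)) x :> r *\<^sub>R grad f (c + r *\<^sub>R x)"
    by (simp add: gderiv_def)
qed

lemma C1_fun_lipschitz:
  assumes f: "C1_fun f" and S: "convex S" "x \<in> S" "y \<in> S" and b: "\<And>z. z \<in> S \<Longrightarrow> norm (grad f z) \<le> b"
  shows "\<bar>f x - f y\<bar> \<le> b * norm (x - y)"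
proof -
  have "norm (f x - f y) \<le> b * norm (x - y)"
  proof (rule differentiable_bound[OF S(1) _ _ S(2,3)])
    show "(f has_derivative (\<lambda>h. h \<bullet> grad f z)) (at z within S)" for z
      using f has_derivative_at_withinI unfolding C1_fun_def gderiv_def by blast
    show "onorm (\<lambda>h. h \<bullet> grad f z) \<le> b" if "z \<in> S" for z
    proof (rule onorm_le)
      fix h
      have "norm (h \<bullet> grad f z) \<le> norm h * norm (grad f z)" by (simp add: Cauchy_Schwarz_ineq2)
      also have "\<dots> \<le> norm h * b" using b[OF that] by (intro mult_left_mono) auto
      finally show "norm (h \<bullet> grad f z) \<le> b * norm h" by (simp add: mult.commute)
    qed
  qed
  then show ?thesis by simp
qed

section \<open>Inverse inequalities on balls\<close>

lemma set_integrable_compact: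
  fixes f :: "'a::euclidean_space \<Rightarrow> real"
  assumes "compact S" "continuous_on S f" shows "set_integrable lborel S f"
  unfolding set_integrable_def by (rule borel_integrable_compact[OF assms])

text \<open>
  A continuous nonnegative function that is positive at an interior point is bounded below on a
  small ball around it.
\<close>

lemma integral_pos_continuous:
  fixes f :: "'a::euclidean_space \<Rightarrow> real"
  assumes f: "continuous_on S f" "\<And>x. x \<in> S \<Longrightarrow> 0 \<le> f x" and S: "compact S" "ball c r \<subseteq> S"
    and z: "(LINT x:S|lborel. f x) = 0" and x: "x \<in> ball c r"
  shows "f x = 0"
proof (rule ccontr)
  assume "f x \<noteq> 0"
  then have pos: "f x > 0" using f(2) x S by (metis less_eq_real_def subset_eq)
  have "continuous_on (ball c r) f" using continuous_on_subset[OF f(1) S(2)] .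
  then have "isCont f x" using x continuous_on_eq_continuous_at[OF open_ball] by blast
  from this[unfolded continuous_at_eps_delta, rule_format, of "f x / 2"] pos
  obtain d where d: "d > 0" "\<And>y. dist y x < d \<Longrightarrow> dist (f y) (f x) < f x / 2" by auto
  obtain e where e: "e > 0" "ball x e \<subseteq> ball c r" using x openE by blast
  define a where "a = min d e / 2"
  have a: "a > 0" "cball x a \<subseteq> S" "\<And>y. y \<in> cball x a \<Longrightarrow> f y \<ge> f x / 2"
  proof -
    show "a > 0" using d e by (simp add: a_def)
    show "cball x a \<subseteq> S" using e d S by (auto simp: a_def subset_eq dist_commute)
    show "f y \<ge> f x / 2" if "y \<in> cball x a" for y
    proof -
      have "dist y x < d" using that d(1) e(1) by (simp add: a_def dist_commute)
      from d(2)[OF this] show ?thesis unfolding dist_real_def by linarith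
    qed
  qed
  have "0 < f x / 2 * measure lborel (cball x a)"
    using pos a content_ball_pos[of a x]  by (simp add: content_cball_pos)
  also have "\<dots> = (LINT y:cball x a|lborel. f x / 2)"
    by (simp add: set_lebesgue_integral_def mult.commute)
  also have "\<dots> \<le> (LINT y:cball x a|lborel. f y)"
    using a by (intro set_integral_mono set_integrable_compact continuous_intros continuous_on_subset[OF f(1)]) auto
  also have "\<dots> \<le> (LINT y:S|lborel. f y)"
    unfolding set_lebesgue_integral_def
    using set_integrable_compact[OF S(1) f(1)] set_integrable_compact[OF compact_cball continuous_on_subset[OF f(1) a(2)]] a f(2)
    by (intro integral_mono) (auto simp: set_integrable_def indicator_def)
  finally show False using z by simp
qed

lemma integral_scale_ball:
  fixes f :: "real ^ 'd \<Rightarrow> real"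
  assumes r: "r > 0" and f: "continuous_on UNIV f"
  shows "(LINT x:cball c r|lborel. f x) = r ^ CARD('d) * (LINT x:cball 0 1|lborel. f (c + r *\<^sub>R x))"
proof -
  let ?T = "\<lambda>x::real ^ 'd. c + r *\<^sub>R x"
  have "f \<in> borel_measurable borel" using f by (rule borel_measurable_continuous_onI)
  then have m: "(\<lambda>x. indicator (cball c r) x *\<^sub>R f x) \<in> borel_measurable borel"
    by (intro borel_measurable_scaleR borel_measurable_indicator borel_closed closed_cball)
  have "(LINT x:cball c r|lborel. f x)
      = integral\<^sup>L (density (distr lborel borel ?T) (\<lambda>_. ennreal (r ^ CARD('d)))) (\<lambda>x. indicator (cball c r) x *\<^sub>R f x)"
    unfolding set_lebesgue_integral_def
    using lborel_affine[of r c] r by simp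
  also have "\<dots> = integral\<^sup>L (distr lborel borel ?T) (\<lambda>x. r ^ CARD('d) *\<^sub>R (indicator (cball c r) x *\<^sub>R f x))"
    using r m by (intro integral_density) (auto simp del: real_scaleR_def)
  also have "\<dots> = (\<integral>x. r ^ CARD('d) *\<^sub>R (indicator (cball c r) (?T x) *\<^sub>R f (?T x)) \<partial>lborel)"
    by (intro integral_distr borel_measurable_scaleR[OF borel_measurable_const m]) auto
  also have "\<dots> = (\<integral>x. r ^ CARD('d) *\<^sub>R (indicator (cball 0 1) x *\<^sub>R f (?T x)) \<partial>lborel)"
  proof -
    have "indicator (cball c r) (?T x) = (indicator (cball 0 1) x :: real)" for x
      using r by (auto simp: indicator_def dist_norm)
    then show ?thesis by simp
  qed
  finally show ?thesis by (simp add: set_lebesgue_integral_def)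
qed

lemma psd_form_L2:
  fixes G :: "(real ^ 'd \<Rightarrow> real) \<Rightarrow> real ^ 'd \<Rightarrow> 'b::euclidean_space"
  assumes "\<And>p q t x. p \<in> poly_space m \<Longrightarrow> q \<in> poly_space m \<Longrightarrow> G (\<lambda>x. t * p x + q x) x = t *\<^sub>R G p x + G q x"
    and cont: "\<And>p. p \<in> poly_space m \<Longrightarrow> continuous_on UNIV (G p)" and S: "compact S"
  shows "psd_form (poly_space m) (\<lambda>p q. LINT x:S|lborel. G p x \<bullet> G q x)"
proof
  show "(\<lambda>x. 0) \<in> poly_space m" by (rule poly_space_zero)
  show "(LINT x:S|lborel. G (\<lambda>x. t * p x + q x) x \<bullet> G s x)
      = t * (LINT x:S|lborel. G p x \<bullet> G s x) + (LINT x:S|lborel. G q x \<bullet> G s x)"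
    if pqs: "p \<in> poly_space m" "q \<in> poly_space m" "s \<in> poly_space m" for p q s t
  proof -
    have c: "set_integrable lborel S (\<lambda>x. G p x \<bullet> G s x)" if "p \<in> poly_space m" for p
      by (intro set_integrable_compact S continuous_intros continuous_on_subset[OF cont] pqs that) auto
    show ?thesis
      using c[OF pqs(1)] c[OF pqs(2)] by (simp add: assms(1)[OF pqs(1,2)] inner_add_left)
  qed
  show "0 \<le> (LINT x:S|lborel. G p x \<bullet> G p x)" for p
    unfolding set_lebesgue_integral_def by (rule integral_nonneg_AE) auto
qed (auto simp: inner_commute poly_space_comb)

text \<open>
  Both inverse inequalities are instances of the norm equivalence \<open>functionals_bounded\<close>, applied to
  the functionals that evaluate directional derivatives at points of a large ball. The operator \<open>G\<close>
  is the gradient in one case and the identity in the other. The large radius \<open>R\<close> matters because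
  the inequalities are used on an element between two balls, not on a ball.
\<close>

lemma poly_functional_bound:
  fixes G :: "(real ^ 'd \<Rightarrow> real) \<Rightarrow> real ^ 'd \<Rightarrow> 'b::euclidean_space"
  assumes G: "\<And>p q t x. p \<in> poly_space m \<Longrightarrow> q \<in> poly_space m \<Longrightarrow> G (\<lambda>x. t * p x + q x) x = t *\<^sub>R G p x + G q x"
    and cont: "\<And>p. p \<in> poly_space m \<Longrightarrow> continuous_on UNIV (G p)"
    and ker: "\<And>p x. p \<in> poly_space m \<Longrightarrow> (\<And>x. x \<in> ball 0 1 \<Longrightarrow> G p x = 0) \<Longrightarrow> grad p x = 0"
  shows "\<exists>C\<ge>0. \<forall>p\<in>poly_space m. \<forall>x\<in>cball 0 R. (norm (grad p x))\<^sup>2 \<le> C * (LINT x:cball 0 1|lborel. (norm (G p x))\<^sup>2)"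
proof -
  let ?B = "\<lambda>p q. LINT x:cball 0 1|lborel. G p x \<bullet> G q x"
  interpret psd_form "poly_space m" ?B
    by (rule psd_form_L2[OF G cont compact_cball])
  obtain fs :: "(real ^ 'd \<Rightarrow> real) list" where fs: "set fs \<subseteq> poly_space m" "fspan fs = poly_space m"
    using poly_space_fspan by blast
  define L :: "((real ^ 'd \<Rightarrow> real) \<Rightarrow> real) set" where "L = {(\<lambda>p. u \<bullet> grad p x) | u x. norm u \<le> 1 \<and> x \<in> cball 0 R}"
  have "\<exists>C\<ge>0. \<forall>p\<in>fspan fs. \<forall>l\<in>L. \<bar>l p\<bar> \<le> C * sqrt (?B p p)"
  proof (rule functionals_bounded[OF fs(1)])
    show "l (\<lambda>x. t * p x + q x) = t * l p + l q" if "l \<in> L" "p \<in> poly_space m" "q \<in> poly_space m" for l p q t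
      using that by (auto simp: L_def grad_comb[OF C1_fun_poly C1_fun_poly] inner_add_right)
    show "\<exists>b. \<forall>l\<in>L. \<bar>l f\<bar> \<le> b" if "f \<in> set fs" for f
    proof -
      have "C1_fun f" using that fs C1_fun_poly by auto
      then have "continuous_on (cball 0 R) (grad f)"
        using continuous_on_subset unfolding C1_fun_def by blast
      then have "bounded (grad f ` cball 0 R)"
        by (intro compact_imp_bounded compact_continuous_image compact_cball)
      then obtain b where b: "\<And>x. x \<in> cball 0 R \<Longrightarrow> norm (grad f x) \<le> b"
        unfolding bounded_iff by blast
      have "\<bar>u \<bullet> grad f x\<bar> \<le> b" if "norm u \<le> 1" "x \<in> cball 0 R" for u x
      proof -
        have "\<bar>u \<bullet> grad f x\<bar> \<le> norm u * norm (grad f x)" by (rule Cauchy_Schwarz_ineq2)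
        also have "\<dots> \<le> 1 * norm (grad f x)" using that by (intro mult_right_mono) auto
        finally show ?thesis using b[OF that(2)] by simp
      qed
      then show ?thesis unfolding L_def by blast
    qed
    show "l p = 0" if p: "p \<in> fspan fs" and B0: "?B p p = 0" and l: "l \<in> L" for p l
    proof -
      have p: "p \<in> poly_space m" using p fs by simp
      have "G p x \<bullet> G p x = 0" if "x \<in> ball 0 1" for x
      proof (rule integral_pos_continuous[where c = 0 and r = 1, OF _ _ compact_cball _ B0 that])
        show "continuous_on (cball 0 1) (\<lambda>x. G p x \<bullet> G p x)"
          by (intro continuous_intros continuous_on_subset[OF cont[OF p]]) auto
      qed auto
      then have "grad p x = 0" for x by (intro ker[OF p]) auto
      then show ?thesis using l by (auto simp: L_def)
    qed
  qed
  then obtain C where C: "C \<ge> 0" "\<And>p l. p \<in> poly_space m \<Longrightarrow> l \<in> L \<Longrightarrow> \<bar>l p\<bar> \<le> C * sqrt (?B p p)"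
    using fs by auto
  have "(norm (grad p x))\<^sup>2 \<le> C\<^sup>2 * ?B p p" if p: "p \<in> poly_space m" and x: "x \<in> cball 0 R" for p x
  proof -
    let ?u = "sgn (grad p x)"
    have "(\<lambda>p. ?u \<bullet> grad p x) \<in> L"
      unfolding L_def by (intro CollectI exI conjI, rule refl) (use x in \<open>auto simp: norm_sgn\<close>)
    from C(2)[OF p this] have "\<bar>?u \<bullet> grad p x\<bar> \<le> C * sqrt (?B p p)" by simp
    moreover have "?u \<bullet> grad p x = norm (grad p x)"
      by (simp add: sgn_div_norm power2_norm_eq_inner[symmetric] power2_eq_square field_simps)
    ultimately have "norm (grad p x) \<le> C * sqrt (?B p p)" by simp
    then have "(norm (grad p x))\<^sup>2 \<le> (C * sqrt (?B p p))\<^sup>2" by (rule power_mono) simp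
    then show ?thesis using nonneg[OF p] by (simp add: power_mult_distrib)
  qed
  then show ?thesis by (intro exI[of _ "C\<^sup>2"]) (simp add: power2_norm_eq_inner)
qed

text \<open>
  On the unit ball, a polynomial with vanishing gradient is constant, hence the gradient vanishes
  everywhere; the general ball follows by scaling.
\<close>

lemma grad_inverse_L2:
  fixes R :: real
  shows "\<exists>C\<ge>0. \<forall>p\<in>(poly_space m :: (real ^ 'd \<Rightarrow> real) set). \<forall>c r. r > 0 \<longrightarrow> (\<forall>x\<in>cball c (R * r).
    r ^ CARD('d) * (norm (grad p x))\<^sup>2 \<le> C * (LINT x:cball c r|lborel. (norm (grad p x))\<^sup>2))"
proof -
  have "\<exists>C\<ge>0. \<forall>p\<in>(poly_space m :: (real ^ 'd \<Rightarrow> real) set). \<forall>x\<in>cball 0 R. (norm (grad p x))\<^sup>2 \<le> C * (LINT x:cball 0 1|lborel. (norm (grad p x))\<^sup>2)"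
  proof (rule poly_functional_bound)
    fix p :: "real ^ 'd \<Rightarrow> real" and x
    assume p: "p \<in> poly_space m" and z: "\<And>x. x \<in> ball 0 1 \<Longrightarrow> grad p x = 0"
    have C1: "C1_fun p" using p by (rule C1_fun_poly)
    define q where "q = (\<lambda>x. 1 * p x + - p 0)"
    have q: "q \<in> poly_space m" unfolding q_def by (intro poly_space_comb p poly_space_const)
    have "q = (\<lambda>x. 0)"
    proof (rule poly_zero_on_ball[where c = 0 and r = 1, OF q])
      fix x :: "real ^ 'd" assume "x \<in> ball 0 1"
      then have "\<bar>p x - p 0\<bar> \<le> 0 * norm (x - 0)"
        by (intro C1_fun_lipschitz[OF C1 convex_ball[of 0 1]]) (auto simp: z)
      then show "q x = 0" by (simp add: q_def)
    qed simp
    then have "p = (\<lambda>x. p 0)" by (auto simp: q_def fun_eq_iff)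
    then have "grad p x = grad (\<lambda>x. p 0) x" by simp
    then show "grad p x = 0" using grad_eq[OF GDERIV_const] by simp
  qed (auto simp: grad_comb[OF C1_fun_poly C1_fun_poly], use C1_fun_poly C1_fun_def in blast)
  then obtain C where C: "C \<ge> 0" "\<And>p x. p \<in> poly_space m \<Longrightarrow> x \<in> cball (0::real ^ 'd) R \<Longrightarrow>
      (norm (grad p x))\<^sup>2 \<le> C * (LINT x:cball 0 1|lborel. (norm (grad p x))\<^sup>2)" by blast
  have "r ^ CARD('d) * (norm (grad p x))\<^sup>2 \<le> C * (LINT x:cball c r|lborel. (norm (grad p x))\<^sup>2)"
    if p: "p \<in> poly_space m" and r: "r > 0" and x: "x \<in> cball c (R * r)" for p :: "real ^ 'd \<Rightarrow> real" and c r x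
  proof -
    define q where "q = (\<lambda>y. p (c + r *\<^sub>R y))"
    define y where "y = (1 / r) *\<^sub>R (x - c)"
    have q: "q \<in> poly_space m" unfolding q_def by (rule poly_space_affine[OF p])
    have C1: "C1_fun p" using p by (rule C1_fun_poly)
    have gq: "grad q z = r *\<^sub>R grad p (c + r *\<^sub>R z)" for z unfolding q_def by (rule grad_affine[OF C1])
    have xy: "c + r *\<^sub>R y = x" using r by (simp add: y_def)
    have "norm y * r = norm (x - c)" using r by (simp add: y_def)
    also have "\<dots> \<le> R * r" using x by (simp add: dist_norm norm_minus_commute)
    finally have y: "y \<in> cball 0 R" using r by simp
    have cg: "continuous_on UNIV (\<lambda>x. (norm (grad p x))\<^sup>2)"
      using C1 unfolding C1_fun_def by (intro continuous_intros) auto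
    have "r\<^sup>2 * (norm (grad p x))\<^sup>2 = (norm (grad q y))\<^sup>2" using xy r by (simp add: gq power_mult_distrib)
    also have "\<dots> \<le> C * (LINT x:cball 0 1|lborel. (norm (grad q x))\<^sup>2)" by (rule C(2)[OF q y])
    also have "(LINT x:cball 0 1|lborel. (norm (grad q x))\<^sup>2) = r\<^sup>2 * (LINT x:cball 0 1|lborel. (norm (grad p (c + r *\<^sub>R x)))\<^sup>2)"
      using r by (simp add: gq power_mult_distrib)
    finally have "(norm (grad p x))\<^sup>2 \<le> C * (LINT x:cball 0 1|lborel. (norm (grad p (c + r *\<^sub>R x)))\<^sup>2)"
      using r by (simp add: algebra_simps)
    then have "r ^ CARD('d) * (norm (grad p x))\<^sup>2 \<le> r ^ CARD('d) * (C * (LINT x:cball 0 1|lborel. (norm (grad p (c + r *\<^sub>R x)))\<^sup>2))"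
      using r by (intro mult_left_mono) auto
    then show ?thesis unfolding integral_scale_ball[OF r cg] by (simp add: algebra_simps)
  qed
  with C(1) show ?thesis by blast
qed

lemma grad_inverse_sup:
  fixes R :: real
  shows "\<exists>C\<ge>0. \<forall>p\<in>(poly_space m :: (real ^ 'd \<Rightarrow> real) set). \<forall>c r M. r > 0 \<longrightarrow> (\<forall>x\<in>cball c r. \<bar>p x\<bar> \<le> M) \<longrightarrow>
    (\<forall>x\<in>cball c (R * r). r * norm (grad p x) \<le> C * M)"
proof -
  have "\<exists>C\<ge>0. \<forall>p\<in>(poly_space m :: (real ^ 'd \<Rightarrow> real) set). \<forall>x\<in>cball 0 R. (norm (grad p x))\<^sup>2 \<le> C * (LINT x:cball 0 1|lborel. (norm (p x))\<^sup>2)"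
  proof (rule poly_functional_bound[where G = "\<lambda>p x. p x"])
    fix p :: "real ^ 'd \<Rightarrow> real" and x
    assume p: "p \<in> poly_space m" and z: "\<And>x. x \<in> ball 0 1 \<Longrightarrow> p x = 0"
    have "p = (\<lambda>x. 0)" by (rule poly_zero_on_ball[where c = 0 and r = 1, OF p]) (use z in auto)
    then show "grad p x = 0" using grad_eq[OF GDERIV_const] by simp
  qed (auto intro: C1_fun_poly C1_fun_continuous)
  then obtain C where C: "C \<ge> 0" "\<And>p x. p \<in> poly_space m \<Longrightarrow> x \<in> cball (0::real ^ 'd) R \<Longrightarrow>
      (norm (grad p x))\<^sup>2 \<le> C * (LINT x:cball 0 1|lborel. (norm (p x))\<^sup>2)" by blast
  let ?v = "measure lborel (cball (0::real ^ 'd) 1)"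
  have "r * norm (grad p x) \<le> sqrt (C * ?v) * M"
    if p: "p \<in> poly_space m" and r: "r > 0" and M: "\<forall>x\<in>cball c r. \<bar>p x\<bar> \<le> M" and x: "x \<in> cball c (R * r)"
    for p :: "real ^ 'd \<Rightarrow> real" and c r x M
  proof -
    define q where "q = (\<lambda>y. p (c + r *\<^sub>R y))"
    define y where "y = (1 / r) *\<^sub>R (x - c)"
    have q: "q \<in> poly_space m" unfolding q_def by (rule poly_space_affine[OF p])
    have C1: "C1_fun p" "C1_fun q" using p q by (auto intro: C1_fun_poly)
    have gq: "grad q z = r *\<^sub>R grad p (c + r *\<^sub>R z)" for z unfolding q_def by (rule grad_affine[OF C1(1)])
    have xy: "c + r *\<^sub>R y = x" using r by (simp add: y_def)
    have "norm y * r = norm (x - c)" using r by (simp add: y_def)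
    also have "\<dots> \<le> R * r" using x by (simp add: dist_norm norm_minus_commute)
    finally have y: "y \<in> cball 0 R" using r by simp
    have M0: "M \<ge> 0" using M r by (auto intro: order_trans[OF abs_ge_zero[of "p c"]])
    have qM: "\<bar>q z\<bar> \<le> M" if "z \<in> cball 0 1" for z
      unfolding q_def using M r that by (auto simp: dist_norm)
    have "(LINT x:cball 0 1|lborel. (norm (q x))\<^sup>2) \<le> (LINT x:cball (0::real^'d) 1|lborel. M\<^sup>2)"
      using qM by (intro set_integral_mono set_integrable_compact continuous_intros C1_fun_continuous C1)
        (auto simp: abs_le_square_iff[symmetric] abs_of_nonneg[OF M0])
    also have "\<dots> = M\<^sup>2 * ?v" by (simp add: set_lebesgue_integral_def mult.commute)
    finally have "(norm (grad q y))\<^sup>2 \<le> C * (M\<^sup>2 * ?v)"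
      using C(2)[OF q y] C(1) by (meson mult_left_mono order_trans)
    then have "norm (grad q y) \<le> sqrt (C * (M\<^sup>2 * ?v))" by (rule real_le_rsqrt)
    also have "\<dots> = sqrt (C * ?v) * M" using M0 by (simp add: real_sqrt_mult)
    finally show ?thesis using xy r by (simp add: gq)
  qed
  moreover have "sqrt (C * ?v) \<ge> 0" using C(1) by simp
  ultimately show ?thesis by blast
qed

section \<open>Facets of full-dimensional polyhedra\<close>

lemma unit_normals_of_same_hyperplane:
  fixes n n' :: "'a::real_inner"
  assumes n: "norm n = 1" "norm n' = 1" and sub: "{x. n \<bullet> x = b} \<subseteq> {x. n' \<bullet> x = b'}"
  shows "n' = n \<or> n' = - n"
proof -
  define w where "w = n' - (n \<bullet> n') *\<^sub>R n"
  have nn: "n \<bullet> n = 1" "n' \<bullet> n' = 1" using n by (simp_all add: norm_eq_1)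
  have nw: "n \<bullet> w = 0" by (simp add: w_def inner_diff_right nn)
  have "n' \<bullet> (b *\<^sub>R n) = b'" "n' \<bullet> (b *\<^sub>R n + w) = b'"
    using subsetD[OF sub, of "b *\<^sub>R n"] subsetD[OF sub, of "b *\<^sub>R n + w"] nn nw by (simp_all add: inner_add_right)
  then have n'w: "n' \<bullet> w = 0" by (simp add: inner_add_right)
  have "w \<bullet> w = n' \<bullet> w - (n \<bullet> n') * (n \<bullet> w)" by (subst (1) w_def) (simp add: inner_diff_left)
  then have "w = 0" using nw n'w by simp
  then have eq: "n' = (n \<bullet> n') *\<^sub>R n" by (simp add: w_def)
  then have "\<bar>n \<bullet> n'\<bar> = 1" using n by (metis mult.right_neutral norm_scaleR)
  then have "n \<bullet> n' = 1 \<or> n \<bullet> n' = -1" by linarith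
  then show ?thesis using eq by (metis scaleR_minus1_left scaleR_one)
qed

lemma facet_supporting_hyperplane:
  fixes K :: "'a::euclidean_space set"
  assumes K: "polyhedron K" "interior K \<noteq> {}" and e: "e facet_of K"
  obtains n b where "norm n = 1" "K \<subseteq> {x. n \<bullet> x \<le> b}" "e = K \<inter> {x. n \<bullet> x = b}"
    "affine hull e = {x. n \<bullet> x = b}" "\<And>q. q \<in> interior K \<Longrightarrow> n \<bullet> q < b"
proof -
  obtain a c where a: "a \<noteq> 0" "K \<subseteq> {x. a \<bullet> x \<le> c}" "e = K \<inter> {x. a \<bullet> x = c}"
    using facet_of_polyhedron[OF K(1) e] .
  define n where "n = a /\<^sub>R norm a"
  define b where "b = c / norm a"
  have iff: "n \<bullet> x \<le> b \<longleftrightarrow> a \<bullet> x \<le> c" "n \<bullet> x = b \<longleftrightarrow> a \<bullet> x = c" for x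
    using a(1) by (auto simp: n_def b_def field_simps)
  have n1: "norm n = 1" using a(1) by (simp add: n_def)
  have dimK: "aff_dim K = DIM('a)"
    using K(2) aff_dim_nonempty_interior by blast
  have "n \<noteq> 0" using n1 by auto
  then have "aff_dim (affine hull e) = aff_dim {x. n \<bullet> x = b}"
    using e dimK by (simp add: facet_of_def)
  moreover have "affine hull e \<subseteq> {x. n \<bullet> x = b}"
    by (rule hull_minimal) (auto simp: a(3) iff affine_hyperplane)
  moreover have "affine hull e \<noteq> {}" using e by (auto simp: facet_of_def)
  ultimately have hull: "affine hull e = {x. n \<bullet> x = b}"
    by (intro affine_dim_equal affine_hyperplane) auto
  have "n \<bullet> q < b" if "q \<in> interior K" for q
  proof -
    have qK: "q \<in> K" using that interior_subset by blast
    have "e \<noteq> K" using e by auto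
    then have "e \<inter> interior K = {}"
      using e face_of_disjoint_interior facet_of_imp_face_of by blast
    then have "n \<bullet> q \<noteq> b" using that qK by (auto simp: a(3) iff)
    moreover have "n \<bullet> q \<le> b" using qK a(2) by (auto simp: iff)
    ultimately show ?thesis by simp
  qed
  with n1 a(2,3) hull show ?thesis by (intro that[of n b]) (auto simp: iff)
qed

text \<open>
  A facet spans its hyperplane, so a vector with constant inner product on the facet is normal to
  it, and an interior point of the element decides the sign.
\<close>

lemma outward_normal_eq:
  fixes K :: "(real ^ 'd) set"
  assumes n: "norm n = 1" "K \<subseteq> {x. n \<bullet> x \<le> b}" "e = K \<inter> {x. n \<bullet> x = b}"
    and hull: "affine hull e = {x. n \<bullet> x = b}" and int: "interior K \<noteq> {}" "\<And>q. q \<in> interior K \<Longrightarrow> n \<bullet> q < b"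
    and e: "e \<noteq> {}"
  shows "outward_normal K e = n"
  unfolding outward_normal_def
proof (rule the_equality)
  show "norm n = 1 \<and> (\<forall>x\<in>e. \<forall>y\<in>K. n \<bullet> (y - x) \<le> 0)"
    using n by (auto simp: inner_diff_right)
next
  fix n' assume n': "norm n' = 1 \<and> (\<forall>x\<in>e. \<forall>y\<in>K. n' \<bullet> (y - x) \<le> 0)"
  obtain x where x: "x \<in> e" using e by blast
  obtain q where q: "q \<in> interior K" using int by blast
  then have qK: "q \<in> K" using interior_subset by blast
  have "n' \<bullet> y = n' \<bullet> x" if "y \<in> e" for y
  proof -
    have "n' \<bullet> (y - x) \<le> 0" "n' \<bullet> (x - y) \<le> 0" using n' that x n(3) by auto
    then show ?thesis by (simp add: inner_diff_right)
  qed
  then have "affine hull e \<subseteq> {y. n' \<bullet> y = n' \<bullet> x}"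
    by (intro hull_minimal) (auto simp: affine_hyperplane)
  then have "n' = n \<or> n' = - n"
    using n(1) n' unfolding hull by (intro unit_normals_of_same_hyperplane) auto
  moreover have "n' \<noteq> - n"
  proof
    assume "n' = - n"
    then have "n \<bullet> (q - x) \<ge> 0" using n' x qK by fastforce
    moreover have "n \<bullet> x = b" using x n(3) by auto
    ultimately show False using int(2)[OF q] by (simp add: inner_diff_right)
  qed
  ultimately show "n' = n" by blast
qed

lemma facet_normal:
  fixes K :: "(real ^ 'd) set"
  assumes "polyhedron K" "interior K \<noteq> {}" "e facet_of K"
  obtains b where "norm (outward_normal K e) = 1" "K \<subseteq> {x. outward_normal K e \<bullet> x \<le> b}"
    "e = K \<inter> {x. outward_normal K e \<bullet> x = b}" "affine hull e = {x. outward_normal K e \<bullet> x = b}"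
    "\<And>q. q \<in> interior K \<Longrightarrow> outward_normal K e \<bullet> q < b"
proof -
  obtain n b where *: "norm n = 1" "K \<subseteq> {x. n \<bullet> x \<le> b}" "e = K \<inter> {x. n \<bullet> x = b}"
    "affine hull e = {x. n \<bullet> x = b}" "\<And>q. q \<in> interior K \<Longrightarrow> n \<bullet> q < b"
    using facet_supporting_hyperplane[OF assms] by blast
  moreover have "outward_normal K e = n"
    using assms by (intro outward_normal_eq[OF *(1-4) _ *(5)]) (auto simp: facet_of_def)
  ultimately show ?thesis by (intro that[of b]) auto
qed

text \<open>
  Near a relatively interior point of a facet the polyhedron fills a half ball: the line from an
  interior point \<open>q\<close> through a nearby point \<open>y\<close> hits the hyperplane at a point \<open>z\<close> that is still
  in the facet, and \<open>y\<close> lies between \<open>q\<close> and \<open>z\<close>.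
\<close>

lemma facet_half_ball:
  fixes K :: "'a::euclidean_space set"
  assumes K: "convex K" and q: "q \<in> K" "n \<bullet> q < b"
    and e: "e \<subseteq> K" "affine hull e = {x. n \<bullet> x = b}" and x: "x \<in> rel_interior e"
  obtains d where "d > 0" "\<And>y. dist y x < d \<Longrightarrow> n \<bullet> y \<le> b \<Longrightarrow> y \<in> K"
proof -
  obtain \<epsilon> where \<epsilon>: "\<epsilon> > 0" "ball x \<epsilon> \<inter> affine hull e \<subseteq> e"
    using x unfolding mem_rel_interior_ball by blast
  have xe: "x \<in> e" using x rel_interior_subset by blast
  then have nx: "n \<bullet> x = b" using hull_subset[of e affine] e(2) by auto
  define g where "g = b - n \<bullet> q"
  have g: "g > 0" using q by (simp add: g_def)
  define M where "M = norm n / g"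
  have M0: "M \<ge> 0" using g by (simp add: M_def)
  define D where "D = norm (x - q)"
  \<comment> \<open>The first bound gives \<open>t \<le> 1 / 2\<close> below, the second one keeps \<open>z\<close> within distance \<open>\<epsilon>\<close> of \<open>x\<close>.\<close>
  define d where "d = min (1 / (2 * (M + 1))) (\<epsilon> / (2 * (1 + M * D)))"
  have D0: "D \<ge> 0" by (simp add: D_def)
  have MD: "1 + M * D > 0" using M0 D0 by (simp add: add_pos_nonneg)
  have d0: "d > 0" using M0 \<epsilon> MD by (auto simp: d_def)
  have "y \<in> K" if y: "dist y x < d" "n \<bullet> y \<le> b" for y
  proof -
    define t where "t = (b - n \<bullet> y) / g"
    have t0: "t \<ge> 0" using y g by (simp add: t_def)
    have "b - n \<bullet> y = n \<bullet> (x - y)" using nx by (simp add: inner_diff_right)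
    also have "\<dots> \<le> norm n * norm (x - y)" by (rule norm_cauchy_schwarz)
    finally have "t \<le> norm n * norm (x - y) / g" unfolding t_def using g by (intro divide_right_mono) auto
    then have tM: "t \<le> M * dist y x" by (simp add: M_def dist_norm norm_minus_commute)
    also have "\<dots> \<le> M * (1 / (2 * (M + 1)))" using y M0 by (intro mult_left_mono) (auto simp: d_def)
    also have "\<dots> \<le> 1 / 2" using M0 by (simp add: field_simps)
    finally have t2: "t \<le> 1 / 2" .
    define z where "z = (1 / (1 - t)) *\<^sub>R (y - t *\<^sub>R q)"
    have yz: "y = (1 - t) *\<^sub>R z + t *\<^sub>R q" using t2 by (simp add: z_def)
    have "n \<bullet> y - t * (n \<bullet> q) = b - t * b" 
    proof -
      have "t * g = b - n \<bullet> y" using g by (simp add: t_def)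
      then show ?thesis by (simp add: g_def algebra_simps)
    qed
    then have "n \<bullet> z = (1 / (1 - t)) * (b - t * b)" by (simp add: z_def inner_diff_right)
    also have "\<dots> = (1 / (1 - t)) * ((1 - t) * b)" by (simp add: algebra_simps)
    also have "\<dots> = b" using t2 by simp
    finally have nz: "n \<bullet> z = b" .
    have "(1 - t) *\<^sub>R (z - x) = (y - x) + t *\<^sub>R (x - q)"
      using yz by (simp add: algebra_simps)
    then have "norm ((1 - t) *\<^sub>R (z - x)) \<le> norm (y - x) + norm (t *\<^sub>R (x - q))"
      by (simp only: norm_triangle_ineq)
    then have "(1 - t) * norm (z - x) \<le> norm (y - x) + t * norm (x - q)"
      using t0 t2 by simp
    then have "(1 - t) * dist z x \<le> dist y x + t * D" by (simp add: dist_norm D_def)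
    moreover have "t * D \<le> M * dist y x * D" using tM D0 by (rule mult_right_mono)
    moreover have "(1 / 2) * dist z x \<le> (1 - t) * dist z x" using t2 by (intro mult_right_mono) auto
    ultimately have "dist z x \<le> 2 * ((1 + M * D) * dist y x)" by (simp add: algebra_simps)
    also have "\<dots> < 2 * ((1 + M * D) * d)" using y MD by (intro mult_strict_left_mono) auto
    also have "\<dots> \<le> 2 * ((1 + M * D) * (\<epsilon> / (2 * (1 + M * D))))" using MD by (intro mult_left_mono) (auto simp: d_def)
    also have "\<dots> = \<epsilon>" using MD by (simp add: field_simps)
    finally have "z \<in> ball x \<epsilon> \<inter> affine hull e" using nz e(2) by (auto simp: dist_commute)
    then have "z \<in> K" using \<epsilon>(2) e(1) by blast
    then show ?thesis unfolding yz using t0 t2 by (intro convexD[OF K _ q(1)]) auto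
  qed
  then show ?thesis using d0 that by blast
qed

text \<open>
  Lower bounds for the size of a facet come from this disc. The section of the inscribed ball
  parallel to the facet is projected centrally from the opposite vertex \<open>q\<close>; the image lies in the
  facet and is an enlarged copy of the section.
\<close>

lemma simplex_facet_contains_disc:
  fixes K :: "'a::euclidean_space set"
  assumes K: "k simplex K" and e: "e facet_of K" and ball: "cball c r \<subseteq> K" "r > 0"
    and n: "norm n = 1" "K \<subseteq> {x. n \<bullet> x \<le> b}" "e = K \<inter> {x. n \<bullet> x = b}"
  obtains z where "n \<bullet> z = b" "cball z r \<inter> {x. n \<bullet> x = b} \<subseteq> e"
proof -
  obtain C where C: "\<not> affine_dependent C" "K = convex hull C" using K unfolding simplex_def by blast
  obtain q where q: "q \<in> C" "e = convex hull (C - {q})" "e \<noteq> {}"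
    using e unfolding C(2) facet_of_convex_hull_affine_independent[OF C(1)] by blast
  have ne: "C - {q} \<noteq> {}" using q by auto
  have conv: "\<exists>u\<ge>0. u \<le> 1 \<and> (\<exists>z\<in>e. x = (1 - u) *\<^sub>R q + u *\<^sub>R z)" if "x \<in> K" for x
  proof -
    have "x \<in> convex hull (insert q (C - {q}))" using that q C by (simp add: insert_absorb)
    then obtain u v z where "u \<ge> 0" "v \<ge> 0" "u + v = 1" "z \<in> convex hull (C - {q})" "x = u *\<^sub>R q + v *\<^sub>R z"
      unfolding convex_hull_insert[OF ne] by blast
    moreover from this have "u = 1 - v" by simp
    ultimately show ?thesis using q(2) by (intro exI[of _ v] conjI bexI[of _ z]) simp_all
  qed
  have ne': "n \<bullet> z = b" if "z \<in> e" for z using that n by auto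
  have nn: "n \<bullet> n = 1" using n by (simp add: norm_eq_1)
  have qK: "q \<in> K" using q C by (simp add: hull_inc)
  define g where "g = b - n \<bullet> q"
  have g0: "g \<ge> 0" using qK n by (auto simp: g_def)
  have val: "n \<bullet> x \<ge> n \<bullet> q" if "x \<in> K" for x
  proof -
    from conv[OF that]
    obtain u z where u: "u \<ge> 0" "u \<le> 1" "z \<in> e" "x = (1 - u) *\<^sub>R q + u *\<^sub>R z" by blast
    have "n \<bullet> x = n \<bullet> q + u * g"
      unfolding u(4) by (simp add: inner_add_right ne'[OF u(3)] g_def algebra_simps)
    then show ?thesis using u g0 by simp
  qed
  \<comment> \<open>The ball contains points closer to \<open>q\<close> than its centre, so the section is not at the height of \<open>q\<close>.\<close>
  have "c - r *\<^sub>R n \<in> cball c r" using n ball by (simp add: dist_norm)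
  then have "n \<bullet> q \<le> n \<bullet> (c - r *\<^sub>R n)" using val ball by blast
  then have nc: "n \<bullet> q < n \<bullet> c" using ball nn by (simp add: inner_diff_right)
  \<comment> \<open>The scaling factor of the projection: the height of the section over \<open>q\<close> relative to that of the facet.\<close>
  define t where "t = (n \<bullet> c - n \<bullet> q) / g"
  have "c \<in> K" using ball by auto
  then have ncb: "n \<bullet> c \<le> b" using n by auto
  have g: "g > 0" using nc ncb by (simp add: g_def)
  have t: "t > 0" "t \<le> 1" using nc ncb g by (auto simp: t_def g_def)
  have tg: "t * g = n \<bullet> c - n \<bullet> q" using g by (simp add: t_def)
  define z where "z = q + (1 / t) *\<^sub>R (c - q)"
  have zc: "t *\<^sub>R (z - q) = c - q" using t by (simp add: z_def)
  have nz: "n \<bullet> z = b"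
  proof -
    have "t * (n \<bullet> z - n \<bullet> q) = t * g"
      using arg_cong[OF zc, of "\<lambda>x. n \<bullet> x"] by (simp add: inner_diff_right tg)
    then show ?thesis using t by (simp add: g_def)
  qed
  have "w \<in> e" if w: "w \<in> cball z r" "n \<bullet> w = b" for w
  proof -
    define y where "y = q + t *\<^sub>R (w - q)"
    have "y - c = t *\<^sub>R (w - z)" using zc by (simp add: y_def algebra_simps)
    then have "dist y c = t * dist w z" using t by (simp add: dist_norm)
    also have "\<dots> \<le> 1 * r" using t w by (intro mult_mono) (auto simp: dist_commute)
    finally have "y \<in> K" using ball by (auto simp: dist_commute)
    from conv[OF this]
    obtain u v where u: "u \<ge> 0" "u \<le> 1" "v \<in> e" "y = (1 - u) *\<^sub>R q + u *\<^sub>R v" by blast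
    have "n \<bullet> y = n \<bullet> q + u * g"
      unfolding u(4) by (simp add: inner_add_right ne'[OF u(3)] g_def algebra_simps)
    moreover have "n \<bullet> y = n \<bullet> q + t * g" using w by (simp add: y_def inner_add_right inner_diff_right g_def)
    ultimately have "u = t" using g by simp
    then have "t *\<^sub>R w = t *\<^sub>R v" using u(4) unfolding y_def by (simp add: algebra_simps)
    then show ?thesis using t u by simp
  qed
  then show ?thesis using nz by (intro that[of z]) auto
qed

lemma card_facets_simplex:
  fixes K :: "'a::euclidean_space set"
  assumes "int k simplex K" shows "finite {e. e facet_of K}" "card {e. e facet_of K} \<le> k + 1"
proof -
  obtain C where C: "finite C" "\<not> affine_dependent C" "int (card C) = int k + 1" "K = convex hull C"
    using assms unfolding simplex by blast
  have sub: "{e. e facet_of K} \<subseteq> (\<lambda>u. convex hull (C - {u})) ` C"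
    using facet_of_convex_hull_affine_independent[OF C(2)] C(4) by auto
  show "finite {e. e facet_of K}" using finite_surj[OF C(1) sub] .
  have "card {e. e facet_of K} \<le> card C" using surj_card_le[OF C(1) sub] .
  then show "card {e. e facet_of K} \<le> k + 1" using C(3) by simp
qed

lemma card_disjoint_balls_le:
  fixes c :: "'i \<Rightarrow> 'a::euclidean_space"
  assumes I: "finite I" and disj: "\<And>i j. i \<in> I \<Longrightarrow> j \<in> I \<Longrightarrow> i \<noteq> j \<Longrightarrow> ball (c i) r \<inter> ball (c j) r = {}"
    and sub: "\<And>i. i \<in> I \<Longrightarrow> ball (c i) r \<subseteq> cball x R" and r: "r > 0" and R: "R \<ge> 0"
  shows "real (card I) \<le> (R / r) ^ DIM('a)"
proof -
  let ?u = "unit_ball_vol (real DIM('a))"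
  have "real (card I) * (?u * r ^ DIM('a)) = (\<Sum>i\<in>I. measure lborel (ball (c i) r))"
    using r by (simp add: content_ball)
  also have "\<dots> = measure lborel (\<Union>i\<in>I. ball (c i) r)"
    using disj by (intro measure_finite_Union[symmetric] I) (auto simp: disjoint_family_on_def less_imp_neq[OF emeasure_lborel_ball_finite, simplified])
  also have "\<dots> \<le> measure lborel (cball x R)"
    using sub I emeasure_lborel_cball_finite[of x R]
    by (intro measure_mono_fmeasurable fmeasurableI sets.finite_UN) (auto simp: UN_subset_iff)
  also have "\<dots> = ?u * R ^ DIM('a)" using R by (simp add: content_cball)
  finally have "?u * (real (card I) * r ^ DIM('a)) \<le> ?u * R ^ DIM('a)" by (simp add: mult.left_commute)
  then have "real (card I) * r ^ DIM('a) \<le> R ^ DIM('a)" by (rule mult_left_le_imp_le) simp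
  then show ?thesis using r by (simp add: power_divide pos_le_divide_eq)
qed

section \<open>Surface measure of a facet\<close>

text \<open>
  The volume of a cylinder is additive in its height; Cauchy's functional equation with a sign
  condition then determines it up to a factor.
\<close>

lemma additive_nonneg_imp_linear:
  fixes f :: "real \<Rightarrow> real"
  assumes add: "\<And>a b. a \<ge> 0 \<Longrightarrow> b \<ge> 0 \<Longrightarrow> f (a + b) = f a + f b"
    and nn: "\<And>a. a \<ge> 0 \<Longrightarrow> f a \<ge> 0" and L: "L \<ge> 0"
  shows "f L = L * f 1"
proof (rule ccontr)
  assume ne: "f L \<noteq> L * f 1"
  have f0: "f 0 = 0" using add[of 0 0] by simp
  have mult: "f (real k * x) = real k * f x" if "x \<ge> 0" for k x
  proof (induction k)
    case (Suc k)
    have "f (real (Suc k) * x) = f (real k * x + x)" by (simp add: algebra_simps)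
    also have "\<dots> = real k * f x + f x" using that Suc by (subst add) auto
    finally show ?case by (simp add: algebra_simps)
  qed (simp add: f0)
  have mono: "f a \<le> f b" if "0 \<le> a" "a \<le> b" for a b
    using add[of a "b - a"] nn[of "b - a"] that by simp
  have close: "real k * \<bar>f L - L * f 1\<bar> \<le> f 1" for k
  proof -
    \<comment> \<open>The value at \<open>k L\<close> lies between those at the neighbouring integers \<open>j\<close> and \<open>j + 1\<close>.\<close>
    define j where "j = nat \<lfloor>real k * L\<rfloor>"
    have kL: "real k * L \<ge> 0" using L by simp
    have j: "real j \<le> real k * L" "real k * L \<le> real j + 1"
      using kL by (auto simp: j_def)
    have "real j * f 1 \<le> real k * f L" using mono[OF _ j(1)] mult[of 1 j] mult[OF L, of k] by simp
    moreover have "real k * f L \<le> (real j + 1) * f 1"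
      using mono[OF kL j(2)] mult[of 1 "Suc j"] mult[OF L, of k] by (simp add: add.commute)
    moreover have "real j * f 1 \<le> (real k * L) * f 1" "(real k * L) * f 1 \<le> (real j + 1) * f 1"
      using j nn[of 1] by (intro mult_right_mono; simp)+
    ultimately have "\<bar>real k * f L - real k * L * f 1\<bar> \<le> f 1" by (simp add: algebra_simps abs_le_iff)
    moreover have "real k * \<bar>f L - L * f 1\<bar> = \<bar>real k * f L - real k * L * f 1\<bar>"
    proof -
      have "real k * f L - real k * L * f 1 = real k * (f L - L * f 1)" by (simp add: algebra_simps)
      then show ?thesis by (simp add: abs_mult)
    qed
    ultimately show ?thesis by simp
  qed
  obtain k where "f 1 < real k * \<bar>f L - L * f 1\<bar>"
    using reals_Archimedean3[of "\<bar>f L - L * f 1\<bar>"] ne by auto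
  with close[of k] show False by simp
qed

lemma bounded_in_cball:
  fixes D :: "'a::real_normed_vector set"
  assumes "bounded D" obtains z s where "D \<subseteq> cball z s"
proof -
  obtain s where "\<And>x. x \<in> D \<Longrightarrow> norm x \<le> s" using assms unfolding bounded_iff by blast
  then show ?thesis by (intro that[of 0 s]) auto
qed

lemma measure_lborel_translate:
  fixes A :: "'a::euclidean_space set"
  assumes "A \<in> sets borel" shows "measure lborel ((\<lambda>y. c + y) -` A) = measure lborel A"
proof -
  have "measure lborel A = measure (distr lborel borel ((+) c)) A" by (simp add: lborel_distr_plus)
  also have "\<dots> = measure lborel ((+) c -` A)" using assms by (subst measure_distr) auto
  finally show ?thesis by simp
qed

text \<open>
  The surface measure of a subset of a hyperplane is the volume of a cylinder of height one over it.
  Volumes of such cylinders over discs of radius \<open>s\<close> are compared with volumes of balls by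
  stretching the height to \<open>2 s\<close>, which costs a factor only since the volume is linear in the
  height.
\<close>

locale unit_hyperplane =
  fixes n :: "real ^ 'd" and b :: real
  assumes n: "norm n = 1"
begin

definition height :: "real ^ 'd \<Rightarrow> real" where "height y = n \<bullet> y - b"
definition foot :: "real ^ 'd \<Rightarrow> real ^ 'd" where "foot y = y - height y *\<^sub>R n"

lemma nn: "n \<bullet> n = 1" using n by (simp add: norm_eq_1)

lemma n_foot: "n \<bullet> foot y = b" by (simp add: foot_def height_def inner_diff_right nn)

lemma height_le_dist: assumes "n \<bullet> z = b" shows "\<bar>height y\<bar> \<le> dist y z"
proof -
  have "height y = n \<bullet> (y - z)" using assms by (simp add: height_def inner_diff_right)
  then show ?thesis using Cauchy_Schwarz_ineq2[of n "y - z"] n by (simp add: dist_norm)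
qed

lemma dist_foot: "dist y (foot y) = \<bar>height y\<bar>"
  by (simp add: foot_def dist_norm n)

lemma closest_point_hyperplane: "closest_point {x. n \<bullet> x = b} y = foot y"
  by (rule closest_point_unique[symmetric])
     (auto simp: convex_hyperplane closed_hyperplane n_foot dist_foot height_le_dist)

lemma infdist_hyperplane: "infdist y {x. n \<bullet> x = b} = \<bar>height y\<bar>"
proof (rule antisym)
  show "infdist y {x. n \<bullet> x = b} \<le> \<bar>height y\<bar>"
    using infdist_le[of "foot y" "{x. n \<bullet> x = b}" y] by (simp add: n_foot dist_foot)
  show "\<bar>height y\<bar> \<le> infdist y {x. n \<bullet> x = b}"
    using n_foot height_le_dist by (auto simp: infdist_def intro!: cINF_greatest)
qed

lemma continuous_height: "continuous_on S height" and continuous_foot: "continuous_on S foot"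
  unfolding foot_def[abs_def] height_def[abs_def] by (intro continuous_intros)+

lemma measurable_height [measurable]: "height \<in> borel_measurable borel"
  and measurable_foot [measurable]: "foot \<in> borel_measurable borel"
  using continuous_height continuous_foot by (auto intro: borel_measurable_continuous_onI)

text \<open>
  Half open in the height, so that two stacked cylinders are disjoint.
\<close>

definition cylinder :: "(real ^ 'd) set \<Rightarrow> real \<Rightarrow> (real ^ 'd) set" where
  "cylinder D L = {y. 0 \<le> height y \<and> height y < L \<and> foot y \<in> D}"

lemma foot_vimage_sets: "D \<in> sets borel \<Longrightarrow> {y. foot y \<in> D} \<in> sets borel"
  using measurable_sets_borel[OF measurable_foot, of D] by (simp add: vimage_def)

lemma height_foot_sets:
  assumes "D \<in> sets borel" and [measurable]: "Measurable.pred borel P"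
  shows "{y. P (height y) \<and> foot y \<in> D} \<in> sets borel"
proof -
  have "{y. P (height y)} \<in> sets borel" by measurable
  from sets.Int[OF this foot_vimage_sets[OF assms(1)]] show ?thesis by (simp add: Int_def)
qed

lemma cylinder_sets: "D \<in> sets borel \<Longrightarrow> cylinder D L \<in> sets borel"
  unfolding cylinder_def using height_foot_sets[of D "\<lambda>h. 0 \<le> h \<and> h < L"] by simp

lemma cylinder_subset_cball:
  assumes "D \<subseteq> cball z s" shows "cylinder D L \<subseteq> cball z (s + L)"
proof
  fix y assume y: "y \<in> cylinder D L"
  have "dist z y \<le> dist z (foot y) + dist (foot y) y" by (rule dist_triangle)
  also have "dist (foot y) y = \<bar>height y\<bar>" by (simp add: dist_foot dist_commute)
  finally show "y \<in> cball z (s + L)" using y assms by (auto simp: cylinder_def)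
qed

lemma cylinder_fmeasurable:
  assumes D: "D \<in> sets borel" "bounded D" shows "cylinder D L \<in> fmeasurable lborel"
proof -
  obtain z s where D': "D \<subseteq> cball z s" using bounded_in_cball[OF D(2)] by blast
  show ?thesis
  proof (rule fmeasurableI2)
    show "cball z (s + L) \<in> fmeasurable lborel"
      using emeasure_lborel_cball_finite by (intro fmeasurableI) auto
    show "cylinder D L \<subseteq> cball z (s + L)" using cylinder_subset_cball[OF D'] .
  qed (use cylinder_sets[OF D(1)] in auto)
qed

lemma height_translate: "height (t *\<^sub>R n + y) = t + height y"
  by (simp add: height_def inner_add_right nn)

lemma foot_translate: "foot (t *\<^sub>R n + y) = foot y"
  by (simp add: foot_def height_translate scaleR_add_left)

lemma measure_cylinder_linear:
  assumes D: "D \<in> sets borel" "bounded D" and L: "L \<ge> 0"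
  shows "measure lborel (cylinder D L) = L * measure lborel (cylinder D 1)"
proof (rule additive_nonneg_imp_linear[where f = "\<lambda>L. measure lborel (cylinder D L)", OF _ _ L])
  fix h k :: real assume h: "h \<ge> 0" "k \<ge> 0"
  obtain z s where D': "D \<subseteq> cball z s" using bounded_in_cball[OF D(2)] by blast
  define E where "E = {y. h \<le> height y \<and> height y < h + k \<and> foot y \<in> D}"
  have Es: "E \<in> sets borel"
    unfolding E_def using height_foot_sets[OF D(1), of "\<lambda>t. h \<le> t \<and> t < h + k"] by simp
  have fin: "X \<in> fmeasurable lborel" if "X \<in> sets borel" "X \<subseteq> cylinder D (h + k)" for X
  proof (rule fmeasurableI2)
    show "cball z (s + (h + k)) \<in> fmeasurable lborel"
      using emeasure_lborel_cball_finite by (intro fmeasurableI) auto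
    show "X \<subseteq> cball z (s + (h + k))" using that cylinder_subset_cball[OF D'] by blast
  qed (use that in auto)
  have "cylinder D (h + k) = cylinder D h \<union> E" using h by (auto simp: cylinder_def E_def)
  then have "measure lborel (cylinder D (h + k)) = measure lborel (cylinder D h \<union> E)" by simp
  also have "\<dots> = measure lborel (cylinder D h) + measure lborel E"
  proof (rule measure_Union)
    have "cylinder D h \<subseteq> cylinder D (h + k)" using h by (auto simp: cylinder_def)
    from fmeasurableD2[OF fin[OF cylinder_sets[OF D(1)] this]]
    show "emeasure lborel (cylinder D h) \<noteq> \<infinity>" by simp
    have "E \<subseteq> cylinder D (h + k)" using h by (auto simp: cylinder_def E_def)
    from fmeasurableD2[OF fin[OF Es this]] show "emeasure lborel E \<noteq> \<infinity>" by simp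
    show "cylinder D h \<inter> E = {}" by (auto simp: cylinder_def E_def)
  qed (use Es cylinder_sets[OF D(1)] in auto)
  also have "measure lborel E = measure lborel ((\<lambda>y. h *\<^sub>R n + y) -` E)"
    by (rule measure_lborel_translate[OF Es, symmetric])
  also have "(\<lambda>y. h *\<^sub>R n + y) -` E = cylinder D k"
    by (auto simp: E_def cylinder_def height_translate foot_translate)
  finally show "measure lborel (cylinder D (h + k)) = measure lborel (cylinder D h) + measure lborel (cylinder D k)" .
qed simp

lemma emeasure_surface_measure:
  assumes D: "D \<in> sets borel"
  shows "emeasure (surface_measure {x. n \<bullet> x = b}) D = emeasure lborel {y. \<bar>height y\<bar> \<le> 1 / 2 \<and> foot y \<in> D}"
proof -
  have slab: "{y. \<bar>height y\<bar> \<le> 1 / 2} \<in> sets lborel" by measurable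
  have "emeasure (surface_measure {x. n \<bullet> x = b}) D
      = emeasure (restrict_space lborel {y. \<bar>height y\<bar> \<le> 1 / 2}) (foot -` D \<inter> {y. \<bar>height y\<bar> \<le> 1 / 2})"
    unfolding surface_measure_def infdist_hyperplane closest_point_hyperplane[abs_def]
    using D by (subst emeasure_distr) (auto simp: space_restrict_space intro!: measurable_restrict_space1)
  also have "\<dots> = emeasure lborel {y. \<bar>height y\<bar> \<le> 1 / 2 \<and> foot y \<in> D}"
    using slab by (subst emeasure_restrict_space) (auto intro!: arg_cong2[where f = emeasure])
  finally show ?thesis .
qed

text \<open>
  The closed slab of thickness one contains a half open cylinder of height one and is contained in
  one of height two.
\<close>

lemma surface_measure_cylinder:
  assumes D: "D \<in> sets borel" "bounded D"
  shows "emeasure (surface_measure {x. n \<bullet> x = b}) D < \<infinity>"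
    "measure lborel (cylinder D 1) \<le> measure (surface_measure {x. n \<bullet> x = b}) D"
    "measure (surface_measure {x. n \<bullet> x = b}) D \<le> 2 * measure lborel (cylinder D 1)"
proof -
  define S where "S = {y. \<bar>height y\<bar> \<le> 1 / 2 \<and> foot y \<in> D}"
  have Ss: "S \<in> sets borel"
    unfolding S_def using height_foot_sets[OF D(1), of "\<lambda>t. \<bar>t\<bar> \<le> 1 / 2"] by simp
  obtain z s where D': "D \<subseteq> cball z s" using bounded_in_cball[OF D(2)] by blast
  have "S \<subseteq> cball z (s + 1)"
  proof
    fix y assume y: "y \<in> S"
    have "dist z y \<le> dist z (foot y) + dist (foot y) y" by (rule dist_triangle)
    also have "dist (foot y) y = \<bar>height y\<bar>" by (simp add: dist_foot dist_commute)
    finally show "y \<in> cball z (s + 1)" using y D' by (auto simp: S_def)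
  qed
  then have "emeasure lborel S \<le> emeasure lborel (cball z (s + 1))" by (intro emeasure_mono) auto
  also have "\<dots> < \<infinity>" by (rule emeasure_lborel_cball_finite)
  finally have fin: "emeasure lborel S < \<infinity>" .
  show "emeasure (surface_measure {x. n \<bullet> x = b}) D < \<infinity>"
    using fin by (simp add: emeasure_surface_measure[OF D(1)] S_def)
  have eq: "measure (surface_measure {x. n \<bullet> x = b}) D = measure lborel S"
    by (simp add: measure_def emeasure_surface_measure[OF D(1)] S_def)
  define T where "T = (\<lambda>y. (- (1/2)) *\<^sub>R n + y) -` S"
  have T: "T = {y. 0 \<le> height y \<and> height y \<le> 1 \<and> foot y \<in> D}"
  proof -
    have "\<bar>- (1/2) + h\<bar> \<le> 1/2 \<longleftrightarrow> 0 \<le> h \<and> h \<le> 1" for h :: real by linarith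
    then show ?thesis unfolding T_def S_def vimage_def by (simp only: mem_Collect_eq height_translate foot_translate conj_assoc)
  qed
  have Ts: "T \<in> sets borel"
    unfolding T using height_foot_sets[OF D(1), of "\<lambda>t. 0 \<le> t \<and> t \<le> 1"] by simp
  have ST: "measure lborel S = measure lborel T" unfolding T_def by (rule measure_lborel_translate[OF Ss, symmetric])
  have c2: "cylinder D 2 \<in> fmeasurable lborel" by (rule cylinder_fmeasurable[OF D])
  have sub: "cylinder D 1 \<subseteq> T" "T \<subseteq> cylinder D 2" by (auto simp: T cylinder_def)
  have Tf: "T \<in> fmeasurable lborel" using fmeasurableI2[OF c2 sub(2)] Ts by simp
  show "measure lborel (cylinder D 1) \<le> measure (surface_measure {x. n \<bullet> x = b}) D"
    unfolding eq ST using cylinder_sets[OF D(1)] by (intro measure_mono_fmeasurable sub Tf) auto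
  have "measure lborel T \<le> measure lborel (cylinder D 2)"
    using Ts by (intro measure_mono_fmeasurable sub c2) auto
  then show "measure (surface_measure {x. n \<bullet> x = b}) D \<le> 2 * measure lborel (cylinder D 1)"
    unfolding eq ST using measure_cylinder_linear[OF D, of 2] by simp
qed

lemma card_power: "s ^ CARD('d) = s * s ^ (CARD('d) - 1)" for s :: real
  by (subst power_eq_if) simp

text \<open>
  The ball of radius \<open>s\<close> that touches the hyperplane at \<open>z\<close> lies in the cylinder of height \<open>2 s\<close>.
\<close>

lemma surface_measure_lower:
  assumes D: "D \<in> sets borel" "bounded D" and z: "n \<bullet> z = b" "cball z s \<inter> {x. n \<bullet> x = b} \<subseteq> D" and s: "s > 0"
  shows "unit_ball_vol CARD('d) / 2 * s ^ (CARD('d) - 1) \<le> measure (surface_measure {x. n \<bullet> x = b}) D"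
proof -
  have "ball (z + s *\<^sub>R n) s \<subseteq> cylinder D (2 * s)"
  proof
    fix y assume "y \<in> ball (z + s *\<^sub>R n) s"
    then have y: "norm (y - (z + s *\<^sub>R n)) < s" by (simp add: dist_norm norm_minus_commute)
    define w where "w = y - (z + s *\<^sub>R n)"
    have hy: "height y = s + n \<bullet> w"
      using z by (simp add: height_def w_def inner_diff_right inner_add_right nn)
    have nw: "\<bar>n \<bullet> w\<bar> \<le> norm w" using Cauchy_Schwarz_ineq2[of n w] n by simp
    have fy: "foot y - z = w - (n \<bullet> w) *\<^sub>R n" by (simp add: foot_def hy w_def algebra_simps)
    have "(norm (foot y - z))\<^sup>2 = (norm w)\<^sup>2 - (n \<bullet> w)\<^sup>2"
      unfolding fy power2_norm_eq_inner
      by (simp add: inner_diff_left inner_diff_right nn inner_commute power2_eq_square)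
    then have "(norm (foot y - z))\<^sup>2 \<le> (norm w)\<^sup>2" by simp
    then have "norm (foot y - z) \<le> norm w" by (rule power2_le_imp_le) simp
    then have "foot y \<in> D" using y z(2) n_foot by (auto simp: w_def dist_norm norm_minus_commute)
    then show "y \<in> cylinder D (2 * s)" using nw y by (auto simp: cylinder_def hy w_def[symmetric])
  qed
  moreover have "cylinder D (2 * s) \<in> fmeasurable lborel" by (rule cylinder_fmeasurable[OF D])
  ultimately have "measure lborel (ball (z + s *\<^sub>R n) s) \<le> measure lborel (cylinder D (2 * s))"
    by (intro measure_mono_fmeasurable) auto
  also have "\<dots> = 2 * s * measure lborel (cylinder D 1)" using s by (intro measure_cylinder_linear D) auto
  also have "\<dots> \<le> 2 * s * measure (surface_measure {x. n \<bullet> x = b}) D"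
    using s surface_measure_cylinder(2)[OF D] by (intro mult_left_mono) auto
  finally have "unit_ball_vol CARD('d) * (s * s ^ (CARD('d) - 1)) \<le> s * (2 * measure (surface_measure {x. n \<bullet> x = b}) D)"
    using s card_power by (simp add: content_ball)
  then have "s * (unit_ball_vol CARD('d) * s ^ (CARD('d) - 1)) \<le> s * (2 * measure (surface_measure {x. n \<bullet> x = b}) D)"
    by (simp only: mult.left_commute)
  then have "unit_ball_vol CARD('d) * s ^ (CARD('d) - 1) \<le> 2 * measure (surface_measure {x. n \<bullet> x = b}) D"
    using s by (rule mult_left_le_imp_le)
  then show ?thesis by simp
qed

lemma surface_measure_upper:
  assumes D: "D \<in> sets borel" "D \<subseteq> cball z s" and s: "s > 0"
  shows "measure (surface_measure {x. n \<bullet> x = b}) D \<le> unit_ball_vol CARD('d) * 3 ^ CARD('d) * s ^ (CARD('d) - 1)"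
proof -
  have bD: "bounded D" using D(2) bounded_subset bounded_cball by blast
  have "s * measure (surface_measure {x. n \<bullet> x = b}) D \<le> s * (2 * measure lborel (cylinder D 1))"
    using s surface_measure_cylinder(3)[OF D(1) bD] by (intro mult_left_mono) auto
  also have "\<dots> = measure lborel (cylinder D (2 * s))"
    using s measure_cylinder_linear[OF D(1) bD, of "2 * s"] by simp
  also have "\<dots> \<le> measure lborel (cball z (s + 2 * s))"
    using cylinder_subset_cball[OF D(2), of "2 * s"] emeasure_lborel_cball_finite cylinder_sets[OF D(1)]
    by (intro measure_mono_fmeasurable fmeasurableI) auto
  also have "\<dots> = unit_ball_vol CARD('d) * (3 * s) ^ CARD('d)"
    using s by (simp add: content_cball)
  also have "\<dots> = s * (unit_ball_vol CARD('d) * 3 ^ CARD('d) * s ^ (CARD('d) - 1))"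
    by (simp add: power_mult_distrib card_power)
  finally show ?thesis using s by (rule mult_left_le_imp_le)
qed

end

section \<open>Combinatorics of a mesh\<close>

text \<open>
  Finitely many proper affine subspaces form a null set.
\<close>

lemma ex_point_avoiding_affine_hulls:
  fixes U :: "'a::euclidean_space set"
  assumes U: "open U" "U \<noteq> {}" and F: "finite F" "\<And>f. f \<in> F \<Longrightarrow> aff_dim f < DIM('a)"
  obtains y where "y \<in> U" "\<And>f. f \<in> F \<Longrightarrow> y \<notin> affine hull f"
proof -
  have "negligible (affine hull f)" if "f \<in> F" for f
  proof -
    have "interior (affine hull f) = {}"
    proof (rule ccontr)
      assume "interior (affine hull f) \<noteq> {}"
      then have "aff_dim (affine hull f) = DIM('a)" by (rule aff_dim_nonempty_interior)
      with F(2)[OF that] show False by simp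
    qed
    then show ?thesis
      by (simp add: negligible_convex_interior affine_imp_convex)
  qed
  then have "negligible (\<Union>f\<in>F. affine hull f)" using F(1) by (intro negligible_Union) auto
  moreover have "\<not> negligible U" using U open_not_negligible by blast
  ultimately have "\<not> U \<subseteq> (\<Union>f\<in>F. affine hull f)" using negligible_subset by blast
  then show ?thesis using that by blast
qed

locale mesh =
  fixes \<Omega> :: "(real ^ 'd) set" and T :: "(real ^ 'd) set set"
  assumes domain: "polyhedral_domain \<Omega>" and mesh: "mesh_of \<Omega> T" and card2: "2 \<le> CARD('d)"
begin

lemma finite_mesh: "finite T"
  and element_simplex: "K \<in> T \<Longrightarrow> int CARD('d) simplex K"
  and cover: "\<Union>T = closure \<Omega>"
  and inter_face: "K \<in> T \<Longrightarrow> K' \<in> T \<Longrightarrow> (K \<inter> K') face_of K"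
  using mesh by (auto simp: mesh_of_def triangulation_def)

lemma element_nonempty_interior: assumes "K \<in> T" shows "interior K \<noteq> {}"
proof -
  have c: "convex K" and d: "aff_dim K = int CARD('d)"
    using element_simplex[OF assms] convex_simplex aff_dim_simplex by auto
  then have "affine hull K = UNIV" using aff_dim_eq_full[of K] by simp
  then have "rel_interior K = interior K" by (rule rel_interior_interior)
  moreover have "K \<noteq> {}" using d by force
  ultimately show ?thesis using rel_interior_eq_empty[OF c] by simp
qed

lemma element_facts:
  assumes "K \<in> T"
  shows "convex K" "compact K" "closed K" "bounded K" "polytope K" "polyhedron K" "aff_dim K = int CARD('d)" "K \<noteq> {}"
  using element_simplex[OF assms] element_nonempty_interior[OF assms]
  by (auto simp: convex_simplex compact_simplex closed_simplex compact_imp_bounded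
      simplex_imp_polytope simplex_imp_polyhedron aff_dim_simplex)

lemma mesh_nonempty: "T \<noteq> {}"
  using cover domain closure_subset by (fastforce simp: polyhedral_domain_def)

lemma convex_cover: "convex (\<Union>T)"
  unfolding cover using domain by (simp add: polyhedral_domain_def convex_closure)

text \<open>
  If the interior of \<open>K\<close> meets \<open>K'\<close>, then the common face is not a proper face of \<open>K\<close>, so \<open>K\<close> is a
  face of \<open>K'\<close> of full dimension.
\<close>

lemma element_eqI:
  assumes K: "K \<in> T" "K' \<in> T" and x: "x \<in> interior K" "x \<in> K'"
  shows "K = K'"
proof -
  have "x \<in> K" using x interior_subset by blast
  then have "K \<inter> K' \<inter> interior K \<noteq> {}" using x by blast
  then have 1: "K \<inter> K' = K" using face_of_disjoint_interior[OF inter_face[OF K]] by blast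
  have "(K' \<inter> K) face_of K'" by (rule inter_face[OF K(2,1)])
  then have "K face_of K'" using 1 by (simp add: Int_commute)
  then show ?thesis
    using face_of_aff_dim_lt[of K' K] element_facts(1,7)[OF K(2)] element_facts(7)[OF K(1)] by auto
qed

lemma adjacentD: "K \<in> adjacent T e \<Longrightarrow> K \<in> T" "K \<in> adjacent T e \<Longrightarrow> e facet_of K"
  by (auto simp: adjacent_def)

lemma finite_adjacent: "finite (adjacent T e)"
  using finite_mesh by (simp add: adjacent_def)

lemma normal:
  assumes "K \<in> adjacent T e"
  obtains b where "norm (outward_normal K e) = 1" "K \<subseteq> {x. outward_normal K e \<bullet> x \<le> b}"
    "e = K \<inter> {x. outward_normal K e \<bullet> x = b}" "affine hull e = {x. outward_normal K e \<bullet> x = b}"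
    "\<And>q. q \<in> interior K \<Longrightarrow> outward_normal K e \<bullet> q < b"
proof (rule facet_normal[OF element_facts(6)[OF adjacentD(1)[OF assms]]
      element_nonempty_interior[OF adjacentD(1)[OF assms]] adjacentD(2)[OF assms]])
qed (rule that)

lemma norm_normal: "K \<in> adjacent T e \<Longrightarrow> norm (outward_normal K e) = 1"
  by (erule normal)

lemma affine_hull_facet: "K \<in> adjacent T e \<Longrightarrow> \<exists>b. affine hull e = {x. outward_normal K e \<bullet> x = b}"
  by (erule normal) (rule exI)

lemma facet_rel_interior: assumes "K \<in> adjacent T e" obtains x where "x \<in> rel_interior e"
proof -
  have "e face_of K" "e \<noteq> {}" using adjacentD[OF assms] by (auto simp: facet_of_def)
  moreover have "convex e" using calculation face_of_imp_convex by blast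
  ultimately show ?thesis using rel_interior_eq_empty that by blast
qed

lemma half_ball:
  assumes "K \<in> adjacent T e" "x \<in> rel_interior e"
  obtains d where "d > 0" "\<And>y. dist y x < d \<Longrightarrow> outward_normal K e \<bullet> y \<le> outward_normal K e \<bullet> x \<Longrightarrow> y \<in> K"
proof -
  obtain b where b1: "norm (outward_normal K e) = 1" and b: "K \<subseteq> {x. outward_normal K e \<bullet> x \<le> b}"
    "e = K \<inter> {x. outward_normal K e \<bullet> x = b}" "affine hull e = {x. outward_normal K e \<bullet> x = b}"
    "\<And>q. q \<in> interior K \<Longrightarrow> outward_normal K e \<bullet> q < b"
    by (rule normal[OF assms(1)]) (rule that)
  obtain q where q: "q \<in> interior K" using element_nonempty_interior adjacentD[OF assms(1)] by blast
  then have qK: "q \<in> K" using interior_subset by blast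
  have "x \<in> e" using assms(2) rel_interior_subset by blast
  then have x: "outward_normal K e \<bullet> x = b" using b(2) by blast
  have eK: "e \<subseteq> K" using b(2) by blast
  obtain d where "d > 0" "\<And>y. dist y x < d \<Longrightarrow> outward_normal K e \<bullet> y \<le> b \<Longrightarrow> y \<in> K"
    using facet_half_ball[OF element_facts(1)[OF adjacentD(1)[OF assms(1)]] qK b(4)[OF q] eK b(3) assms(2)] by blast
  then show ?thesis using that x by blast
qed

text \<open>
  If the normals agreed, both elements would contain the same half ball at a point of the facet.
\<close>

lemma opposite_normals:
  assumes K: "K \<in> adjacent T e" "K' \<in> adjacent T e" "K \<noteq> K'"
  shows "outward_normal K' e = - outward_normal K e"
proof -
  let ?n = "outward_normal K e" and ?n' = "outward_normal K' e"
  obtain b where b: "norm ?n = 1" "affine hull e = {x. ?n \<bullet> x = b}"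
    using norm_normal[OF K(1)] affine_hull_facet[OF K(1)] by blast
  obtain b' where b': "norm ?n' = 1" "affine hull e = {x. ?n' \<bullet> x = b'}"
    using norm_normal[OF K(2)] affine_hull_facet[OF K(2)] by blast
  have "?n' = ?n \<or> ?n' = - ?n"
    using b b' by (intro unit_normals_of_same_hyperplane) auto
  moreover have "?n' \<noteq> ?n"
  proof
    assume eq: "?n' = ?n"
    obtain x where x: "x \<in> rel_interior e" using facet_rel_interior[OF K(1)] .
    obtain d where d: "d > 0" "\<And>y. dist y x < d \<Longrightarrow> ?n \<bullet> y \<le> ?n \<bullet> x \<Longrightarrow> y \<in> K"
      using half_ball[OF K(1) x] by blast
    obtain d' where d': "d' > 0" "\<And>y. dist y x < d' \<Longrightarrow> ?n' \<bullet> y \<le> ?n' \<bullet> x \<Longrightarrow> y \<in> K'"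
      using half_ball[OF K(2) x] by blast
    define \<delta> where "\<delta> = min d d' / 2"
    have \<delta>: "\<delta> > 0" using d d' by (simp add: \<delta>_def)
    define y where "y = x - \<delta> *\<^sub>R ?n"
    have yx: "dist y x = \<delta>" using b(1) \<delta> by (simp add: y_def dist_norm)
    have "ball y \<delta> \<subseteq> K \<inter> K'"
    proof
      fix z assume z: "z \<in> ball y \<delta>"
      have "dist z x \<le> dist z y + dist y x" by (rule dist_triangle)
      then have zx: "dist z x < d" "dist z x < d'" using z yx \<delta> by (auto simp: \<delta>_def dist_commute)
      have "?n \<bullet> (z - y) \<le> norm ?n * norm (z - y)" by (rule norm_cauchy_schwarz)
      also have "\<dots> \<le> \<delta>" using z b(1) by (simp add: dist_norm norm_minus_commute)
      finally have "?n \<bullet> z \<le> ?n \<bullet> y + \<delta>" by (simp add: inner_diff_right)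
      also have "?n \<bullet> y = ?n \<bullet> x - \<delta>" using b(1) by (simp add: y_def inner_diff_right norm_eq_1)
      finally show "z \<in> K \<inter> K'" using d(2)[OF zx(1)] d'(2)[OF zx(2)] eq by simp
    qed
    then have "y \<in> interior K" "y \<in> K'"
      using \<delta> interior_maximal[of "ball y \<delta>" K] by (auto simp: subset_eq)
    then show False using element_eqI adjacentD(1)[OF K(1)] adjacentD(1)[OF K(2)] K(3) by blast
  qed
  ultimately show ?thesis by blast
qed

text \<open>
  Three pairwise opposite unit vectors do not exist.
\<close>

lemma card_adjacent_le: "card (adjacent T e) \<le> 2"
proof (rule ccontr)
  assume "\<not> ?thesis"
  then have "3 \<le> card (adjacent T e)" by simp
  then obtain S where S: "S \<subseteq> adjacent T e" "card S = 3"
    by (rule obtain_subset_with_card_n) (rule that)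
  from S(2) obtain A B C where "S = {A, B, C}" and ne: "A \<noteq> B" "A \<noteq> C" "B \<noteq> C"
    unfolding card_3_iff by blast
  then have ABC: "A \<in> adjacent T e" "B \<in> adjacent T e" "C \<in> adjacent T e" using S(1) by blast+
  have "outward_normal B e = - outward_normal A e" "outward_normal C e = - outward_normal A e"
    "outward_normal C e = - outward_normal B e"
    by (rule opposite_normals[OF ABC(1,2) ne(1)], rule opposite_normals[OF ABC(1,3) ne(2)],
        rule opposite_normals[OF ABC(2,3) ne(3)])
  then have "outward_normal A e \<bullet> outward_normal A e = - (outward_normal A e \<bullet> outward_normal A e)"
    by (metis inner_minus_right minus_minus)
  then show False using norm_normal[OF ABC(1)] by (simp add: norm_eq_1)
qed

lemma faces_iff: "e \<in> faces T \<longleftrightarrow> adjacent T e \<noteq> {}"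
proof -
  have "adjacent T e \<noteq> {} \<longleftrightarrow> card (adjacent T e) \<noteq> 0" using finite_adjacent[of e] by simp
  also have "\<dots> \<longleftrightarrow> card (adjacent T e) = 2 \<or> card (adjacent T e) = 1"
    using card_adjacent_le[of e] by arith
  finally show ?thesis by (simp add: faces_def interior_faces_def boundary_faces_def)
qed

lemma faces_eq: "faces T = {e. \<exists>K\<in>T. e facet_of K}"
  using faces_iff by (auto simp: adjacent_def)

lemma finite_faces: "finite (faces T)"
proof -
  have "faces T = (\<Union>K\<in>T. {e. e facet_of K})" by (auto simp: faces_eq)
  then show ?thesis using finite_mesh card_facets_simplex(1)[OF element_simplex] by simp
qed

lemma face_cases:
  assumes "e \<in> faces T"
  obtains (boundary) K where "adjacent T e = {K}" "e \<notin> interior_faces T"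
    | (interior) K K' where "K \<noteq> K'" "adjacent T e = {K, K'}" "e \<in> interior_faces T"
proof (cases "e \<in> interior_faces T")
  case True
  then have "card (adjacent T e) = 2" by (simp add: interior_faces_def)
  then show ?thesis using card_2_iff[of "adjacent T e"] interior True by auto
next
  case False
  then have "card (adjacent T e) = 1" using assms by (simp add: faces_def boundary_faces_def)
  then show ?thesis using card_1_singletonE boundary False by metis
qed

lemma facesI: "K \<in> adjacent T e \<Longrightarrow> e \<in> faces T"
  by (auto simp: faces_eq adjacent_def)

lemma card_faces_of_element: assumes "K \<in> T"
  shows "finite {e\<in>faces T. K \<in> adjacent T e}" "card {e\<in>faces T. K \<in> adjacent T e} \<le> CARD('d) + 1"
proof -
  have "{e\<in>faces T. K \<in> adjacent T e} = {e. e facet_of K}" using assms by (auto simp: faces_eq adjacent_def)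
  then show "finite {e\<in>faces T. K \<in> adjacent T e}" "card {e\<in>faces T. K \<in> adjacent T e} \<le> CARD('d) + 1"
    using card_facets_simplex[OF element_simplex[OF assms]] by simp_all
qed

lemma sum_faces_adjacent_le:
  assumes "\<And>K. K \<in> T \<Longrightarrow> g K \<ge> (0::real)"
  shows "(\<Sum>e\<in>faces T. \<Sum>K\<in>adjacent T e. g K) \<le> (real CARD('d) + 1) * (\<Sum>K\<in>T. g K)"
proof -
  have "(\<Sum>e\<in>faces T. \<Sum>K\<in>adjacent T e. g K) = (\<Sum>e\<in>faces T. \<Sum>K\<in>{K\<in>T. K \<in> adjacent T e}. g K)"
    by (intro sum.cong) (auto simp: adjacent_def)
  also have "\<dots> = (\<Sum>K\<in>T. \<Sum>e\<in>{e\<in>faces T. K \<in> adjacent T e}. g K)"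
    by (rule sum.swap_restrict[OF finite_faces finite_mesh])
  also have "\<dots> = (\<Sum>K\<in>T. real (card {e\<in>faces T. K \<in> adjacent T e}) * g K)" by simp
  also have "\<dots> \<le> (\<Sum>K\<in>T. (real CARD('d) + 1) * g K)"
  proof (rule sum_mono)
    fix K assume K: "K \<in> T"
    have "real (card {e\<in>faces T. K \<in> adjacent T e}) \<le> real CARD('d) + 1"
      using card_faces_of_element(2)[OF K] by linarith
    then show "real (card {e\<in>faces T. K \<in> adjacent T e}) * g K \<le> (real CARD('d) + 1) * g K"
      by (intro mult_right_mono assms K)
  qed
  finally show ?thesis by (simp add: sum_distrib_left)
qed

section \<open>Chains of elements along generic segments\<close>

text \<open>
  The faces of codimension at least two, which a generic segment avoids.
\<close>

definition low_faces :: "(real ^ 'd) set set" where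
  "low_faces = {f. (\<exists>K\<in>T. f face_of K) \<and> aff_dim f \<le> int CARD('d) - 2}"

lemma finite_low_faces: "finite low_faces"
proof -
  have "low_faces \<subseteq> (\<Union>K\<in>T. {f. f face_of K})" by (auto simp: low_faces_def)
  moreover have "finite (\<Union>K\<in>T. {f. f face_of K})" using finite_mesh finite_polytope_faces element_facts(5) by blast
  ultimately show ?thesis using finite_subset by blast
qed

text \<open>
  First \<open>x\<close> is chosen off the affine hulls of all low-dimensional faces, then \<open>y\<close> off the affine
  hulls spanned by \<open>x\<close> and these faces; the latter are proper because the faces have codimension
  two.
\<close>

lemma generic_segment:
  assumes "open U" "U \<noteq> {}" "open V" "V \<noteq> {}"
  obtains x y where "x \<in> U" "y \<in> V" "\<And>f. f \<in> low_faces \<Longrightarrow> closed_segment x y \<inter> f = {}"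
proof -
  have lt: "aff_dim f \<le> int CARD('d) - 2" if "f \<in> low_faces" for f using that by (simp add: low_faces_def)
  obtain x where x: "x \<in> U" "\<And>f. f \<in> low_faces \<Longrightarrow> x \<notin> affine hull f"
  proof (rule ex_point_avoiding_affine_hulls[OF assms(1,2) finite_low_faces])
    show "aff_dim f < DIM(real ^ 'd)" if "f \<in> low_faces" for f using lt[OF that] by simp
  qed (rule that)
  have fin: "finite (insert x ` low_faces)" using finite_low_faces by simp
  have lt2: "aff_dim g < DIM(real ^ 'd)" if g: "g \<in> insert x ` low_faces" for g
  proof -
    obtain f where f: "f \<in> low_faces" "g = insert x f" using g by blast
    have "aff_dim g \<le> aff_dim f + 1" unfolding f(2) aff_dim_insert by simp
    then show ?thesis using lt[OF f(1)] by simp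
  qed
  obtain y where y: "y \<in> V" "\<And>g. g \<in> insert x ` low_faces \<Longrightarrow> y \<notin> affine hull g"
    using ex_point_avoiding_affine_hulls[OF assms(3,4) fin lt2] by blast
  have "closed_segment x y \<inter> f = {}" if f: "f \<in> low_faces" for f
  proof (rule ccontr)
    assume "closed_segment x y \<inter> f \<noteq> {}"
    then obtain u where u: "(1 - u) *\<^sub>R x + u *\<^sub>R y \<in> f" by (auto simp: in_segment)
    define z where "z = (1 - u) *\<^sub>R x + u *\<^sub>R y"
    have "x \<notin> f" using x(2)[OF f] hull_inc by metis
    then have u0: "u \<noteq> 0" using u by auto
    have zin: "z \<in> affine hull (insert x f)" and xin: "x \<in> affine hull (insert x f)"
      using u unfolding z_def by (auto intro: hull_inc)
    \<comment> \<open>The point \<open>y\<close> lies on the line through \<open>x\<close> and the point \<open>z\<close> of the face.\<close>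
    let ?w = "(1 - 1 / u) *\<^sub>R x + (1 / u) *\<^sub>R z"
    have uu: "u * (1 - 1 / u) = u - 1" "u * (1 / u) = 1" using u0 by (simp_all add: right_diff_distrib)
    have "u *\<^sub>R ?w = (u * (1 - 1 / u)) *\<^sub>R x + (u * (1 / u)) *\<^sub>R z"
      by (simp only: scaleR_add_right scaleR_scaleR)
    also have "\<dots> = u *\<^sub>R y" unfolding uu by (simp add: z_def scaleR_diff_left)
    finally have "?w = y" using u0 by (simp only: scaleR_cancel_left) simp
    moreover have "?w \<in> affine hull (insert x f)"
      by (intro mem_affine[OF affine_affine_hull xin zin]) simp
    ultimately show False using y(2)[of "insert x f"] f by blast
  qed
  with x y show ?thesis using that by blast
qed

lemma share_facet:
  assumes K: "K \<in> T" "K' \<in> T" "K \<noteq> K'" and z: "z \<in> K" "z \<in> K'" "\<And>f. f \<in> low_faces \<Longrightarrow> z \<notin> f"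
  shows "adjacent T (K \<inter> K') = {K, K'}"
proof -
  let ?e = "K \<inter> K'"
  have f: "?e face_of K" "?e face_of K'"
    using inter_face[OF K(1,2)] inter_face[OF K(2,1)] by (simp_all add: Int_commute)
  have "?e \<notin> low_faces" using z by blast
  then have ge: "aff_dim ?e \<ge> int CARD('d) - 1" using f K by (force simp: low_faces_def)
  have fac: "?e facet_of A" if A: "A \<in> T" "?e face_of A" "?e \<noteq> A" for A
  proof -
    have "aff_dim ?e < int CARD('d)"
      using face_of_aff_dim_lt[OF element_facts(1)[OF A(1)] A(2,3)] element_facts(7)[OF A(1)] by simp
    then show ?thesis using ge A z element_facts(7)[OF A(1)] by (auto simp: facet_of_def)
  qed
  have ne: "?e \<noteq> K" "?e \<noteq> K'"
  proof -
    have "\<not> K \<subseteq> K'" if "K \<in> T" "K' \<in> T" "K \<noteq> K'" for K K'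
      using element_eqI[OF that(1,2)] element_nonempty_interior[OF that(1)] interior_subset that(3) by blast
    then show "?e \<noteq> K" "?e \<noteq> K'" using K by blast+
  qed
  have "{K, K'} \<subseteq> adjacent T ?e"
    using fac f ne K by (auto simp: adjacent_def)
  moreover have "card {K, K'} = 2" using K by simp
  ultimately show ?thesis using card_adjacent_le[of ?e] finite_adjacent[of ?e]
    by (metis card_seteq)
qed

definition segment_adjacency :: "real ^ 'd \<Rightarrow> real ^ 'd \<Rightarrow> (real ^ 'd) set rel" where
  "segment_adjacency x y =
     {(A, B). A \<in> T \<and> B \<in> T \<and> A \<inter> closed_segment x y \<noteq> {} \<and> B \<inter> closed_segment x y \<noteq> {} \<and>
        A \<noteq> B \<and> (\<exists>e. adjacent T e = {A, B})}"

text \<open>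
  The elements reachable from \<open>K\<close> and the other elements cover the segment by two closed sets. As a
  segment is connected, these sets share one of its points, and there the two elements meet in a
  facet.
\<close>

lemma element_chain:
  assumes K: "K \<in> T" "K' \<in> T"
  obtains x y where "x \<in> K" "y \<in> K'"
    "(K, K') \<in> (segment_adjacency x y)\<^sup>*"
proof -
  obtain x y where xy: "x \<in> interior K" "y \<in> interior K'" "\<And>f. f \<in> low_faces \<Longrightarrow> closed_segment x y \<inter> f = {}"
    using generic_segment[OF open_interior element_nonempty_interior[OF K(1)] open_interior element_nonempty_interior[OF K(2)]]
    by blast
  have xK: "x \<in> K" "y \<in> K'" using xy interior_subset by blast+
  define E where "E = segment_adjacency x y"
  \<comment> \<open>The elements that can be reached from \<open>K\<close>.\<close>
  define R where "R = {A\<in>T. (K, A) \<in> E\<^sup>*}"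
  have "(K, K') \<in> E\<^sup>*"
  proof (rule ccontr)
    assume "(K, K') \<notin> E\<^sup>*"
    then have K'R: "K' \<in> T - R" using K by (simp add: R_def)
    have KR: "K \<in> R" using K by (simp add: R_def)
    have cl: "closed (\<Union>R)" "closed (\<Union>(T - R))"
      using finite_mesh element_facts(3) by (auto intro!: closed_Union simp: R_def)
    have seg: "closed_segment x y \<subseteq> \<Union>R \<union> \<Union>(T - R)"
    proof -
      have "closed_segment x y \<subseteq> \<Union>T"
        using convex_cover xK K by (meson UnionI closed_segment_subset)
      then show ?thesis by (auto simp: R_def)
    qed
    have "\<Union>R \<inter> \<Union>(T - R) \<inter> closed_segment x y = {}"
    proof (rule ccontr)
      assume "\<not> ?thesis"
      then obtain z A B where z: "z \<in> closed_segment x y" "A \<in> R" "z \<in> A" "B \<in> T - R" "z \<in> B" by blast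
      have AB: "A \<in> T" "B \<in> T" "A \<noteq> B" using z by (auto simp: R_def)
      have "adjacent T (A \<inter> B) = {A, B}"
        using xy(3) z by (intro share_facet[OF AB]) auto
      then have "(A, B) \<in> E" unfolding E_def segment_adjacency_def using AB z by blast
      then have "(K, B) \<in> E\<^sup>*" using z(2) by (auto simp: R_def)
      then show False using z(4) AB by (simp add: R_def)
    qed
    from connected_closedD[OF convex_connected[OF convex_closed_segment] this seg cl]
    show False using xK KR K'R by auto
  qed
  then show ?thesis using that xK unfolding E_def by blast
qed

text \<open>
  Otherwise a generic segment from inside the mesh to its complement could never leave the mesh:
  every point of the segment in the mesh is interior to an element or to the union of the two
  elements at a facet.
\<close>

lemma ex_boundary_face: "\<exists>e. card (adjacent T e) = 1"
proof (rule ccontr)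
  assume none: "\<not> ?thesis"
  obtain K where K: "K \<in> T" using mesh_nonempty by blast
  have bd: "bounded (\<Union>T)" and cl: "closed (\<Union>T)"
    unfolding cover using domain by (auto simp: polyhedral_domain_def)
  then have "- \<Union>T \<noteq> {}"
    using not_bounded_UNIV by (metis Compl_UNIV_eq double_compl)
  then obtain x y where xy: "x \<in> interior K" "y \<in> - \<Union>T" "\<And>f. f \<in> low_faces \<Longrightarrow> closed_segment x y \<inter> f = {}"
    using generic_segment[OF open_interior element_nonempty_interior[OF K] open_Compl[OF cl]] by blast
  have int: "z \<in> interior (\<Union>T)" if z: "z \<in> closed_segment x y" "z \<in> A" "A \<in> T" for z A
  proof (cases "z \<in> interior A")
    case True
    then show ?thesis using interior_mono[of A "\<Union>T"] z by blast
  next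
    case False
    have "rel_interior A = interior A"
      using aff_dim_eq_full[of A] element_facts(7)[OF z(3)] rel_interior_interior by auto
    then have "z \<in> \<Union>{F. F facet_of A}"
      using False z(2) rel_boundary_of_polyhedron[OF element_facts(6)[OF z(3)]] by blast
    then obtain e where e: "e facet_of A" "z \<in> e" by blast
    have eA: "e face_of A" using e facet_of_imp_face_of by blast
    have poly: "polyhedron e"
      using eA element_facts(5)[OF z(3)] by (meson face_of_polytope_polytope polytope_imp_polyhedron)
    \<comment> \<open>The segment avoids the facets of \<open>e\<close>.\<close>
    have ri: "z \<in> rel_interior e"
    proof (rule ccontr)
      assume "z \<notin> rel_interior e"
      then obtain f where f: "f facet_of e" "z \<in> f" using e(2) rel_boundary_of_polyhedron[OF poly] by blast
      have "f face_of A" using f(1) eA face_of_trans facet_of_imp_face_of by blast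
      moreover have "aff_dim f = int CARD('d) - 2"
        using f(1) e(1) element_facts(7)[OF z(3)] by (simp add: facet_of_def)
      ultimately have "f \<in> low_faces" using z(3) by (auto simp: low_faces_def)
      then show False using xy(3) z(1) f(2) by blast
    qed
    have A: "A \<in> adjacent T e" using e z by (simp add: adjacent_def)
    have "card (adjacent T e) \<noteq> card {A}" using none by simp
    then have "adjacent T e \<noteq> {A}" by metis
    then obtain B where B: "B \<in> adjacent T e" "A \<noteq> B" using A by blast
    let ?n = "outward_normal A e"
    have nB: "outward_normal B e = - ?n" by (rule opposite_normals[OF A B])
    obtain d where d: "d > 0" "\<And>y. dist y z < d \<Longrightarrow> ?n \<bullet> y \<le> ?n \<bullet> z \<Longrightarrow> y \<in> A"
      using half_ball[OF A ri] by blast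
    obtain d' where d': "d' > 0" "\<And>y. dist y z < d' \<Longrightarrow> - ?n \<bullet> y \<le> - ?n \<bullet> z \<Longrightarrow> y \<in> B"
      using half_ball[OF B(1) ri] nB by auto
    have "ball z (min d d') \<subseteq> \<Union>T"
    proof
      fix w assume w: "w \<in> ball z (min d d')"
      show "w \<in> \<Union>T"
      proof (cases "?n \<bullet> w \<le> ?n \<bullet> z")
        case True
        then show ?thesis using d(2)[of w] w z(3) by (auto simp: dist_commute)
      next
        case False
        then show ?thesis using d'(2)[of w] w adjacentD(1)[OF B(1)] by (auto simp: dist_commute)
      qed
    qed
    then have "ball z (min d d') \<subseteq> interior (\<Union>T)" by (simp add: interior_maximal)
    then show ?thesis using d d' by (auto simp: subset_eq)
  qed
  have xT: "x \<in> interior (\<Union>T)"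
    using xy(1) interior_subset K int[of x K] by auto
  have "closed_segment x y \<subseteq> interior (\<Union>T) \<union> (- \<Union>T)" using int by blast
  moreover have "interior (\<Union>T) \<inter> (- \<Union>T) \<inter> closed_segment x y = {}" using interior_subset by blast
  ultimately have "interior (\<Union>T) \<inter> closed_segment x y = {} \<or> (- \<Union>T) \<inter> closed_segment x y = {}"
    by (intro connectedD[OF convex_connected[OF convex_closed_segment]] open_interior open_Compl cl) auto
  then show False using xT xy(2) by auto
qed

section \<open>Jumps\<close>

lemma norm_jump_interior:
  assumes "K \<noteq> K'" "adjacent T e = {K, K'}"
  shows "(norm (jump T e v x))\<^sup>2 = (v K x - v K' x)\<^sup>2"
proof -
  have "jump T e v x = (v K x - v K' x) *\<^sub>R outward_normal K e"
    using assms opposite_normals[of K e K'] by (simp add: jump_def algebra_simps)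
  then show ?thesis using norm_normal[of K e] assms by (simp add: power_mult_distrib)
qed

lemma norm_jump_boundary:
  assumes "adjacent T e = {K}" shows "(norm (jump T e v x))\<^sup>2 = (v K x)\<^sup>2"
  using norm_normal[of K e] assms by (simp add: jump_def power_mult_distrib)

lemma jump_add: "jump T e (\<lambda>K x. v K x + w K x) x = jump T e v x + jump T e w x"
  by (simp add: jump_def scaleR_add_left sum.distrib)

lemma norm_jump_le: "(norm (jump T e v x))\<^sup>2 \<le> 2 * (\<Sum>K\<in>adjacent T e. (v K x)\<^sup>2)"
proof (cases "e \<in> faces T")
  case True
  then show ?thesis
  proof (cases rule: face_cases)
    case (boundary K)
    then show ?thesis using norm_jump_boundary by simp
  next
    case (interior K K')
    have "(v K x - v K' x)\<^sup>2 \<le> 2 * ((v K x)\<^sup>2 + (v K' x)\<^sup>2)"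
      using zero_le_power2[of "v K x + v K' x"] by (simp add: power2_eq_square algebra_simps)
    then show ?thesis using interior norm_jump_interior by simp
  qed
next
  case False
  then have "adjacent T e = {}" using facesI by blast
  then show ?thesis by (simp add: jump_def)
qed

text \<open>
  The squared jump of a piecewise constant function, which is the same at all points of a facet; it
  is evaluated at the origin for definiteness.
\<close>

definition sq_jump :: "((real ^ 'd) set \<Rightarrow> real) \<Rightarrow> (real ^ 'd) set \<Rightarrow> real" where
  "sq_jump v e = (norm (jump T e (\<lambda>K x. v K) 0))\<^sup>2"

lemma sq_jump_nonneg: "sq_jump v e \<ge> 0" by (simp add: sq_jump_def)

lemma sq_jump_interior: "K \<noteq> K' \<Longrightarrow> adjacent T e = {K, K'} \<Longrightarrow> sq_jump v e = (v K - v K')\<^sup>2"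
  unfolding sq_jump_def by (rule norm_jump_interior)

lemma sq_jump_boundary: "adjacent T e = {K} \<Longrightarrow> sq_jump v e = (v K)\<^sup>2"
  unfolding sq_jump_def by (rule norm_jump_boundary)

lemma jumps_zero_imp_zero:
  assumes z: "\<And>e. e \<in> faces T \<Longrightarrow> sq_jump v e = 0" and K: "K \<in> T"
  shows "v K = 0"
proof -
  obtain e K0 where e: "adjacent T e = {K0}" using ex_boundary_face card_1_singletonE by metis
  then have K0: "K0 \<in> T" "e \<in> faces T" using adjacentD[of K0 e] facesI[of K0 e] by auto
  have v0: "v K0 = 0" using z[OF K0(2)] sq_jump_boundary[OF e] by simp
  obtain x y where "x \<in> K0" "y \<in> K" and "(K0, K) \<in> (segment_adjacency x y)\<^sup>*"
    by (rule element_chain[OF K0(1) K]) (rule that)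
  from this(3) show ?thesis
  proof (induction rule: rtrancl_induct)
    case (step A B)
    then obtain f where f: "A \<noteq> B" "adjacent T f = {A, B}" by (auto simp: segment_adjacency_def)
    then have "f \<in> faces T" using facesI by auto
    from z[OF this] have "(v A - v B)\<^sup>2 = 0" unfolding sq_jump_interior[OF f] .
    then have "v A = v B" by simp
    with step.IH show ?case by simp
  qed (rule v0)
qed

end

section \<open>Quasi-uniform meshes\<close>

locale quasi_mesh = mesh \<Omega> T for \<Omega> :: "(real ^ 'd) set" and T :: "(real ^ 'd) set set" +
  fixes C\<sigma> :: real
  assumes C\<sigma>: "C\<sigma> > 0" and quasi: "quasi_uniform C\<sigma> T"
begin

definition h :: real where "h = (MAX K\<in>T. diameter K)"
text \<open>
  A radius strictly below the bound for the inradii, so that a ball of this radius exists in every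
  element although the inradius is a supremum.
\<close>

definition r :: real where "r = h / (2 * C\<sigma>)"

lemma dist_element_le: assumes "K \<in> T" "x \<in> K" "y \<in> K" shows "dist x y \<le> h"
proof -
  have "dist x y \<le> diameter K"
    using diameter_bounded_bound[OF element_facts(4)[OF assms(1)] assms(2,3)] .
  also have "\<dots> \<le> h" unfolding h_def using finite_mesh assms(1) by (intro Max_ge) auto
  finally show ?thesis .
qed

lemma element_subset_cball: "K \<in> T \<Longrightarrow> x \<in> K \<Longrightarrow> K \<subseteq> cball x h"
  using dist_element_le by auto

lemma h_pos: "h > 0"
proof -
  obtain K x where K: "K \<in> T" "x \<in> interior K"
    using mesh_nonempty element_nonempty_interior by blast
  then obtain e where e: "e > 0" "ball x e \<subseteq> K" unfolding mem_interior by blast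
  obtain i :: 'd where True by blast
  define y where "y = x + (e / 2) *\<^sub>R axis i 1"
  have d: "dist y x = e / 2" using e by (simp add: y_def dist_norm norm_axis_1)
  have "y \<in> K" "x \<in> K" using e d by (auto simp: subset_eq dist_commute)
  then have "e / 2 \<le> h" using dist_element_le[OF K(1), of y x] d by simp
  then show ?thesis using e by simp
qed

lemma r_pos: "r > 0" using h_pos C\<sigma> by (simp add: r_def)

lemma h_eq: "h = 2 * C\<sigma> * r" using C\<sigma> by (simp add: r_def)

lemma inner_ball: assumes "K \<in> T" obtains c where "cball c r \<subseteq> K"
proof -
  let ?S = "{r. 0 \<le> r \<and> (\<exists>x. cball x r \<subseteq> K)}"
  have "h \<le> C\<sigma> * (MIN K\<in>T. inradius K)" using quasi by (simp add: quasi_uniform_def h_def)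
  also have "\<dots> \<le> C\<sigma> * inradius K" using C\<sigma> finite_mesh assms by (intro mult_left_mono Min_le) auto
  finally have "h / C\<sigma> \<le> inradius K" using C\<sigma> by (simp add: field_simps)
  moreover have "r < h / C\<sigma>" using h_pos C\<sigma> by (simp add: r_def field_simps)
  ultimately have "r < Sup ?S" by (simp add: inradius_def)
  moreover obtain x where "x \<in> K" using element_facts(8)[OF assms] by blast
  then have "0 \<in> ?S" by auto
  ultimately obtain s where s: "s \<in> ?S" "r < s" using less_cSupD[of ?S r] by blast
  then obtain c where "cball c s \<subseteq> K" by blast
  then show ?thesis using that[of c] s(2) subset_cball[of r s c] by auto
qed

lemma facet_facts:
  assumes "K \<in> adjacent T e"
  shows "compact e" "e \<subseteq> K" "e \<noteq> {}"
proof -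
  have K: "K \<in> T" "e facet_of K" using adjacentD[OF assms] by auto
  show "compact e"
    by (rule face_of_imp_compact[OF element_facts(1,2)[OF K(1)] facet_of_imp_face_of[OF K(2)]])
  show "e \<subseteq> K" by (rule facet_of_imp_subset[OF K(2)])
  show "e \<noteq> {}" using K(2) by (simp add: facet_of_def)
qed

definition area :: "(real ^ 'd) set \<Rightarrow> real" where
  "area e = measure (surface_measure (affine hull e)) e"

text \<open>
  Facets are comparable to discs of radius \<open>r\<close>: they contain one and lie in an element of diameter at
  most \<open>h\<close>. The dimension enters in the lower bound for the diameter, where a direction within the
  facet is needed.
\<close>

lemma facet_geometry:
  assumes K: "K \<in> adjacent T e"
  shows "emeasure (surface_measure (affine hull e)) e < \<infinity>"
    "unit_ball_vol CARD('d) / 2 * r ^ (CARD('d) - 1) \<le> area e"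
    "area e \<le> unit_ball_vol CARD('d) * 3 ^ CARD('d) * h ^ (CARD('d) - 1)"
    "r \<le> diameter e" "diameter e \<le> h"
proof -
  let ?n = "outward_normal K e"
  obtain b where n: "norm ?n = 1" "K \<subseteq> {x. ?n \<bullet> x \<le> b}" "e = K \<inter> {x. ?n \<bullet> x = b}"
    "affine hull e = {x. ?n \<bullet> x = b}" "\<And>q. q \<in> interior K \<Longrightarrow> ?n \<bullet> q < b"
    by (rule normal[OF K]) (rule that)
  have KT: "K \<in> T" "e facet_of K" using adjacentD[OF K] by auto
  obtain c where c: "cball c r \<subseteq> K" using inner_ball[OF KT(1)] .
  obtain z where z: "?n \<bullet> z = b" "cball z r \<inter> {x. ?n \<bullet> x = b} \<subseteq> e"
    by (rule simplex_facet_contains_disc[OF element_simplex[OF KT(1)] KT(2) c r_pos n(1-3)])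
  have ez: "z \<in> e" using z r_pos by auto
  have eK: "e \<subseteq> K" "compact e" using facet_facts[OF K] by auto
  then have es: "e \<in> sets borel" "bounded e" by (auto simp: compact_imp_closed compact_imp_bounded)
  have eh: "e \<subseteq> cball z h" using element_subset_cball[OF KT(1), of z] eK(1) ez by blast
  interpret hp: unit_hyperplane ?n b by unfold_locales (rule n(1))
  show "emeasure (surface_measure (affine hull e)) e < \<infinity>"
    unfolding n(4) by (rule hp.surface_measure_cylinder(1)[OF es])
  show "unit_ball_vol CARD('d) / 2 * r ^ (CARD('d) - 1) \<le> area e"
    unfolding area_def n(4) by (rule hp.surface_measure_lower[OF es z r_pos])
  show "area e \<le> unit_ball_vol CARD('d) * 3 ^ CARD('d) * h ^ (CARD('d) - 1)"
    unfolding area_def n(4) by (rule hp.surface_measure_upper[OF es(1) eh h_pos])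
  show "diameter e \<le> h"
    using eK(1) dist_element_le[OF KT(1)] ez h_pos by (intro diameter_le) (auto simp: dist_norm)
  have "2 \<le> DIM(real ^ 'd)" using card2 by simp
  then obtain u where u: "u \<noteq> 0" "Linear_Algebra.orthogonal ?n u"
    by (rule orthogonal_to_vector_exists) (rule that)
  define w where "w = z + (r / norm u) *\<^sub>R u"
  have wz: "dist z w = r" using u r_pos by (simp add: w_def dist_norm)
  have "?n \<bullet> w = b" using z(1) u(2) by (simp add: w_def inner_add_right Linear_Algebra.orthogonal_def)
  then have "w \<in> e" using z(2) wz by auto
  then show "r \<le> diameter e" using diameter_bounded_bound[OF es(2) ez] wz by metis
qed

text \<open>
  The inscribed balls are disjoint, so their number is bounded by a ratio of volumes.
\<close>

lemma card_elements_le: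
  assumes A: "A \<subseteq> T" "\<And>K. K \<in> A \<Longrightarrow> K \<subseteq> cball x R" and R: "R \<ge> 0"
  shows "real (card A) \<le> (R / r) ^ CARD('d)"
proof -
  have "\<forall>K\<in>T. \<exists>c. cball c r \<subseteq> K" using inner_ball by metis
  then obtain c where c: "\<And>K. K \<in> T \<Longrightarrow> cball (c K) r \<subseteq> K" by metis
  have "real (card A) \<le> (R / r) ^ DIM(real ^ 'd)"
  proof (rule card_disjoint_balls_le[where c = c and x = x])
    show "finite A" using A finite_mesh finite_subset by blast
    show "ball (c K) r \<inter> ball (c K') r = {}" if K: "K \<in> A" "K' \<in> A" "K \<noteq> K'" for K K'
    proof (rule ccontr)
      assume "ball (c K) r \<inter> ball (c K') r \<noteq> {}"
      then obtain y where y: "y \<in> ball (c K) r" "y \<in> ball (c K') r" by blast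
      have KT: "K \<in> T" "K' \<in> T" using K A by auto
      have "ball (c K) r \<subseteq> interior K"
        using c[OF KT(1)] ball_subset_cball by (intro interior_maximal) auto
      then have "y \<in> interior K" using y by blast
      moreover have "y \<in> K'" using c[OF KT(2)] ball_subset_cball y by blast
      ultimately show False using element_eqI[OF KT] K(3) by blast
    qed
    show "ball (c K) r \<subseteq> cball x R" if "K \<in> A" for K
      using c[of K] A that ball_subset_cball by blast
  qed (use r_pos R in auto)
  then show ?thesis by simp
qed

section \<open>Patches and the discrete Poincare inequality\<close>

lemma patch_iter_mesh: "K \<in> T \<Longrightarrow> patch_iter T t K \<subseteq> T"
  by (induction t) (auto simp: neighbours_def)

lemma patch_iter_dist:
  assumes K: "K \<in> T" and x: "x \<in> K"
  shows "K' \<in> patch_iter T t K \<Longrightarrow> y \<in> K' \<Longrightarrow> dist x y \<le> (real t + 1) * h"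
proof (induction t arbitrary: K' y)
  case 0
  then show ?case using dist_element_le[OF K x] by simp
next
  case (Suc t)
  then obtain B where B: "B \<in> patch_iter T t K" "K' \<in> neighbours T B" by auto
  have BT: "B \<in> T" using B patch_iter_mesh[OF K] by blast
  have K'T: "K' \<in> T" using B by (simp add: neighbours_def)
  have "closure B \<inter> closure K' \<noteq> {}" using B by (simp add: neighbours_def)
  then obtain z where z: "z \<in> B" "z \<in> K'"
    using element_facts(3)[OF BT] element_facts(3)[OF K'T] by auto
  have "dist x y \<le> dist x z + dist z y" by (rule dist_triangle)
  also have "\<dots> \<le> (real t + 1) * h + h"
    using Suc.IH[OF B(1) z(1)] dist_element_le[OF K'T z(2) Suc.prems(2)] by linarith
  finally show ?case by (simp add: algebra_simps)
qed

lemma patch_iter_mono: assumes K: "K \<in> T" shows "patch_iter T t K \<subseteq> patch_iter T (Suc t) K"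
proof
  fix B assume B: "B \<in> patch_iter T t K"
  then have "B \<in> T" using patch_iter_mesh[OF K] by blast
  then have "B \<in> neighbours T B" using element_facts(3,8)[of B] by (simp add: neighbours_def)
  then show "B \<in> patch_iter T (Suc t) K" using B by auto
qed

text \<open>
  Until the threshold is reached, every step of the iteration adds an element; a step that adds none
  would leave the patch unchanged forever, and the threshold would never be reached.
\<close>

lemma patch_depth:
  assumes K: "K \<in> T" and ex: "\<exists>t. nS \<le> card (patch_iter T t K)"
  shows "(LEAST t. nS \<le> card (patch_iter T t K)) \<le> nS"
proof -
  define s where "s = (LEAST t. nS \<le> card (patch_iter T t K))"
  have less: "card (patch_iter T t K) < nS" if "t < s" for t
    using not_less_Least[OF that[unfolded s_def]] by simp
  have fin: "finite (patch_iter T t K)" for t using patch_iter_mesh[OF K] finite_mesh finite_subset by blast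
  have strict: "card (patch_iter T t K) < card (patch_iter T (Suc t) K)" if t: "t < s" for t
  proof (rule ccontr)
    assume "\<not> ?thesis"
    then have eq: "patch_iter T (Suc t) K = patch_iter T t K"
      using patch_iter_mono[OF K] fin by (metis card_seteq not_less)
    have stable: "patch_iter T (t + k) K = patch_iter T t K" for k
    proof (induction k)
      case (Suc k)
      then show ?case using eq by simp
    qed simp
    have "nS \<le> card (patch_iter T s K)" unfolding s_def using ex by (rule LeastI_ex)
    moreover have "patch_iter T s K = patch_iter T t K" using stable[of "s - t"] t by simp
    ultimately show False using less[OF t] by simp
  qed
  have "t \<le> s \<Longrightarrow> t + 1 \<le> card (patch_iter T t K)" for t
  proof (induction t)
    case (Suc t)
    then show ?case using strict[of t] by simp
  qed simp
  then have "\<not> nS < s" using less[of nS] by (metis Suc_eq_plus1 less_imp_le_nat not_less_eq_eq)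
  then show ?thesis unfolding s_def by simp
qed

text \<open>
  The relation is symmetric, as needed for exchanging sums, and wide enough to contain all elements
  that a segment from \<open>K\<close> into its patch meets: such a segment has length at most \<open>(k + 1) h\<close>, and
  the diameters of the two elements at its ends add \<open>2 h\<close>.
\<close>

definition near :: "nat \<Rightarrow> (real ^ 'd) set \<Rightarrow> (real ^ 'd) set set" where
  "near k K = {A\<in>T. \<forall>x\<in>K. \<forall>y\<in>A. dist x y \<le> (real k + 3) * h}"

definition near_bound :: "nat \<Rightarrow> real" where
  "near_bound k = ((real k + 3) * (2 * C\<sigma>)) ^ CARD('d)"

lemma card_near: assumes "K \<in> T" shows "real (card (near k K)) \<le> near_bound k"
proof -
  obtain x where x: "x \<in> K" using element_facts(8)[OF assms] by blast
  have "real (card (near k K)) \<le> ((real k + 3) * h / r) ^ CARD('d)"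
    using h_pos x by (intro card_elements_le[of _ x]) (auto simp: near_def)
  also have "(real k + 3) * h / r = (real k + 3) * (2 * C\<sigma>)"
    using r_pos by (simp add: h_eq)
  finally show ?thesis by (simp add: near_bound_def)
qed

lemma near_bound_ge_1: "1 \<le> near_bound k"
proof -
  obtain K where K: "K \<in> T" using mesh_nonempty by blast
  have "K \<in> near k K"
    unfolding near_def using K h_pos by (auto intro!: order_trans[OF dist_element_le[OF K]])
  moreover have "finite (near k K)" using finite_mesh by (simp add: near_def)
  ultimately have "card (near k K) \<ge> 1" by (metis card_0_eq empty_iff leI less_one)
  then show ?thesis using card_near[OF K, of k] by linarith
qed

lemma patch_facts:
  assumes K: "K \<in> T" and ex: "\<exists>t. nS \<le> card (patch_iter T t K)"
  shows "patch T nS K \<subseteq> near nS K" "K \<in> patch T nS K" "finite (patch T nS K)"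
proof -
  let ?s = "LEAST t. nS \<le> card (patch_iter T t K)"
  have s: "real ?s \<le> real nS" using patch_depth[OF K ex] by simp
  show "patch T nS K \<subseteq> near nS K"
  proof
    fix A assume A: "A \<in> patch T nS K"
    have "dist x y \<le> (real nS + 3) * h" if "x \<in> K" "y \<in> A" for x y
    proof -
      have "dist x y \<le> (real ?s + 1) * h"
        using patch_iter_dist[OF K that(1) _ that(2)] A by (simp add: patch_def)
      also have "\<dots> \<le> (real nS + 3) * h" using s h_pos by (intro mult_right_mono) auto
      finally show ?thesis .
    qed
    then show "A \<in> near nS K" using A patch_iter_mesh[OF K] by (auto simp: near_def patch_def)
  qed
  have "K \<in> patch_iter T t K" for t
    by (induction t) (use patch_iter_mono[OF K] in auto)
  then show "K \<in> patch T nS K" by (simp add: patch_def)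
  show "finite (patch T nS K)"
    unfolding patch_def using patch_iter_mesh[OF K] finite_mesh finite_subset by blast
qed

lemma chain_difference_le:
  assumes M: "\<And>A B. (A, B) \<in> E \<Longrightarrow> \<bar>v A - v B\<bar> \<le> (M::real)" and E: "finite E" and chain: "(a, b) \<in> E\<^sup>*" and M0: "M \<ge> 0"
  shows "\<bar>v a - v b\<bar> \<le> real (card E) * M"
proof -
  obtain n where n: "n \<le> card E" "(a, b) \<in> E ^^ n"
    using chain rtrancl_finite_eq_relpow[OF E] by blast
  have "(a, b) \<in> E ^^ n \<Longrightarrow> \<bar>v a - v b\<bar> \<le> real n * M" for n b
  proof (induction n arbitrary: b)
    case (Suc n)
    then obtain c where c: "(a, c) \<in> E ^^ n" "(c, b) \<in> E" by auto
    have "\<bar>v a - v b\<bar> \<le> \<bar>v a - v c\<bar> + \<bar>v c - v b\<bar>" by simp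
    also have "\<dots> \<le> real n * M + M" by (intro add_mono Suc.IH[OF c(1)] M c(2))
    finally show ?case by (simp add: algebra_simps)
  qed simp
  from this[OF n(2)] show ?thesis using n(1) M0
    by (meson mult_right_mono of_nat_le_iff order_trans)
qed

text \<open>
  The chain of elements along the segment has at most as many steps as there are adjacent pairs of
  elements near \<open>K\<close>, and each step is a jump over a facet near \<open>K\<close>.
\<close>

lemma patch_difference_le:
  assumes K: "K \<in> T" "K' \<in> patch T nS K" and ex: "\<exists>t. nS \<le> card (patch_iter T t K)"
  shows "(v K' - v K)\<^sup>2 \<le> near_bound nS ^ 4 * (\<Sum>A\<in>near nS K. \<Sum>e\<in>{e\<in>faces T. A \<in> adjacent T e}. sq_jump v e)"
proof -
  define S where "S = (\<Sum>A\<in>near nS K. \<Sum>e\<in>{e\<in>faces T. A \<in> adjacent T e}. sq_jump v e)"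
  have fn: "finite (near nS K)" using finite_mesh by (simp add: near_def)
  have S0: "S \<ge> 0" unfolding S_def by (intro sum_nonneg sq_jump_nonneg)
  have K'T: "K' \<in> T" using patch_facts(1)[OF K(1) ex] K(2) by (auto simp: near_def)
  obtain x y where xy: "x \<in> K" "y \<in> K'" and
    chain: "(K, K') \<in> (segment_adjacency x y)\<^sup>*"
    by (rule element_chain[OF K(1) K'T]) (rule that)
  define E where "E = segment_adjacency x y"
  have xy_dist: "dist x y \<le> (real nS + 1) * h"
  proof -
    have "dist x y \<le> (real (LEAST t. nS \<le> card (patch_iter T t K)) + 1) * h"
      using patch_iter_dist[OF K(1) xy(1) _ xy(2)] K(2) by (simp add: patch_def)
    also have "\<dots> \<le> (real nS + 1) * h"
      using patch_depth[OF K(1) ex] h_pos by (intro mult_right_mono) auto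
    finally show ?thesis .
  qed
  have seg_near: "A \<in> near nS K" if A: "A \<in> T" "A \<inter> closed_segment x y \<noteq> {}" for A
  proof -
    obtain z where z: "z \<in> A" "z \<in> closed_segment x y" using A by blast
    have "dist x' y' \<le> (real nS + 3) * h" if "x' \<in> K" "y' \<in> A" for x' y'
    proof -
      have "dist x' y' \<le> dist x' x + dist x z + dist z y'"
        by (metis add_mono_thms_linordered_semiring(3) dist_triangle order_trans)
      moreover have "dist x z \<le> dist x y" using segment_bound(1)[OF z(2)] by (simp add: dist_norm norm_minus_commute)
      ultimately have "dist x' y' \<le> h + (real nS + 1) * h + h"
        using dist_element_le[OF K(1) that(1) xy(1)] dist_element_le[OF A(1) z(1) that(2)] xy_dist by linarith
      then show ?thesis by (simp add: algebra_simps)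
    qed
    then show ?thesis using A by (simp add: near_def)
  qed
  have Esub: "E \<subseteq> near nS K \<times> near nS K" using seg_near by (auto simp: E_def segment_adjacency_def)
  then have fE: "finite E" using fn finite_subset by blast
  have "card E \<le> card (near nS K) * card (near nS K)"
    using card_mono[OF _ Esub] fn by (simp add: card_cartesian_product)
  then have "real (card E) \<le> real (card (near nS K)) * real (card (near nS K))"
    by (metis of_nat_le_iff of_nat_mult)
  also have "\<dots> \<le> near_bound nS * near_bound nS"
    using card_near[OF K(1)] near_bound_ge_1[of nS] by (intro mult_mono) auto
  finally have cE: "real (card E) \<le> (near_bound nS)\<^sup>2" by (simp add: power2_eq_square)
  have step: "\<bar>v A - v B\<bar> \<le> sqrt S" if AB: "(A, B) \<in> E" for A B
  proof -
    obtain e where e: "A \<noteq> B" "adjacent T e = {A, B}" using AB by (auto simp: E_def segment_adjacency_def)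
    have An: "A \<in> near nS K" using AB Esub by blast
    have ef: "e \<in> faces T" using facesI[of A e] e by simp
    have "sq_jump v e \<le> (\<Sum>e\<in>{e\<in>faces T. A \<in> adjacent T e}. sq_jump v e)"
      using ef e finite_faces by (intro member_le_sum) (auto simp: sq_jump_nonneg)
    also have "\<dots> \<le> S" unfolding S_def
      using An fn by (intro member_le_sum[of A _ "\<lambda>A. \<Sum>e\<in>{e\<in>faces T. A \<in> adjacent T e}. sq_jump v e"])
        (auto intro!: sum_nonneg simp: sq_jump_nonneg)
    finally have "(v A - v B)\<^sup>2 \<le> S" unfolding sq_jump_interior[OF e] .
    then show ?thesis using real_sqrt_le_mono by fastforce
  qed
  have "\<bar>v K - v K'\<bar> \<le> real (card E) * sqrt S"
    using chain unfolding E_def[symmetric] by (intro chain_difference_le step fE) (auto simp: S0)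
  also have "\<dots> \<le> (near_bound nS)\<^sup>2 * sqrt S" using cE S0 by (intro mult_right_mono) auto
  finally have "\<bar>v K - v K'\<bar>\<^sup>2 \<le> ((near_bound nS)\<^sup>2 * sqrt S)\<^sup>2" by (rule power_mono) simp
  then show ?thesis using S0 by (simp add: power_mult_distrib S_def[symmetric] power2_commute)
qed

text \<open>
  A discrete Poincare inequality: summation over \<open>K\<close> counts every facet a bounded number of times,
  because an element is near a bounded number of elements only.
\<close>

lemma sum_patch_differences_le:
  assumes ex: "\<And>K. K \<in> T \<Longrightarrow> \<exists>t. nS \<le> card (patch_iter T t K)"
  shows "(\<Sum>K\<in>T. \<Sum>K'\<in>patch T nS K. (v K' - v K)\<^sup>2) \<le> 2 * near_bound nS ^ 6 * (\<Sum>e\<in>faces T. sq_jump v e)"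
proof -
  let ?N = "near_bound nS"
  define g where "g A = (\<Sum>e\<in>{e\<in>faces T. A \<in> adjacent T e}. sq_jump v e)" for A
  have g0: "g A \<ge> 0" for A unfolding g_def by (intro sum_nonneg sq_jump_nonneg)
  have N: "?N \<ge> 1" by (rule near_bound_ge_1)
  \<comment> \<open>The patch contributes one factor of the bound for the number of near elements, the squared length of a chain four, and the exchange of sums below the sixth.\<close>
  have "(\<Sum>K'\<in>patch T nS K. (v K' - v K)\<^sup>2) \<le> ?N ^ 5 * (\<Sum>A\<in>near nS K. g A)" if K: "K \<in> T" for K
  proof -
    have fn: "finite (near nS K)" using finite_mesh by (simp add: near_def)
    have "(\<Sum>K'\<in>patch T nS K. (v K' - v K)\<^sup>2) \<le> real (card (patch T nS K)) * (?N ^ 4 * (\<Sum>A\<in>near nS K. g A))"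
      unfolding g_def using patch_difference_le[OF K _ ex[OF K]] by (intro sum_bounded_above) auto
    also have "\<dots> \<le> ?N * (?N ^ 4 * (\<Sum>A\<in>near nS K. g A))"
    proof (intro mult_right_mono mult_nonneg_nonneg sum_nonneg g0)
      have "card (patch T nS K) \<le> card (near nS K)" by (rule card_mono[OF fn patch_facts(1)[OF K ex[OF K]]])
      then show "real (card (patch T nS K)) \<le> ?N" using card_near[OF K, of nS] by linarith
    qed (use N in auto)
    finally show ?thesis by (simp add: power_numeral_reduce)
  qed
  then have "(\<Sum>K\<in>T. \<Sum>K'\<in>patch T nS K. (v K' - v K)\<^sup>2) \<le> (\<Sum>K\<in>T. ?N ^ 5 * (\<Sum>A\<in>near nS K. g A))"
    by (rule sum_mono)
  also have "\<dots> = ?N ^ 5 * (\<Sum>K\<in>T. \<Sum>A\<in>{A\<in>T. A \<in> near nS K}. g A)"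
    by (simp add: sum_distrib_left near_def)
  also have "(\<Sum>K\<in>T. \<Sum>A\<in>{A\<in>T. A \<in> near nS K}. g A) = (\<Sum>A\<in>T. \<Sum>K\<in>{K\<in>T. A \<in> near nS K}. g A)"
    by (rule sum.swap_restrict[OF finite_mesh finite_mesh])
  also have "\<dots> \<le> (\<Sum>A\<in>T. ?N * g A)"
  proof (rule sum_mono)
    fix A assume A: "A \<in> T"
    have "{K\<in>T. A \<in> near nS K} \<subseteq> near nS A" by (auto simp: near_def) (metis dist_commute)
    then have "card {K\<in>T. A \<in> near nS K} \<le> card (near nS A)"
      using finite_mesh by (intro card_mono) (auto simp: near_def)
    then have "real (card {K\<in>T. A \<in> near nS K}) \<le> ?N" using card_near[OF A, of nS] by linarith
    then show "(\<Sum>K\<in>{K\<in>T. A \<in> near nS K}. g A) \<le> ?N * g A"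
      using g0 by (simp add: mult_right_mono)
  qed
  also have "\<dots> = ?N * (\<Sum>A\<in>T. \<Sum>e\<in>{e\<in>faces T. A \<in> adjacent T e}. sq_jump v e)"
    by (simp add: sum_distrib_left g_def)
  also have "(\<Sum>A\<in>T. \<Sum>e\<in>{e\<in>faces T. A \<in> adjacent T e}. sq_jump v e)
      = (\<Sum>e\<in>faces T. \<Sum>A\<in>{A\<in>T. A \<in> adjacent T e}. sq_jump v e)"
    by (rule sum.swap_restrict[OF finite_mesh finite_faces])
  also have "\<dots> \<le> (\<Sum>e\<in>faces T. 2 * sq_jump v e)"
  proof (rule sum_mono)
    fix e
    have "{A\<in>T. A \<in> adjacent T e} = adjacent T e" by (auto simp: adjacent_def)
    then have "real (card {A\<in>T. A \<in> adjacent T e}) \<le> 2" using card_adjacent_le[of e] by simp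
    then have "real (card {A\<in>T. A \<in> adjacent T e}) * sq_jump v e \<le> 2 * sq_jump v e"
      by (rule mult_right_mono) (rule sq_jump_nonneg)
    then show "(\<Sum>A\<in>{A\<in>T. A \<in> adjacent T e}. sq_jump v e) \<le> 2 * sq_jump v e" by simp
  qed
  finally have "(\<Sum>K\<in>T. \<Sum>K'\<in>patch T nS K. (v K' - v K)\<^sup>2) \<le> ?N ^ 5 * (?N * (\<Sum>e\<in>faces T. 2 * sq_jump v e))"
    using N by (simp add: mult_left_mono)
  then show ?thesis by (simp add: sum_distrib_left[symmetric] power_numeral_reduce mult.assoc mult.left_commute)
qed

lemma barycenter_in_element: assumes "K \<in> T" shows "barycenter K \<in> K"
proof -
  have poly: "polytope K" by (rule element_facts(5)[OF assms])
  let ?V = "{v. v extreme_point_of K}"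
  have fin: "finite ?V" by (rule finite_polyhedron_extreme_points[OF element_facts(6)[OF assms]])
  have "K = convex hull ?V"
    by (rule Krein_Milman_Minkowski[OF element_facts(2,1)[OF assms]])
  then have ne: "?V \<noteq> {}" using element_facts(8)[OF assms] by auto
  then have c: "card ?V > 0" using fin by (simp add: card_gt_0_iff)
  have "(\<Sum>v\<in>?V. (1 / real (card ?V)) *\<^sub>R v) \<in> K"
    using c element_facts(1)[OF assms] by (intro convex_sum fin) (auto simp: extreme_point_of_def)
  then show ?thesis by (simp add: barycenter_def scaleR_sum_right inverse_eq_divide)
qed

end

section \<open>Least squares reconstruction\<close>

text \<open>
  The sum that is minimised runs over elements and not over their barycenters. Mapping the generators
  to functions on elements makes the projection theorem applicable to it.
\<close>

lemma fspan_map: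
  assumes lin: "\<And>t p q. \<Phi> (\<lambda>x. t * p x + q x) = (\<lambda>y. t * \<Phi> p y + \<Phi> q y)"
  shows "fspan (map \<Phi> fs) = \<Phi> ` fspan fs"
proof (induction fs)
  case Nil
  have "\<Phi> (\<lambda>x. 0) = (\<lambda>y. 0)" using lin[of "-1" "\<lambda>x. 0" "\<lambda>x. 0"] by simp
  then show ?case by simp
next
  case (Cons f fs)
  show ?case
  proof (intro subset_antisym subsetI)
    fix g assume "g \<in> fspan (map \<Phi> (f # fs))"
    then obtain t q where "g = (\<lambda>y. t * \<Phi> f y + \<Phi> q y)" "q \<in> fspan fs" using Cons.IH by auto
    then have "g = \<Phi> (\<lambda>x. t * f x + q x)" "(\<lambda>x. t * f x + q x) \<in> fspan (f # fs)" using lin by auto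
    then show "g \<in> \<Phi> ` fspan (f # fs)" by (rule image_eqI)
  next
    fix g assume "g \<in> \<Phi> ` fspan (f # fs)"
    then obtain t q where g: "g = \<Phi> (\<lambda>x. t * f x + q x)" "q \<in> fspan fs" by auto
    have "\<Phi> q \<in> fspan (map \<Phi> fs)" using g(2) Cons.IH by blast
    then show "g \<in> fspan (map \<Phi> (f # fs))" unfolding g(1) lin by auto
  qed
qed

lemma psd_form_finite_sum: "psd_form UNIV (\<lambda>p q. \<Sum>k\<in>P. p (\<phi> k) * q (\<phi> k))"
  by unfold_locales
     (auto simp: algebra_simps sum.distrib sum_distrib_left intro!: sum_nonneg sum.cong)

locale reconstruction_mesh = quasi_mesh \<Omega> T C\<sigma>
  for \<Omega> :: "(real ^ 'd) set" and T :: "(real ^ 'd) set set" and C\<sigma> :: real +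
  fixes nS m :: nat
  assumes uni: "unisolvent_patches T nS m"
begin

lemma patch_stops: "K \<in> T \<Longrightarrow> \<exists>t. nS \<le> card (patch_iter T t K)"
  and unisolvent: "K \<in> T \<Longrightarrow> p \<in> poly_space m \<Longrightarrow> (\<And>K'. K' \<in> patch T nS K \<Longrightarrow> p (barycenter K') = 0) \<Longrightarrow> p = (\<lambda>x. 0)"
  using uni by (auto simp: unisolvent_patches_def patch_points_def)

lemma patch_mesh:
  assumes "K \<in> T"
  shows "patch T nS K \<subseteq> near nS K" "K \<in> patch T nS K" "finite (patch T nS K)"
  by (rule patch_facts[OF assms patch_stops[OF assms]])+

text \<open>
  The normal equations of the constrained least squares problem. Unlike the minimisation they are
  linear in the pair of data and solution, which gives the linearity of the reconstruction.
\<close>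

definition reconstructs :: "(real ^ 'd) set \<Rightarrow> ((real ^ 'd) set \<Rightarrow> real) \<Rightarrow> (real ^ 'd \<Rightarrow> real) \<Rightarrow> bool" where
  "reconstructs K v p \<longleftrightarrow> p \<in> poly_space m \<and> p (barycenter K) = v K \<and>
     (\<forall>s\<in>poly_space m. s (barycenter K) = 0 \<longrightarrow>
        (\<Sum>K'\<in>patch T nS K. (p (barycenter K') - v K') * s (barycenter K')) = 0)"

text \<open>
  Subtracting the value at the barycenter of \<open>K\<close> turns the constraint into a linear one; the solution
  is then a projection.
\<close>

lemma ex_reconstructs: assumes K: "K \<in> T" shows "\<exists>p. reconstructs K v p"
proof -
  let ?P = "patch T nS K" and ?b = "barycenter :: (real ^ 'd) set \<Rightarrow> real ^ 'd"
  define \<Phi> :: "(real ^ 'd \<Rightarrow> real) \<Rightarrow> (real ^ 'd) set \<Rightarrow> real" where "\<Phi> f K' = f (?b K') - f (?b K)" for f K'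
  interpret psd_form UNIV "\<lambda>p q. \<Sum>k\<in>?P. p (id k) * q (id k)" by (rule psd_form_finite_sum)
  obtain fs :: "(real ^ 'd \<Rightarrow> real) list" where fs: "fspan fs = poly_space m"
    using poly_space_fspan by blast
  have im: "fspan (map \<Phi> fs) = \<Phi> ` poly_space m"
    unfolding fs[symmetric] by (rule fspan_map) (auto simp: \<Phi>_def algebra_simps)
  obtain g where g: "g \<in> fspan (map \<Phi> fs)"
    "\<And>s. s \<in> fspan (map \<Phi> fs) \<Longrightarrow> (\<Sum>K'\<in>?P. (v K' - v K - g K') * s K') = 0"
    using projection[of "map \<Phi> fs" "\<lambda>K'. v K' - v K"] by auto
  obtain q where q: "q \<in> poly_space m" "g = \<Phi> q" using g(1) im by blast
  define p where "p = (\<lambda>x. 1 * q x + (v K - q (?b K)))"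
  have "p \<in> poly_space m" unfolding p_def by (intro poly_space_comb q poly_space_const)
  moreover have "p (?b K) = v K" by (simp add: p_def)
  moreover have "(\<Sum>K'\<in>?P. (p (?b K') - v K') * s (?b K')) = 0" if s: "s \<in> poly_space m" "s (?b K) = 0" for s
  proof -
    have "\<Phi> s \<in> fspan (map \<Phi> fs)" using s im by blast
    from g(2)[OF this] have "(\<Sum>K'\<in>?P. (v K' - v K - g K') * \<Phi> s K') = 0" .
    moreover have "(p (?b K') - v K') * s (?b K') = - ((v K' - v K - g K') * \<Phi> s K')" for K'
      using s(2) by (simp add: q(2) \<Phi>_def p_def algebra_simps)
    ultimately show ?thesis by (simp add: sum_negf)
  qed
  ultimately show ?thesis unfolding reconstructs_def by blast
qed

text \<open>
  By Pythagoras a solution of the normal equations is a minimiser, and the excess of any other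
  competitor is a discrete norm of the difference, which vanishes only for equal polynomials because
  the patch is unisolvent.
\<close>

lemma local_reconstruction_reconstructs:
  assumes K: "K \<in> T"
  shows "reconstructs K (\<lambda>K'. v K' (barycenter K')) (local_reconstruction T nS m v K)"
proof -
  let ?P = "patch T nS K" and ?b = "barycenter :: (real ^ 'd) set \<Rightarrow> real ^ 'd"
  let ?w = "\<lambda>K'. v K' (?b K')"
  let ?f = "\<lambda>p. \<Sum>K'\<in>?P. (p (?b K') - v K' (?b K'))\<^sup>2"
  let ?F = "\<lambda>p. p \<in> poly_space m \<and> p (?b K) = v K (?b K)"
  obtain p where p: "reconstructs K ?w p" using ex_reconstructs[OF K] by blast
  have pF: "?F p" using p by (simp add: reconstructs_def)
  have pyth: "?f q = ?f p + (\<Sum>K'\<in>?P. (q (?b K') - p (?b K'))\<^sup>2)" if q: "?F q" for q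
  proof -
    define s where "s = (\<lambda>x. - 1 * p x + q x)"
    have "s \<in> poly_space m" "s (?b K) = 0"
      unfolding s_def using pF q by (auto intro: poly_space_comb[of p m q "-1", simplified])
    then have o: "(\<Sum>K'\<in>?P. (p (?b K') - v K' (?b K')) * s (?b K')) = 0"
      using p by (simp add: reconstructs_def)
    have "?f q = (\<Sum>K'\<in>?P. (p (?b K') - v K' (?b K'))\<^sup>2 + (s (?b K'))\<^sup>2 + 2 * ((p (?b K') - v K' (?b K')) * s (?b K')))"
      by (intro sum.cong) (auto simp: s_def power2_eq_square algebra_simps)
    also have "\<dots> = ?f p + (\<Sum>K'\<in>?P. (s (?b K'))\<^sup>2)"
      using o by (simp add: sum.distrib sum_distrib_left[symmetric])
    finally show ?thesis by (simp add: s_def)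
  qed
  have "local_reconstruction T nS m v K = p"
    unfolding local_reconstruction_def
  proof (rule the_equality)
    show "is_arg_min ?f ?F p"
      unfolding is_arg_min_def
    proof (intro conjI pF notI, elim exE conjE)
      fix q assume q: "q \<in> poly_space m" "q (?b K) = v K (?b K)" "?f q < ?f p"
      have "(\<Sum>K'\<in>?P. (q (?b K') - p (?b K'))\<^sup>2) \<ge> 0" by (intro sum_nonneg) simp
      with pyth[of q] q show False by simp
    qed
  next
    fix q assume q: "is_arg_min ?f ?F q"
    then have qF: "?F q" and "\<not> ?f p < ?f q" using pF by (auto simp: is_arg_min_def)
    then have "(\<Sum>K'\<in>?P. (q (?b K') - p (?b K'))\<^sup>2) \<le> 0" using pyth[OF qF] by simp
    then have "(\<Sum>K'\<in>?P. (q (?b K') - p (?b K'))\<^sup>2) = 0"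
      by (intro antisym sum_nonneg) auto
    then have z: "q (?b K') - p (?b K') = 0" if "K' \<in> ?P" for K'
      using sum_nonneg_eq_0_iff[OF patch_mesh(3)[OF K], of "\<lambda>K'. (q (?b K') - p (?b K'))\<^sup>2"] that by simp
    have "(\<lambda>x. - 1 * p x + q x) = (\<lambda>x. 0)"
      using pF qF z by (intro unisolvent[OF K] poly_space_comb) auto
    then show "q = p" by (auto simp: fun_eq_iff)
  qed
  with p show ?thesis by simp
qed

lemma reconstructs_comb:
  assumes "reconstructs K v p" "reconstructs K w q"
  shows "reconstructs K (\<lambda>A. t * v A + w A) (\<lambda>x. t * p x + q x)"
proof -
  have "(\<Sum>K'\<in>patch T nS K. (t * p (barycenter K') + q (barycenter K') - (t * v K' + w K')) * s (barycenter K')) =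
    t * (\<Sum>K'\<in>patch T nS K. (p (barycenter K') - v K') * s (barycenter K')) +
    (\<Sum>K'\<in>patch T nS K. (q (barycenter K') - w K') * s (barycenter K'))" for s :: "real ^ 'd \<Rightarrow> real"
    by (simp add: sum_distrib_left sum.distrib[symmetric] algebra_simps)
  then show ?thesis
    using assms unfolding reconstructs_def by (auto intro: poly_space_comb)
qed

lemma reconstructs_zero: "reconstructs K (\<lambda>A. 0) (\<lambda>x. 0)"
  by (simp add: reconstructs_def poly_space_zero)

lemma reconstructs_sum:
  assumes "finite J" "\<And>j. j \<in> J \<Longrightarrow> reconstructs K (v j) (p j)"
  shows "reconstructs K (\<lambda>A. \<Sum>j\<in>J. c j * v j A) (\<lambda>x. \<Sum>j\<in>J. c j * p j x)"
  using assms
proof (induction J rule: finite_induct)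
  case (insert j J)
  then show ?case using reconstructs_comb[of K "v j" "p j" "\<lambda>A. \<Sum>j\<in>J. c j * v j A" "\<lambda>x. \<Sum>j\<in>J. c j * p j x" "c j"] by simp
qed (simp add: reconstructs_zero)

section \<open>Stability of the reconstruction\<close>

text \<open>
  This makes the supremum in the definition of \<open>Lambda_local\<close> finite: by unisolvence the sampling points
  define a norm on the finite-dimensional polynomial space.
\<close>

lemma patch_sup_bound:
  assumes K: "K \<in> T"
  shows "\<exists>C\<ge>0. \<forall>p\<in>poly_space m. \<forall>x\<in>\<Union>(patch T nS K). \<bar>p x\<bar> \<le> C * (MAX x\<in>patch_points T nS K. \<bar>p x\<bar>)"
proof -
  let ?P = "patch T nS K" and ?b = "barycenter :: (real ^ 'd) set \<Rightarrow> real ^ 'd"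
  let ?B = "\<lambda>p q. \<Sum>k\<in>?P. p (?b k) * q (?b k)"
  have fP: "finite ?P" "?P \<noteq> {}" using patch_mesh[OF K] by auto
  have PT: "?P \<subseteq> T" using patch_mesh(1)[OF K] by (auto simp: near_def)
  have cP: "compact (\<Union>?P)" using fP PT element_facts(2) by (intro compact_Union) auto
  interpret psd_form UNIV ?B by (rule psd_form_finite_sum)
  obtain fs :: "(real ^ 'd \<Rightarrow> real) list" where fs: "set fs \<subseteq> poly_space m" "fspan fs = poly_space m"
    using poly_space_fspan by blast
  define L :: "((real ^ 'd \<Rightarrow> real) \<Rightarrow> real) set" where "L = (\<lambda>x p. p x) ` \<Union>?P"
  have "\<exists>C\<ge>0. \<forall>p\<in>fspan fs. \<forall>l\<in>L. \<bar>l p\<bar> \<le> C * sqrt (?B p p)"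
  proof (rule functionals_bounded)
    show "\<exists>b. \<forall>l\<in>L. \<bar>l f\<bar> \<le> b" if "f \<in> set fs" for f
    proof -
      have "continuous_on (\<Union>?P) f" using that fs(1) C1_fun_poly C1_fun_continuous by blast
      then have "bounded (f ` \<Union>?P)" using cP by (intro compact_imp_bounded compact_continuous_image)
      then obtain b where b: "\<And>x. x \<in> \<Union>?P \<Longrightarrow> norm (f x) \<le> b" unfolding bounded_iff by blast
      then have "\<bar>l f\<bar> \<le> b" if "l \<in> L" for l using that unfolding L_def by fastforce
      then show ?thesis by blast
    qed
    show "l p = 0" if p: "p \<in> fspan fs" "?B p p = 0" "l \<in> L" for p l
    proof -
      have "p (?b K') = 0" if "K' \<in> ?P" for K'
        using sum_nonneg_eq_0_iff[OF fP(1), of "\<lambda>k. p (?b k) * p (?b k)"] p(2) that by auto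
      then have "p = (\<lambda>x. 0)" using p(1) fs(2) by (intro unisolvent[OF K]) auto
      then show ?thesis using p(3) by (auto simp: L_def)
    qed
  qed (auto simp: L_def)
  then obtain C where C: "C \<ge> 0" "\<And>p l. p \<in> poly_space m \<Longrightarrow> l \<in> L \<Longrightarrow> \<bar>l p\<bar> \<le> C * sqrt (?B p p)"
    unfolding fs(2) by blast
  have "\<bar>p x\<bar> \<le> (C * sqrt (real (card ?P))) * (MAX x\<in>patch_points T nS K. \<bar>p x\<bar>)"
    if p: "p \<in> poly_space m" and x: "x \<in> \<Union>?P" for p x
  proof -
    let ?M = "MAX x\<in>patch_points T nS K. \<bar>p x\<bar>"
    have M: "\<bar>p (?b k)\<bar> \<le> ?M" if "k \<in> ?P" for k
      using that fP by (intro Max_ge) (auto simp: patch_points_def)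
    have M0: "?M \<ge> 0" using M fP(2) by (meson abs_ge_zero ex_in_conv order_trans)
    have "?B p p \<le> (\<Sum>k\<in>?P. ?M\<^sup>2)"
    proof (rule sum_mono)
      fix k assume "k \<in> ?P"
      then have "\<bar>p (?b k)\<bar>\<^sup>2 \<le> ?M\<^sup>2" using M by (intro power_mono) auto
      then show "p (?b k) * p (?b k) \<le> ?M\<^sup>2" by (simp add: power2_eq_square)
    qed
    then have "sqrt (?B p p) \<le> sqrt (real (card ?P) * ?M\<^sup>2)" by simp
    also have "\<dots> = sqrt (real (card ?P)) * ?M" using M0 by (simp add: real_sqrt_mult)
    finally have "C * sqrt (?B p p) \<le> C * (sqrt (real (card ?P)) * ?M)" using C(1) by (rule mult_left_mono)
    moreover have "\<bar>p x\<bar> \<le> C * sqrt (?B p p)" using C(2)[OF p, of "\<lambda>p. p x"] x by (auto simp: L_def)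
    ultimately show ?thesis by (simp add: mult.assoc)
  qed
  moreover have "C * sqrt (real (card ?P)) \<ge> 0" using C by simp
  ultimately show ?thesis by blast
qed

lemma Lambda_local_facts:
  assumes K: "K \<in> T"
  shows "1 \<le> Lambda_local T nS m K"
    and "p \<in> poly_space m \<Longrightarrow> x \<in> \<Union>(patch T nS K) \<Longrightarrow>
      \<bar>p x\<bar> \<le> Lambda_local T nS m K * (MAX x\<in>patch_points T nS K. \<bar>p x\<bar>)"
proof -
  let ?P = "patch T nS K" and ?I = "patch_points T nS K"
  let ?M = "\<lambda>p :: real ^ 'd \<Rightarrow> real. MAX x\<in>?I. \<bar>p x\<bar>"
  let ?q = "\<lambda>p. (SUP x\<in>\<Union>?P. \<bar>p x\<bar>) / ?M p"
  have fP: "finite ?P" "?P \<noteq> {}" using patch_mesh[OF K] by auto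
  have fI: "finite ?I" "?I \<noteq> {}" using fP by (auto simp: patch_points_def)
  have PT: "?P \<subseteq> T" using patch_mesh(1)[OF K] by (auto simp: near_def)
  have neU: "\<Union>?P \<noteq> {}" using patch_mesh(2)[OF K] element_facts(8)[OF K] by blast
  have IU: "?I \<subseteq> \<Union>?P" using PT barycenter_in_element by (auto simp: patch_points_def)
  obtain C where C: "C \<ge> 0" "\<And>p x. p \<in> poly_space m \<Longrightarrow> x \<in> \<Union>?P \<Longrightarrow> \<bar>p x\<bar> \<le> C * ?M p"
    using patch_sup_bound[OF K] by blast
  have Mpos: "?M p > 0" if p: "p \<in> poly_space m - {\<lambda>x. 0}" for p
  proof -
    obtain K' where K': "K' \<in> ?P" "p (barycenter K') \<noteq> 0" using unisolvent[OF K, of p] p by blast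
    have "0 < \<bar>p (barycenter K')\<bar>" using K' by simp
    also have "\<dots> \<le> ?M p" using K' fI by (intro Max_ge) (auto simp: patch_points_def)
    finally show ?thesis .
  qed
  have bddU: "bdd_above ((\<lambda>x. \<bar>p x\<bar>) ` \<Union>?P)" if "p \<in> poly_space m" for p
    using C(2)[OF that] by (intro bdd_aboveI[of _ "C * ?M p"]) auto
  have bddq: "bdd_above (?q ` (poly_space m - {\<lambda>x. 0}))"
  proof (rule bdd_aboveI)
    fix y assume "y \<in> ?q ` (poly_space m - {\<lambda>x. 0})"
    then obtain p where p: "p \<in> poly_space m - {\<lambda>x. 0}" "y = ?q p" by blast
    have "(SUP x\<in>\<Union>?P. \<bar>p x\<bar>) \<le> C * ?M p" using C(2) p(1) by (intro cSUP_least neU) auto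
    then show "y \<le> C" using Mpos[OF p(1)] p(2) by (simp add: pos_divide_le_eq)
  qed
  have le: "?q p \<le> Lambda_local T nS m K" if "p \<in> poly_space m - {\<lambda>x. 0}" for p
    unfolding Lambda_local_def by (rule cSUP_upper[OF that bddq])
  have one: "(\<lambda>x. 1) \<in> poly_space m - {\<lambda>x. 0}"
    using poly_space_const[of 1 m] by (auto dest: fun_cong[where x = 0])
  have "(\<lambda>x. \<bar>1 :: real\<bar>) ` \<Union>?P = {1}" "(\<lambda>x. \<bar>1 :: real\<bar>) ` ?I = {1}" using neU fI(2) by auto
  then have "?q (\<lambda>x. 1) = 1" by simp
  then show "1 \<le> Lambda_local T nS m K" using le[OF one] by simp
  show "\<bar>p x\<bar> \<le> Lambda_local T nS m K * ?M p" if p: "p \<in> poly_space m" and x: "x \<in> \<Union>?P"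
  proof (cases "p = (\<lambda>x. 0)")
    case True
    have "(\<lambda>x. 0 :: real) ` ?I = {0}" using fI(2) by auto
    then show ?thesis by (simp add: True)
  next
    case False
    then have p': "p \<in> poly_space m - {\<lambda>x. 0}" using p by simp
    have "\<bar>p x\<bar> \<le> (SUP x\<in>\<Union>?P. \<bar>p x\<bar>)" by (rule cSUP_upper[OF x bddU[OF p]])
    also have "\<dots> = ?q p * ?M p" using Mpos[OF p'] by simp
    also have "\<dots> \<le> Lambda_local T nS m K * ?M p" using le[OF p'] Mpos[OF p'] by (intro mult_right_mono) auto
    finally show ?thesis .
  qed
qed

text \<open>
  The factor \<open>sqrt (card (patch T nS K))\<close> in \<open>Lambda_bar\<close> is at least one.
\<close>

lemma Lambda_local_le_bar: assumes K: "K \<in> T" shows "Lambda_local T nS m K \<le> Lambda_bar T nS m"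
proof -
  have "Lambda_local T nS m K \<le> Lambda T nS m"
    unfolding Lambda_def using K finite_mesh by (intro Max_ge) auto
  moreover have "Lambda T nS m * 1 \<le> Lambda T nS m * sqrt (real (card (patch T nS K)))"
  proof (rule mult_left_mono)
    have "card (patch T nS K) \<ge> 1" using patch_mesh(2,3)[OF K] by (metis One_nat_def Suc_leI card_gt_0_iff empty_iff)
    then show "1 \<le> sqrt (real (card (patch T nS K)))" by simp
    show "0 \<le> Lambda T nS m" using calculation Lambda_local_facts(1)[OF K] by linarith
  qed
  moreover have "1 + Lambda T nS m * sqrt (real (card (patch T nS K))) \<le> Lambda_bar T nS m"
    unfolding Lambda_bar_def using K finite_mesh by (intro Max_ge) auto
  ultimately show ?thesis by linarith
qed

lemma Lambda_bar_ge_1: "1 \<le> Lambda_bar T nS m"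
proof -
  obtain K where K: "K \<in> T" using mesh_nonempty by blast
  show ?thesis by (rule order_trans[OF Lambda_local_facts(1)[OF K] Lambda_local_le_bar[OF K]])
qed

text \<open>
  Testing the normal equations with \<open>p - v K\<close> itself shows that its discrete norm is at most that of
  \<open>v - v K\<close>; then \<open>\<Lambda>\<close> bounds it on the whole patch.
\<close>

lemma reconstruction_stable:
  assumes K: "K \<in> T" and p: "reconstructs K v p" and x: "x \<in> \<Union>(patch T nS K)"
  shows "(p x - v K)\<^sup>2 \<le> (Lambda_bar T nS m)\<^sup>2 * (\<Sum>K'\<in>patch T nS K. (v K' - v K)\<^sup>2)"
proof -
  let ?P = "patch T nS K" and ?b = "barycenter :: (real ^ 'd) set \<Rightarrow> real ^ 'd"
  let ?S = "\<Sum>K'\<in>?P. (v K' - v K)\<^sup>2"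
  have fP: "finite ?P" "?P \<noteq> {}" using patch_mesh[OF K] by auto
  define q where "q = (\<lambda>x. 1 * p x + - v K)"
  have q: "q \<in> poly_space m" unfolding q_def
    using p by (intro poly_space_comb poly_space_const) (simp add: reconstructs_def)
  have "q (?b K) = 0" using p by (simp add: q_def reconstructs_def)
  then have o: "(\<Sum>K'\<in>?P. (p (?b K') - v K') * q (?b K')) = 0"
    using p q by (simp add: reconstructs_def)
  have "2 * (\<Sum>K'\<in>?P. (q (?b K'))\<^sup>2) = 2 * (\<Sum>K'\<in>?P. (v K' - v K) * q (?b K')) + 2 * (\<Sum>K'\<in>?P. (p (?b K') - v K') * q (?b K'))"
    by (simp add: sum_distrib_left sum.distrib[symmetric] q_def power2_eq_square algebra_simps)
  also have "\<dots> = (\<Sum>K'\<in>?P. 2 * ((v K' - v K) * q (?b K')))" by (simp add: o sum_distrib_left)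
  also have "\<dots> \<le> (\<Sum>K'\<in>?P. (v K' - v K)\<^sup>2 + (q (?b K'))\<^sup>2)"
    using sum_squares_bound by (intro sum_mono) (simp add: mult.assoc)
  finally have sq: "(\<Sum>K'\<in>?P. (q (?b K'))\<^sup>2) \<le> ?S" by (simp add: sum.distrib)
  have M: "(MAX x\<in>patch_points T nS K. \<bar>q x\<bar>) \<le> sqrt ?S"
  proof (rule Max.boundedI)
    fix y assume "y \<in> (\<lambda>x. \<bar>q x\<bar>) ` patch_points T nS K"
    then obtain K' where K': "K' \<in> ?P" "y = \<bar>q (?b K')\<bar>" by (auto simp: patch_points_def)
    have "(q (?b K'))\<^sup>2 \<le> (\<Sum>K'\<in>?P. (q (?b K'))\<^sup>2)" using K' fP by (intro member_le_sum) auto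
    then have "\<bar>y\<bar>\<^sup>2 \<le> ?S" using sq K'(2) by simp
    then show "y \<le> sqrt ?S" by (intro real_le_rsqrt) (simp add: K'(2))
  qed (use fP in \<open>auto simp: patch_points_def\<close>)
  have L: "0 \<le> Lambda_local T nS m K" using Lambda_local_facts(1)[OF K] by simp
  have "\<bar>q x\<bar> \<le> Lambda_local T nS m K * (MAX x\<in>patch_points T nS K. \<bar>q x\<bar>)"
    by (rule Lambda_local_facts(2)[OF K q x])
  also have "\<dots> \<le> Lambda_local T nS m K * sqrt ?S" using M L by (rule mult_left_mono)
  also have "\<dots> \<le> Lambda_bar T nS m * sqrt ?S"
    using Lambda_local_le_bar[OF K] by (intro mult_right_mono) (auto intro: sum_nonneg)
  finally have "\<bar>q x\<bar>\<^sup>2 \<le> (Lambda_bar T nS m * sqrt ?S)\<^sup>2" by (rule power_mono) simp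
  then show ?thesis by (simp add: q_def power_mult_distrib sum_nonneg)
qed

end

section \<open>Integrals over elements and facets\<close>

context quasi_mesh begin

lemma facet_sets: "K \<in> adjacent T e \<Longrightarrow> e \<in> sets borel"
  by (intro borel_closed compact_imp_closed facet_facts(1))

lemma sets_surface_measure: "sets (surface_measure H) = sets borel"
  by (simp add: surface_measure_def)

lemma surface_integrable:
  assumes K: "K \<in> adjacent T e" and f: "continuous_on UNIV (f :: real ^ 'd \<Rightarrow> real)"
  shows "set_integrable (surface_measure (affine hull e)) e f"
proof -
  have "bounded (f ` e)"
    using facet_facts(1)[OF K] continuous_on_subset[OF f] by (intro compact_imp_bounded compact_continuous_image) auto
  then obtain B where B: "\<And>x. x \<in> e \<Longrightarrow> norm (f x) \<le> B" unfolding bounded_iff by blast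
  have m: "f \<in> borel_measurable (surface_measure (affine hull e))"
    using borel_measurable_continuous_onI[OF f] measurable_cong_sets[OF sets_surface_measure refl] by blast
  show ?thesis
    unfolding set_integrable_def
    using facet_sets[OF K] facet_geometry(1)[OF K] m B
    by (intro integrableI_bounded_set_indicator[of _ _ _ B]) (auto simp: sets_surface_measure)
qed

lemma surface_integral_comb:
  assumes "K \<in> adjacent T e" "continuous_on UNIV f" "continuous_on UNIV g"
  shows "surface_integral e (\<lambda>x. t * f x + g x) = t * surface_integral e f + surface_integral e g"
  using surface_integrable[OF assms(1,2)] surface_integrable[OF assms(1,3)]
  unfolding surface_integral_def by simp

lemma surface_integral_mono:
  assumes "K \<in> adjacent T e" "continuous_on UNIV f" "continuous_on UNIV g" "\<And>x. x \<in> e \<Longrightarrow> f x \<le> g x"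
  shows "surface_integral e f \<le> surface_integral e g"
  unfolding surface_integral_def
  using surface_integrable[OF assms(1,2)] surface_integrable[OF assms(1,3)] assms(4)
  by (intro set_integral_mono)

lemma surface_integral_const: "surface_integral e (\<lambda>x. c) = c * area e"
proof -
  have "space (surface_measure (affine hull e)) = UNIV" by (simp add: surface_measure_def)
  then show ?thesis by (simp add: surface_integral_def set_lebesgue_integral_def area_def mult.commute)
qed

lemma surface_integral_le:
  assumes "K \<in> adjacent T e" "continuous_on UNIV f" "\<And>x. x \<in> e \<Longrightarrow> f x \<le> B"
  shows "surface_integral e f \<le> B * area e"
  using surface_integral_mono[OF assms(1,2) continuous_on_const assms(3)] by (simp add: surface_integral_const)

lemma surface_integral_nonneg:
  assumes "K \<in> adjacent T e" "continuous_on UNIV f" "\<And>x. x \<in> e \<Longrightarrow> f x \<ge> 0"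
  shows "surface_integral e f \<ge> 0"
  using surface_integral_mono[OF assms(1) continuous_on_const[of UNIV 0] assms(2) assms(3)]
  by (simp add: surface_integral_const)

lemma element_integrable:
  "K \<in> T \<Longrightarrow> continuous_on UNIV f \<Longrightarrow> set_integrable lborel K (f :: real ^ 'd \<Rightarrow> real)"
  by (rule set_integrable_compact[OF element_facts(2) continuous_on_subset[OF _ subset_UNIV]])

lemma element_volume_le: assumes K: "K \<in> T" shows "measure lborel K \<le> unit_ball_vol CARD('d) * h ^ CARD('d)"
proof -
  obtain x where x: "x \<in> K" using element_facts(8)[OF K] by blast
  have "measure lborel K \<le> measure lborel (cball x h)"
    using element_subset_cball[OF K x] emeasure_lborel_cball_finite element_facts(3)[OF K]
    by (intro measure_mono_fmeasurable fmeasurableI) auto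
  then show ?thesis using h_pos by (simp add: content_cball)
qed

section \<open>Broken polynomials\<close>

definition broken_C1 :: "('d, real) broken \<Rightarrow> bool" where
  "broken_C1 u \<longleftrightarrow> (\<forall>K\<in>T. C1_fun (u K))"

lemma broken_C1_comb: "broken_C1 u \<Longrightarrow> broken_C1 w \<Longrightarrow> broken_C1 (\<lambda>K x. t * u K x + w K x)"
  by (auto simp: broken_C1_def intro: C1_fun_comb)

lemma continuous_jump: "broken_C1 u \<Longrightarrow> continuous_on UNIV (jump T e u)"
  unfolding jump_def[abs_def]
  by (intro continuous_intros) (auto simp: broken_C1_def adjacent_def intro: C1_fun_continuous)

lemma continuous_flux: assumes "C1_fun (u K)" shows "continuous_on UNIV (flux A u K)"
proof -
  have "continuous_on UNIV (grad (u K))" using assms by (simp add: C1_fun_def)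
  from continuous_on_compose2[OF linear_continuous_on[OF matrix_vector_mul_bounded_linear] this subset_UNIV]
  show ?thesis unfolding flux_def[abs_def] .
qed

lemma continuous_avg_flux: assumes "broken_C1 u" shows "continuous_on UNIV (avg T e (flux A u))"
proof -
  have "continuous_on UNIV (\<lambda>x. \<Sum>K\<in>adjacent T e. flux A u K x)"
    using assms by (intro continuous_on_sum continuous_flux) (auto simp: broken_C1_def adjacent_def)
  then show ?thesis unfolding avg_def[abs_def] by (cases "e \<in> interior_faces T") (auto intro: continuous_intros)
qed

lemma jump_comb: "jump T e (\<lambda>K x. t * u K x + w K x) x = t *\<^sub>R jump T e u x + jump T e w x"
  by (simp add: jump_def scaleR_add_left sum.distrib scaleR_sum_right)

lemma flux_comb: "C1_fun (u K) \<Longrightarrow> C1_fun (w K) \<Longrightarrow>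
    flux A (\<lambda>K x. t * u K x + w K x) K x = t *\<^sub>R flux A u K x + flux A w K x"
  by (simp add: flux_def grad_comb matrix_vector_right_distrib matrix_vector_mult_scaleR)

lemma avg_flux_comb:
  assumes "broken_C1 u" "broken_C1 w"
  shows "avg T e (flux A (\<lambda>K x. t * u K x + w K x)) x = t *\<^sub>R avg T e (flux A u) x + avg T e (flux A w) x"
proof -
  have "(\<Sum>K\<in>adjacent T e. flux A (\<lambda>K x. t * u K x + w K x) K x)
      = t *\<^sub>R (\<Sum>K\<in>adjacent T e. flux A u K x) + (\<Sum>K\<in>adjacent T e. flux A w K x)"
    unfolding scaleR_sum_right sum.distrib[symmetric]
    using assms by (intro sum.cong refl flux_comb) (auto simp: broken_C1_def adjacent_def)
  then show ?thesis by (simp add: avg_def scaleR_add_right mult.commute)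
qed

text \<open>
  The form is split because the consistency part enters twice, with exchanged arguments, and cancels
  on the diagonal for one choice of \<open>\<theta>\<close>.
\<close>

definition diffusion :: "real ^ 'd ^ 'd \<Rightarrow> ('d, real) broken \<Rightarrow> ('d, real) broken \<Rightarrow> real" where
  "diffusion A u w = (\<Sum>K\<in>T. LINT x:K|lborel. flux A u K x \<bullet> grad (w K) x)"

definition consistency :: "real ^ 'd ^ 'd \<Rightarrow> ('d, real) broken \<Rightarrow> ('d, real) broken \<Rightarrow> real" where
  "consistency A u w = (\<Sum>e\<in>faces T. surface_integral e (\<lambda>x. avg T e (flux A u) x \<bullet> jump T e w x))"

definition penalty :: "real \<Rightarrow> ('d, real) broken \<Rightarrow> ('d, real) broken \<Rightarrow> real" where
  "penalty \<mu> u w = (\<Sum>e\<in>faces T. surface_integral e (\<lambda>x. \<mu> * inverse (diameter e) * (jump T e u x \<bullet> jump T e w x)))"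

lemma dg_form_split:
  "dg_form A \<theta> \<mu> T u w = diffusion A u w - consistency A u w + \<theta> * consistency A w u + penalty \<mu> u w"
  by (simp add: dg_form_def diffusion_def consistency_def penalty_def)

lemma dg_form0_penalty: "dg_form0 T u w = penalty 1 u w"
  by (simp add: dg_form0_def penalty_def)

lemma diffusion_comb_left:
  assumes u: "broken_C1 u" "broken_C1 u'" and w: "broken_C1 w"
  shows "diffusion A (\<lambda>K x. t * u K x + u' K x) w = t * diffusion A u w + diffusion A u' w"
  unfolding diffusion_def sum_distrib_left sum.distrib[symmetric]
proof (rule sum.cong[OF refl])
  fix K assume K: "K \<in> T"
  have c: "C1_fun (u K)" "C1_fun (u' K)" "continuous_on UNIV (grad (w K))"
    using u w K by (auto simp: broken_C1_def C1_fun_def)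
  have "set_integrable lborel K (\<lambda>x. flux A u K x \<bullet> grad (w K) x)"
    "set_integrable lborel K (\<lambda>x. flux A u' K x \<bullet> grad (w K) x)"
    by (intro element_integrable[OF K] continuous_on_inner continuous_flux c)+
  then show "(LINT x:K|lborel. flux A (\<lambda>K x. t * u K x + u' K x) K x \<bullet> grad (w K) x)
      = t * (LINT x:K|lborel. flux A u K x \<bullet> grad (w K) x) + (LINT x:K|lborel. flux A u' K x \<bullet> grad (w K) x)"
    by (simp add: flux_comb[of u K u', OF c(1,2)] inner_add_left)
qed

lemma diffusion_comb_right:
  assumes u: "broken_C1 u" "broken_C1 u'" and w: "broken_C1 w"
  shows "diffusion A w (\<lambda>K x. t * u K x + u' K x) = t * diffusion A w u + diffusion A w u'"
  unfolding diffusion_def sum_distrib_left sum.distrib[symmetric]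
proof (rule sum.cong[OF refl])
  fix K assume K: "K \<in> T"
  have c: "C1_fun (u K)" "C1_fun (u' K)" "C1_fun (w K)" "continuous_on UNIV (grad (u K))" "continuous_on UNIV (grad (u' K))"
    using u w K by (auto simp: broken_C1_def C1_fun_def)
  have "set_integrable lborel K (\<lambda>x. flux A w K x \<bullet> grad (u K) x)"
    "set_integrable lborel K (\<lambda>x. flux A w K x \<bullet> grad (u' K) x)"
    by (intro element_integrable[OF K] continuous_on_inner continuous_flux c)+
  then show "(LINT x:K|lborel. flux A w K x \<bullet> grad (\<lambda>x. t * u K x + u' K x) x)
      = t * (LINT x:K|lborel. flux A w K x \<bullet> grad (u K) x) + (LINT x:K|lborel. flux A w K x \<bullet> grad (u' K) x)"
    by (simp add: grad_comb[OF c(1,2)] inner_add_right)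
qed

text \<open>
  Linearity of all sums over facets at once, reduced to an identity between the integrands.
\<close>

lemma faces_sum_comb:
  assumes "\<And>e. e \<in> faces T \<Longrightarrow> continuous_on UNIV (f e)" "\<And>e. e \<in> faces T \<Longrightarrow> continuous_on UNIV (g e)"
    and "\<And>e x. e \<in> faces T \<Longrightarrow> k e x = t * f e x + g e x"
  shows "(\<Sum>e\<in>faces T. surface_integral e (k e))
    = t * (\<Sum>e\<in>faces T. surface_integral e (f e)) + (\<Sum>e\<in>faces T. surface_integral e (g e))"
  unfolding sum_distrib_left sum.distrib[symmetric]
proof (rule sum.cong[OF refl])
  fix e assume e: "e \<in> faces T"
  then obtain K where K: "K \<in> adjacent T e" using faces_iff by blast
  have "k e = (\<lambda>x. t * f e x + g e x)" using assms(3)[OF e] by blast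
  then show "surface_integral e (k e) = t * surface_integral e (f e) + surface_integral e (g e)"
    using surface_integral_comb[OF K assms(1,2)[OF e], of t] by simp
qed

lemma consistency_comb_left:
  assumes "broken_C1 u" "broken_C1 u'" "broken_C1 w"
  shows "consistency A (\<lambda>K x. t * u K x + u' K x) w = t * consistency A u w + consistency A u' w"
  unfolding consistency_def
  by (rule faces_sum_comb)
     (auto simp: avg_flux_comb assms inner_add_left intro!: continuous_on_inner continuous_avg_flux continuous_jump assms)

lemma consistency_comb_right:
  assumes "broken_C1 u" "broken_C1 u'" "broken_C1 w"
  shows "consistency A w (\<lambda>K x. t * u K x + u' K x) = t * consistency A w u + consistency A w u'"
  unfolding consistency_def
  by (rule faces_sum_comb)
     (auto simp: jump_comb inner_add_right intro!: continuous_on_inner continuous_avg_flux continuous_jump assms)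

lemma penalty_comb_left:
  assumes "broken_C1 u" "broken_C1 u'" "broken_C1 w"
  shows "penalty \<mu> (\<lambda>K x. t * u K x + u' K x) w = t * penalty \<mu> u w + penalty \<mu> u' w"
  unfolding penalty_def
  by (rule faces_sum_comb)
     (auto simp: jump_comb inner_add_left distrib_left mult.left_commute
       intro!: continuous_on_mult continuous_on_const continuous_on_inner continuous_jump assms)

lemma penalty_sym: "penalty \<mu> u w = penalty \<mu> w u"
  by (simp add: penalty_def inner_commute)

lemma dg_form_comb_left:
  assumes "broken_C1 u" "broken_C1 u'" "broken_C1 w"
  shows "dg_form A \<theta> \<mu> T (\<lambda>K x. t * u K x + u' K x) w = t * dg_form A \<theta> \<mu> T u w + dg_form A \<theta> \<mu> T u' w"
  unfolding dg_form_split diffusion_comb_left[OF assms] consistency_comb_left[OF assms]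
    consistency_comb_right[OF assms] penalty_comb_left[OF assms]
  by (simp add: distrib_left right_diff_distrib mult.left_commute)

lemma dg_form_comb_right:
  assumes "broken_C1 u" "broken_C1 u'" "broken_C1 w"
  shows "dg_form A \<theta> \<mu> T w (\<lambda>K x. t * u K x + u' K x) = t * dg_form A \<theta> \<mu> T w u + dg_form A \<theta> \<mu> T w u'"
  unfolding dg_form_split diffusion_comb_right[OF assms] consistency_comb_left[OF assms]
    consistency_comb_right[OF assms] penalty_sym[of \<mu> w] penalty_comb_left[OF assms]
  by (simp add: distrib_left right_diff_distrib mult.left_commute)

definition grad_energy :: "('d, real) broken \<Rightarrow> (real ^ 'd) set \<Rightarrow> real" where
  "grad_energy u K = (LINT x:K|lborel. (norm (grad (u K) x))\<^sup>2)"

definition jump_energy :: "('d, real) broken \<Rightarrow> (real ^ 'd) set \<Rightarrow> real" where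
  "jump_energy u e = surface_integral e (\<lambda>x. inverse (diameter e) * (norm (jump T e u x))\<^sup>2)"

definition dg_energy :: "('d, real) broken \<Rightarrow> real" where
  "dg_energy u = (\<Sum>K\<in>T. grad_energy u K) + (\<Sum>e\<in>faces T. jump_energy u e)"

lemma diameter_pos: "K \<in> adjacent T e \<Longrightarrow> diameter e > 0"
  using facet_geometry(4) r_pos by fastforce

lemma jump_energy_nonneg: assumes "e \<in> faces T" "broken_C1 u" shows "jump_energy u e \<ge> 0"
proof -
  obtain K where K: "K \<in> adjacent T e" using assms faces_iff by blast
  show ?thesis
    unfolding jump_energy_def
    by (rule surface_integral_nonneg[OF K])
       (auto intro!: continuous_intros continuous_jump assms simp: less_imp_le[OF diameter_pos[OF K]])
qed

lemma grad_energy_nonneg: "grad_energy u K \<ge> 0"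
  unfolding grad_energy_def set_lebesgue_integral_def by (intro integral_nonneg_AE) auto

definition piecewise_const :: "((real ^ 'd) set \<Rightarrow> real) \<Rightarrow> ('d, real) broken" where
  "piecewise_const v = (\<lambda>K x. v K)"

lemma broken_C1_const: "broken_C1 (piecewise_const v)"
  by (simp add: broken_C1_def piecewise_const_def C1_fun_const)

lemma jump_energy_const: "jump_energy (piecewise_const v) e = inverse (diameter e) * area e * sq_jump v e"
proof -
  have "jump T e (piecewise_const v) x = jump T e (\<lambda>K x. v K) 0" for x
    by (simp add: jump_def piecewise_const_def)
  then show ?thesis
    unfolding jump_energy_def sq_jump_def by (simp add: surface_integral_const)
qed

end

section \<open>Energy estimates\<close>

text \<open>
  The constants are parameters that satisfy conditions free of the mesh, so that they can be chosen
  before the mesh is: \<open>C1\<close> and \<open>C2\<close> are those of the two inverse inequalities at the ratio of radii that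
  quasi-uniformity provides, \<open>a0\<close> and \<open>a1\<close> bound the coefficient matrix, \<open>ca\<close> bounds the area of a
  facet in terms of a power of \<open>r\<close>, and \<open>c5\<close> is the constant of the trace inequality summed over all
  facets.
\<close>

locale dg_mesh = reconstruction_mesh \<Omega> T C\<sigma> nS m
  for \<Omega> :: "(real ^ 'd) set" and T :: "(real ^ 'd) set set" and C\<sigma> :: real and nS m :: nat +
  fixes A :: "real ^ 'd ^ 'd" and C1 C2 a0 a1 ca c5 :: real
  assumes C1: "C1 \<ge> 0" and inverse_L2: "\<And>p :: real ^ 'd \<Rightarrow> real. \<And>c r x. p \<in> poly_space m \<Longrightarrow> r > 0 \<Longrightarrow> x \<in> cball c (2 * C\<sigma> * r) \<Longrightarrow>
      r ^ CARD('d) * (norm (grad p x))\<^sup>2 \<le> C1 * (LINT x:cball c r|lborel. (norm (grad p x))\<^sup>2)"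
    and C2: "C2 \<ge> 0" and inverse_sup: "\<And>p :: real ^ 'd \<Rightarrow> real. \<And>c r x M. p \<in> poly_space m \<Longrightarrow> r > 0 \<Longrightarrow>
      (\<And>x. x \<in> cball c r \<Longrightarrow> \<bar>p x\<bar> \<le> M) \<Longrightarrow> x \<in> cball c (2 * C\<sigma> * r) \<Longrightarrow> r * norm (grad p x) \<le> C2 * M"
    and a0: "a0 > 0" "\<And>x. a0 * (norm x)\<^sup>2 \<le> x \<bullet> (A *v x)"
    and a1: "a1 \<ge> 0" "\<And>x. norm (A *v x) \<le> a1 * norm x"
    and ca: "ca = unit_ball_vol CARD('d) * 3 ^ CARD('d) * (2 * C\<sigma>) ^ (CARD('d) - 1)"
    and c5: "c5 = (real CARD('d) + 1) * (2 * C\<sigma> * a1\<^sup>2 * C1 * ca)"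
begin

definition broken_poly :: "('d, real) broken \<Rightarrow> bool" where
  "broken_poly u \<longleftrightarrow> (\<forall>K\<in>T. u K \<in> poly_space m)"

lemma broken_poly_C1: "broken_poly u \<Longrightarrow> broken_C1 u"
  by (auto simp: broken_poly_def broken_C1_def intro: C1_fun_poly)

lemma ca_nonneg: "ca \<ge> 0" using C\<sigma> by (simp add: ca)

lemma c5_nonneg: "c5 \<ge> 0" using C\<sigma> C1 ca_nonneg by (simp add: c5)

lemma r_power: "r ^ CARD('d) = r * r ^ (CARD('d) - 1)" "r ^ CARD('d) = r\<^sup>2 * r ^ (CARD('d) - 2)"
    "r ^ (CARD('d) - 1) = r * r ^ (CARD('d) - 2)"
proof -
  have "CARD('d) = Suc (CARD('d) - 1)" "CARD('d) - 1 = Suc (CARD('d) - 2)" using card2 by auto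
  then show 1: "r ^ CARD('d) = r * r ^ (CARD('d) - 1)" and 2: "r ^ (CARD('d) - 1) = r * r ^ (CARD('d) - 2)"
    by (metis power_Suc)+
  show "r ^ CARD('d) = r\<^sup>2 * r ^ (CARD('d) - 2)" unfolding 1 2 by (simp add: power2_eq_square)
qed

lemma area_le: assumes "K \<in> adjacent T e" shows "area e \<le> ca * r ^ (CARD('d) - 1)"
  using facet_geometry(3)[OF assms] by (simp add: ca h_eq power_mult_distrib mult.assoc)

lemma element_between_balls:
  assumes K: "K \<in> T" obtains c where "cball c r \<subseteq> K" "K \<subseteq> cball c (2 * C\<sigma> * r)"
proof -
  obtain c where c: "cball c r \<subseteq> K" using inner_ball[OF K] .
  then have "c \<in> K" using r_pos by auto
  then show ?thesis using that[of c] c element_subset_cball[OF K] h_eq by metis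
qed

text \<open>
  The element contains a ball and is contained in the concentric ball whose radius is larger by a
  fixed factor.
\<close>

lemma grad_inverse_element:
  assumes K: "K \<in> T" and u: "broken_poly u" and x: "x \<in> K"
  shows "r ^ CARD('d) * (norm (grad (u K) x))\<^sup>2 \<le> C1 * grad_energy u K"
proof -
  obtain c where c: "cball c r \<subseteq> K" "K \<subseteq> cball c (2 * C\<sigma> * r)" by (rule element_between_balls[OF K]) (rule that)
  have p: "u K \<in> poly_space m" using u K by (simp add: broken_poly_def)
  have cg: "continuous_on UNIV (\<lambda>x. (norm (grad (u K) x))\<^sup>2)"
    using C1_fun_poly[OF p] unfolding C1_fun_def by (intro continuous_intros) auto
  have i: "set_integrable lborel K (\<lambda>x. (norm (grad (u K) x))\<^sup>2)" by (rule element_integrable[OF K cg])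
  have j: "set_integrable lborel (cball c r) (\<lambda>x. (norm (grad (u K) x))\<^sup>2)"
    by (rule set_integrable_subset[OF i _ c(1)]) simp
  have "(LINT x:cball c r|lborel. (norm (grad (u K) x))\<^sup>2) \<le> grad_energy u K"
    unfolding grad_energy_def set_lebesgue_integral_def
    using i j c(1) by (intro integral_mono) (auto simp: set_integrable_def indicator_def)
  then have "C1 * (LINT x:cball c r|lborel. (norm (grad (u K) x))\<^sup>2) \<le> C1 * grad_energy u K"
    using C1 by (rule mult_left_mono)
  then show ?thesis using inverse_L2[OF p r_pos, of x c] x c(2) by (meson order_trans subsetD)
qed

lemma norm_avg_flux_le:
  "(norm (avg T e (flux A u) x))\<^sup>2 \<le> (\<Sum>K\<in>adjacent T e. a1\<^sup>2 * (norm (grad (u K) x))\<^sup>2)"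
proof -
  have fl: "(norm (flux A u K x))\<^sup>2 \<le> a1\<^sup>2 * (norm (grad (u K) x))\<^sup>2" for K
    using power_mono[OF a1(2)[of "grad (u K) x"], of 2] by (simp add: flux_def power_mult_distrib)
  have "(norm (avg T e (flux A u) x))\<^sup>2 \<le> (\<Sum>K\<in>adjacent T e. (norm (flux A u K x))\<^sup>2)"
  proof (cases "e \<in> faces T")
    case True
    then show ?thesis
    proof (cases rule: face_cases)
      case (boundary K)
      then show ?thesis by (simp add: avg_def)
    next
      case (interior K K')
      have avg: "avg T e (flux A u) x = (1 / 2) *\<^sub>R (flux A u K x + flux A u K' x)"
        using interior by (simp add: avg_def)
      have "norm (flux A u K x + flux A u K' x) \<le> norm (flux A u K x) + norm (flux A u K' x)"
        by (rule norm_triangle_ineq)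
      then have "norm (avg T e (flux A u) x) \<le> (norm (flux A u K x) + norm (flux A u K' x)) / 2"
        unfolding avg by simp
      then have "(norm (avg T e (flux A u) x))\<^sup>2 \<le> ((norm (flux A u K x) + norm (flux A u K' x)) / 2)\<^sup>2"
        by (rule power_mono) simp
      also have "\<dots> \<le> (norm (flux A u K x))\<^sup>2 + (norm (flux A u K' x))\<^sup>2"
      proof -
        have "((a + b) / 2)\<^sup>2 \<le> a\<^sup>2 + b\<^sup>2" for a b :: real
        proof -
          have "((a + b) / 2)\<^sup>2 = (a\<^sup>2 + b\<^sup>2 + 2 * a * b) / 4" by (simp add: power2_eq_square field_simps)
          also have "\<dots> \<le> (a\<^sup>2 + b\<^sup>2 + (a\<^sup>2 + b\<^sup>2)) / 4"
            using sum_squares_bound[of a b] by (intro divide_right_mono add_left_mono) auto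
          also have "\<dots> \<le> a\<^sup>2 + b\<^sup>2" by simp
          finally show ?thesis .
        qed
        then show ?thesis .
      qed
      finally show ?thesis using interior by simp
    qed
  next
    case False
    then have "adjacent T e = {}" using faces_iff[of e] by simp
    then have "avg T e (flux A u) x = 0" by (simp add: avg_def)
    then show ?thesis by (simp add: sum_nonneg)
  qed
  also have "\<dots> \<le> (\<Sum>K\<in>adjacent T e. a1\<^sup>2 * (norm (grad (u K) x))\<^sup>2)" by (intro sum_mono fl)
  finally show ?thesis .
qed

text \<open>
  The powers of \<open>r\<close> cancel against the area of the facet.
\<close>

lemma facet_bound_scale:
  assumes K: "K \<in> adjacent T e" and f: "continuous_on UNIV f" and S: "S \<ge> 0"
    and b: "\<And>x. x \<in> e \<Longrightarrow> r ^ (CARD('d) - 1) * f x \<le> S"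
  shows "surface_integral e f \<le> ca * S"
proof -
  have rp: "r ^ (CARD('d) - 1) > 0" using r_pos by simp
  have "surface_integral e f \<le> (S / r ^ (CARD('d) - 1)) * area e"
    using b rp by (intro surface_integral_le[OF K f]) (simp add: pos_le_divide_eq mult.commute)
  also have "\<dots> \<le> (S / r ^ (CARD('d) - 1)) * (ca * r ^ (CARD('d) - 1))"
    using area_le[OF K] S rp by (intro mult_left_mono) auto
  also have "\<dots> = ca * S"
  proof -
    have "(S / R) * (ca * R) = ca * S" if "R > 0" for R :: real using that by simp
    from this[OF rp] show ?thesis .
  qed
  finally show ?thesis .
qed

text \<open>
  The discrete trace inequality: on a facet the squared gradient is bounded pointwise by its mean over
  the adjacent elements, and the area of the facet times its diameter is at most a multiple of the
  volume of an element.
\<close>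

lemma avg_flux_energy:
  assumes u: "broken_poly u" and e: "e \<in> faces T"
  shows "surface_integral e (\<lambda>x. diameter e * (norm (avg T e (flux A u) x))\<^sup>2)
    \<le> 2 * C\<sigma> * a1\<^sup>2 * C1 * ca * (\<Sum>K\<in>adjacent T e. grad_energy u K)"
proof -
  obtain K0 where K0: "K0 \<in> adjacent T e" using e faces_iff by blast
  let ?S = "\<Sum>K\<in>adjacent T e. grad_energy u K"
  have S0: "?S \<ge> 0" by (intro sum_nonneg grad_energy_nonneg)
  have "surface_integral e (\<lambda>x. diameter e * (norm (avg T e (flux A u) x))\<^sup>2) \<le> ca * (2 * C\<sigma> * a1\<^sup>2 * (C1 * ?S))"
  proof (rule facet_bound_scale[OF K0])
    show "continuous_on UNIV (\<lambda>x. diameter e * (norm (avg T e (flux A u) x))\<^sup>2)"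
      by (intro continuous_intros continuous_avg_flux broken_poly_C1 u)
    show "0 \<le> 2 * C\<sigma> * a1\<^sup>2 * (C1 * ?S)" using C\<sigma> C1 S0 by simp
    fix x assume x: "x \<in> e"
    have d: "diameter e \<le> 2 * C\<sigma> * r" "0 \<le> diameter e"
      using facet_geometry(5)[OF K0] h_eq diameter_pos[OF K0] by auto
    have rp: "r ^ (CARD('d) - 1) \<ge> 0" using r_pos by simp
    have "r ^ CARD('d) * (norm (avg T e (flux A u) x))\<^sup>2 \<le> r ^ CARD('d) * (\<Sum>K\<in>adjacent T e. a1\<^sup>2 * (norm (grad (u K) x))\<^sup>2)"
      using r_pos by (intro mult_left_mono norm_avg_flux_le) auto
    also have "\<dots> = a1\<^sup>2 * (\<Sum>K\<in>adjacent T e. r ^ CARD('d) * (norm (grad (u K) x))\<^sup>2)"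
      by (simp add: sum_distrib_left mult.left_commute)
    also have "\<dots> \<le> a1\<^sup>2 * (\<Sum>K\<in>adjacent T e. C1 * grad_energy u K)"
    proof (intro mult_left_mono sum_mono)
      fix K assume K: "K \<in> adjacent T e"
      then show "r ^ CARD('d) * (norm (grad (u K) x))\<^sup>2 \<le> C1 * grad_energy u K"
        using x facet_facts(2)[OF K] by (intro grad_inverse_element adjacentD(1) u) auto
    qed simp
    finally have b: "r ^ CARD('d) * (norm (avg T e (flux A u) x))\<^sup>2 \<le> a1\<^sup>2 * (C1 * ?S)"
      by (simp add: sum_distrib_left)
    have "r ^ (CARD('d) - 1) * (diameter e * (norm (avg T e (flux A u) x))\<^sup>2)
        \<le> r ^ (CARD('d) - 1) * ((2 * C\<sigma> * r) * (norm (avg T e (flux A u) x))\<^sup>2)"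
      using d rp by (intro mult_left_mono mult_right_mono) auto
    also have "\<dots> = 2 * C\<sigma> * (r ^ CARD('d) * (norm (avg T e (flux A u) x))\<^sup>2)"
      unfolding r_power(1) by (simp add: mult_ac)
    also have "\<dots> \<le> 2 * C\<sigma> * (a1\<^sup>2 * (C1 * ?S))" using b C\<sigma> by (intro mult_left_mono) auto
    finally show "r ^ (CARD('d) - 1) * (diameter e * (norm (avg T e (flux A u) x))\<^sup>2) \<le> 2 * C\<sigma> * a1\<^sup>2 * (C1 * ?S)"
      by (simp add: mult.assoc)
  qed
  then show ?thesis by (simp add: mult_ac)
qed

lemma young_inner:
  fixes x y :: "'b::real_inner"
  assumes "s > 0" shows "\<bar>x \<bullet> y\<bar> \<le> s / 2 * (norm x)\<^sup>2 + inverse s / 2 * (norm y)\<^sup>2"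
proof -
  have "0 \<le> (s * norm x - norm y)\<^sup>2" by simp
  then have "2 * s * (norm x * norm y) \<le> s\<^sup>2 * (norm x)\<^sup>2 + (norm y)\<^sup>2"
    by (simp add: power2_diff power_mult_distrib mult_ac)
  then have "norm x * norm y \<le> s / 2 * (norm x)\<^sup>2 + inverse s / 2 * (norm y)\<^sup>2"
    using assms by (simp add: field_simps power2_eq_square)
  then show ?thesis using Cauchy_Schwarz_ineq2[of x y] by linarith
qed

text \<open>
  Young's inequality with weights \<open>s h\<^sub>e\<close> and \<open>(s h\<^sub>e)\<^sup>-\<^sup>1\<close>; the free parameter \<open>s\<close> is what the
  coercivity proof for \<open>\<theta> = -1\<close> adjusts.
\<close>

lemma consistency_le:
  assumes u: "broken_poly u" and w: "broken_poly w" and s: "s > 0"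
  shows "\<bar>consistency A u w\<bar> \<le> s / 2 * (c5 * (\<Sum>K\<in>T. grad_energy u K)) + inverse s / 2 * (\<Sum>e\<in>faces T. jump_energy w e)"
proof -
  have face: "\<bar>surface_integral e (\<lambda>x. avg T e (flux A u) x \<bullet> jump T e w x)\<bar>
      \<le> s / 2 * (2 * C\<sigma> * a1\<^sup>2 * C1 * ca * (\<Sum>K\<in>adjacent T e. grad_energy u K)) + inverse s / 2 * jump_energy w e"
    if e: "e \<in> faces T" for e
  proof -
    obtain K where K: "K \<in> adjacent T e" using e faces_iff by blast
    have dpos: "diameter e > 0" by (rule diameter_pos[OF K])
    let ?f = "\<lambda>x. avg T e (flux A u) x \<bullet> jump T e w x"
    let ?a = "\<lambda>x. diameter e * (norm (avg T e (flux A u) x))\<^sup>2"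
    let ?j = "\<lambda>x. inverse (diameter e) * (norm (jump T e w x))\<^sup>2"
    let ?g = "\<lambda>x. s / 2 * ?a x + inverse s / 2 * ?j x"
    have cf: "continuous_on UNIV ?f" "continuous_on UNIV (\<lambda>x. - ?f x)" "continuous_on UNIV ?a" "continuous_on UNIV ?j"
      "continuous_on UNIV (\<lambda>x. inverse s / 2 * ?j x)"
      by (intro continuous_on_minus continuous_on_mult continuous_on_const continuous_on_power continuous_on_norm continuous_on_inner
          continuous_avg_flux continuous_jump broken_poly_C1 u w)+
    have cg: "continuous_on UNIV ?g" 
      by (rule continuous_on_add[OF continuous_on_mult[OF continuous_on_const cf(3)] cf(5)])
    have fg: "\<bar>?f x\<bar> \<le> ?g x" for x
    proof -
      have "\<bar>?f x\<bar> \<le> (s * diameter e) / 2 * (norm (avg T e (flux A u) x))\<^sup>2 + inverse (s * diameter e) / 2 * (norm (jump T e w x))\<^sup>2"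
        using s dpos by (intro young_inner) simp
      then show ?thesis by (simp add: mult_ac)
    qed
    have i: "surface_integral e ?g = s / 2 * surface_integral e ?a + inverse s / 2 * surface_integral e ?j"
    proof -
      have "surface_integral e ?g = s / 2 * surface_integral e ?a + surface_integral e (\<lambda>x. inverse s / 2 * ?j x)"
        by (rule surface_integral_comb[OF K cf(3,5)])
      also have "surface_integral e (\<lambda>x. inverse s / 2 * ?j x) = inverse s / 2 * surface_integral e ?j"
        using surface_integral_comb[OF K cf(4) continuous_on_const[of UNIV 0], of "inverse s / 2"]
        by (simp add: surface_integral_const)
      finally show ?thesis .
    qed
    have m: "surface_integral e (\<lambda>x. - ?f x) = - surface_integral e ?f"
      using surface_integral_comb[OF K cf(1) continuous_on_const[of UNIV 0], of "-1"]
      by (simp add: surface_integral_const)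
    have "surface_integral e ?f \<le> surface_integral e ?g"
      using fg by (intro surface_integral_mono[OF K cf(1) cg]) (simp add: abs_le_iff)
    moreover have "surface_integral e (\<lambda>x. - ?f x) \<le> surface_integral e ?g"
      using fg by (intro surface_integral_mono[OF K cf(2) cg]) (simp add: abs_le_iff)
    ultimately have "\<bar>surface_integral e ?f\<bar> \<le> surface_integral e ?g" using m by linarith
    also have "\<dots> \<le> s / 2 * (2 * C\<sigma> * a1\<^sup>2 * C1 * ca * (\<Sum>K\<in>adjacent T e. grad_energy u K)) + inverse s / 2 * jump_energy w e"
      unfolding i jump_energy_def using avg_flux_energy[OF u e] s by (intro add_right_mono mult_left_mono) auto
    finally show ?thesis .
  qed
  have "\<bar>consistency A u w\<bar> \<le> (\<Sum>e\<in>faces T. \<bar>surface_integral e (\<lambda>x. avg T e (flux A u) x \<bullet> jump T e w x)\<bar>)"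
    unfolding consistency_def by (rule sum_abs)
  also have "\<dots> \<le> (\<Sum>e\<in>faces T. s / 2 * (2 * C\<sigma> * a1\<^sup>2 * C1 * ca * (\<Sum>K\<in>adjacent T e. grad_energy u K)) + inverse s / 2 * jump_energy w e)"
    by (intro sum_mono face)
  also have "\<dots> = s / 2 * (2 * C\<sigma> * a1\<^sup>2 * C1 * ca * (\<Sum>e\<in>faces T. \<Sum>K\<in>adjacent T e. grad_energy u K)) + inverse s / 2 * (\<Sum>e\<in>faces T. jump_energy w e)"
    by (simp only: sum.distrib sum_distrib_left)
  also have "\<dots> \<le> s / 2 * (2 * C\<sigma> * a1\<^sup>2 * C1 * ca * ((real CARD('d) + 1) * (\<Sum>K\<in>T. grad_energy u K))) + inverse s / 2 * (\<Sum>e\<in>faces T. jump_energy w e)"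
    using s C\<sigma> C1 ca_nonneg by (intro add_right_mono mult_left_mono sum_faces_adjacent_le grad_energy_nonneg) auto
  finally show ?thesis by (simp add: c5 mult_ac)
qed

lemma diffusion_le:
  assumes u: "broken_poly u" and w: "broken_poly w"
  shows "\<bar>diffusion A u w\<bar> \<le> a1 / 2 * ((\<Sum>K\<in>T. grad_energy u K) + (\<Sum>K\<in>T. grad_energy w K))"
proof -
  have el: "\<bar>LINT x:K|lborel. flux A u K x \<bullet> grad (w K) x\<bar> \<le> a1 / 2 * (grad_energy u K + grad_energy w K)"
    if K: "K \<in> T" for K
  proof -
    have c: "C1_fun (u K)" "C1_fun (w K)" using u w K broken_poly_C1 by (auto simp: broken_C1_def)
    then have cg: "continuous_on UNIV (grad (u K))" "continuous_on UNIV (grad (w K))" by (auto simp: C1_fun_def)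
    let ?f = "\<lambda>x. flux A u K x \<bullet> grad (w K) x"
    let ?a = "\<lambda>x. (norm (grad (u K) x))\<^sup>2" and ?b = "\<lambda>x. (norm (grad (w K) x))\<^sup>2"
    have ia: "set_integrable lborel K ?a" "set_integrable lborel K ?b" "set_integrable lborel K ?f"
      by (intro element_integrable[OF K] continuous_on_power continuous_on_norm continuous_on_inner continuous_flux cg c)+
    have ig: "set_integrable lborel K (\<lambda>x. a1 / 2 * (?a x + ?b x))" using ia by simp
    have fg: "\<bar>?f x\<bar> \<le> a1 / 2 * (?a x + ?b x)" for x
    proof -
      have "\<bar>?f x\<bar> \<le> norm (flux A u K x) * norm (grad (w K) x)" by (rule Cauchy_Schwarz_ineq2)
      also have "\<dots> \<le> (a1 * norm (grad (u K) x)) * norm (grad (w K) x)"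
        unfolding flux_def by (intro mult_right_mono a1) auto
      also have "\<dots> = a1 / 2 * (2 * norm (grad (u K) x) * norm (grad (w K) x))" by simp
      also have "\<dots> \<le> a1 / 2 * (?a x + ?b x)" using a1(1) sum_squares_bound by (intro mult_left_mono) auto
      finally show ?thesis .
    qed
    have "(LINT x:K|lborel. ?f x) \<le> (LINT x:K|lborel. a1 / 2 * (?a x + ?b x))"
      by (rule set_integral_mono[OF ia(3) ig]) (rule order_trans[OF abs_ge_self fg])
    moreover have "- (LINT x:K|lborel. ?f x) = (LINT x:K|lborel. - ?f x)"
      by (simp add: set_lebesgue_integral_def)
    moreover have "(LINT x:K|lborel. - ?f x) \<le> (LINT x:K|lborel. a1 / 2 * (?a x + ?b x))"
    proof (rule set_integral_mono[OF _ ig])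
      show "set_integrable lborel K (\<lambda>x. - ?f x)"
        by (intro element_integrable[OF K] continuous_on_minus continuous_on_inner continuous_flux cg c)
    qed (rule order_trans[OF abs_ge_minus_self fg])
    moreover have "(LINT x:K|lborel. a1 / 2 * (?a x + ?b x)) = a1 / 2 * (grad_energy u K + grad_energy w K)"
      using ia by (simp add: grad_energy_def)
    ultimately show ?thesis by linarith
  qed
  have "\<bar>diffusion A u w\<bar> \<le> (\<Sum>K\<in>T. \<bar>LINT x:K|lborel. flux A u K x \<bullet> grad (w K) x\<bar>)"
    unfolding diffusion_def by (rule sum_abs)
  also have "\<dots> \<le> (\<Sum>K\<in>T. a1 / 2 * (grad_energy u K + grad_energy w K))" by (intro sum_mono el)
  finally show ?thesis by (simp only: sum_distrib_left[symmetric] sum.distrib)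
qed

lemma diffusion_ge:
  assumes u: "broken_poly u" shows "a0 * (\<Sum>K\<in>T. grad_energy u K) \<le> diffusion A u u"
proof -
  have "a0 * grad_energy u K \<le> (LINT x:K|lborel. flux A u K x \<bullet> grad (u K) x)" if K: "K \<in> T" for K
  proof -
    have c: "C1_fun (u K)" using u K broken_poly_C1 by (auto simp: broken_C1_def)
    then have cg: "continuous_on UNIV (grad (u K))" by (auto simp: C1_fun_def)
    have ia: "set_integrable lborel K (\<lambda>x. (norm (grad (u K) x))\<^sup>2)" "set_integrable lborel K (\<lambda>x. flux A u K x \<bullet> grad (u K) x)"
      by (intro element_integrable[OF K] continuous_on_power continuous_on_norm continuous_on_inner continuous_flux cg c)+
    have "a0 * grad_energy u K = (LINT x:K|lborel. a0 * (norm (grad (u K) x))\<^sup>2)" by (simp add: grad_energy_def)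
    also have "\<dots> \<le> (LINT x:K|lborel. flux A u K x \<bullet> grad (u K) x)"
      using ia a0(2) by (intro set_integral_mono) (auto simp: flux_def inner_commute)
    finally show ?thesis .
  qed
  then show ?thesis unfolding diffusion_def sum_distrib_left by (rule sum_mono)
qed

lemma penalty_eq: assumes "broken_C1 u" shows "penalty \<mu> u u = \<mu> * (\<Sum>e\<in>faces T. jump_energy u e)"
proof -
  have "(\<Sum>e\<in>faces T. surface_integral e (\<lambda>x. \<mu> * inverse (diameter e) * (jump T e u x \<bullet> jump T e u x)))
    = \<mu> * (\<Sum>e\<in>faces T. jump_energy u e) + (\<Sum>e\<in>faces T. surface_integral e (\<lambda>x. 0))"
    unfolding jump_energy_def
    by (rule faces_sum_comb)
       (auto intro!: continuous_intros continuous_jump assms simp: power2_norm_eq_inner)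
  then show ?thesis by (simp add: penalty_def surface_integral_const)
qed

text \<open>Polarisation: a positive semidefinite symmetric form is bounded by its diagonal.\<close>

lemma penalty_le:
  assumes \<mu>: "\<mu> \<ge> 0" and u: "broken_C1 u" and w: "broken_C1 w"
  shows "\<bar>penalty \<mu> u w\<bar> \<le> \<mu> / 2 * ((\<Sum>e\<in>faces T. jump_energy u e) + (\<Sum>e\<in>faces T. jump_energy w e))"
proof -
  have nn: "penalty \<mu> v v \<ge> 0" if "broken_C1 v" for v
    unfolding penalty_eq[OF that] using \<mu> jump_energy_nonneg[OF _ that] by (intro mult_nonneg_nonneg sum_nonneg) auto
  have "penalty \<mu> (\<lambda>K x. t * u K x + w K x) (\<lambda>K x. t * u K x + w K x)
      = t * (t * penalty \<mu> u u + penalty \<mu> w u) + (t * penalty \<mu> u w + penalty \<mu> w w)" for t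
  proof -
    have v: "broken_C1 (\<lambda>K x. t * u K x + w K x)" by (rule broken_C1_comb[OF u w])
    show ?thesis
      unfolding penalty_comb_left[OF u w v] penalty_sym[of \<mu> _ "\<lambda>K x. t * u K x + w K x"]
        penalty_comb_left[OF u w u] penalty_comb_left[OF u w w] ..
  qed
  from this[of 1] this[of "-1"]
  have "0 \<le> penalty \<mu> u u + 2 * penalty \<mu> u w + penalty \<mu> w w" "0 \<le> penalty \<mu> u u - 2 * penalty \<mu> u w + penalty \<mu> w w"
    using nn[OF broken_C1_comb[OF u w, of 1]] nn[OF broken_C1_comb[OF u w, of "-1"]] penalty_sym[of \<mu> w u] by simp_all
  then show ?thesis unfolding penalty_eq[OF u] penalty_eq[OF w] by (simp add: abs_le_iff algebra_simps)
qed

text \<open>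
  A bound by the sum of the energies suffices: homogeneity turns it into a bound by the product of the
  energy norms (\<open>scaled_form_bound\<close>).
\<close>

lemma dg_form_bounded:
  assumes u: "broken_poly u" and w: "broken_poly w" and \<theta>: "\<theta> = -1 \<or> \<theta> = 1" and \<mu>: "\<mu> \<ge> 0"
  shows "\<bar>dg_form A \<theta> \<mu> T u w\<bar> \<le> (a1 + c5 + 1 + \<mu>) * (dg_energy u + dg_energy w)"
proof -
  define Gu Gw Ju Jw where "Gu = (\<Sum>K\<in>T. grad_energy u K)" and "Gw = (\<Sum>K\<in>T. grad_energy w K)"
    and "Ju = (\<Sum>e\<in>faces T. jump_energy u e)" and "Jw = (\<Sum>e\<in>faces T. jump_energy w e)"
  have nn: "Gu \<ge> 0" "Gw \<ge> 0" "Ju \<ge> 0" "Jw \<ge> 0"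
    unfolding Gu_def Gw_def Ju_def Jw_def
    using broken_poly_C1[OF u] broken_poly_C1[OF w] by (auto intro!: sum_nonneg grad_energy_nonneg jump_energy_nonneg)
  have "\<bar>diffusion A u w\<bar> \<le> a1 / 2 * (Gu + Gw)" using diffusion_le[OF u w] by (simp add: Gu_def Gw_def)
  moreover have "\<bar>consistency A u w\<bar> \<le> 1 / 2 * (c5 * Gu) + 1 / 2 * Jw"
    using consistency_le[OF u w, of 1] by (simp add: Gu_def Jw_def)
  moreover have "\<bar>consistency A w u\<bar> \<le> 1 / 2 * (c5 * Gw) + 1 / 2 * Ju"
    using consistency_le[OF w u, of 1] by (simp add: Gw_def Ju_def)
  moreover have "\<bar>penalty \<mu> u w\<bar> \<le> \<mu> / 2 * (Ju + Jw)"
    using penalty_le[OF \<mu> broken_poly_C1[OF u] broken_poly_C1[OF w]] by (simp add: Ju_def Jw_def)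
  moreover have "\<bar>dg_form A \<theta> \<mu> T u w\<bar> \<le> \<bar>diffusion A u w\<bar> + \<bar>consistency A u w\<bar> + \<bar>consistency A w u\<bar> + \<bar>penalty \<mu> u w\<bar>"
    unfolding dg_form_split using \<theta> by (elim disjE) simp_all
  ultimately have "\<bar>dg_form A \<theta> \<mu> T u w\<bar>
      \<le> a1 / 2 * (Gu + Gw) + (1 / 2 * (c5 * Gu) + 1 / 2 * Jw) + (1 / 2 * (c5 * Gw) + 1 / 2 * Ju) + \<mu> / 2 * (Ju + Jw)"
    by (meson add_mono order_trans)
  also have "\<dots> = a1 / 2 * (Gu + Gw) + (c5 / 2 * (Gu + Gw) + 1 / 2 * (Ju + Jw)) + \<mu> / 2 * (Ju + Jw)"
    by (simp add: field_simps)
  also have "\<dots> \<le> (a1 + c5 + 1 + \<mu>) * ((Gu + Gw) + (Ju + Jw))"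
  proof -
    have "a1 * (Gu + Gw) \<ge> 0" "c5 * (Gu + Gw) \<ge> 0" "\<mu> * (Gu + Gw) \<ge> 0" "a1 * (Ju + Jw) \<ge> 0" "c5 * (Ju + Jw) \<ge> 0" "\<mu> * (Ju + Jw) \<ge> 0"
      using nn a1(1) c5_nonneg \<mu> by simp_all
    then show ?thesis using nn unfolding distrib_right distrib_left by linarith
  qed
  finally show ?thesis by (simp add: dg_energy_def Gu_def Gw_def Ju_def Jw_def algebra_simps)
qed

lemma dg_form_coercive:
  assumes u: "broken_poly u" and \<theta>: "\<theta> = -1 \<or> \<theta> = 1" and \<mu>: "\<mu> > 0" "\<theta> = -1 \<Longrightarrow> \<mu> \<ge> 4 * (c5 + 1) / a0"
  shows "min (a0 / 2) (\<mu> / 2) * dg_energy u \<le> dg_form A \<theta> \<mu> T u u"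
proof -
  define G J where "G = (\<Sum>K\<in>T. grad_energy u K)" and "J = (\<Sum>e\<in>faces T. jump_energy u e)"
  have nn: "G \<ge> 0" "J \<ge> 0"
    unfolding G_def J_def using broken_poly_C1[OF u] by (auto intro!: sum_nonneg grad_energy_nonneg jump_energy_nonneg)
  have D: "a0 * G \<le> diffusion A u u" using diffusion_ge[OF u] by (simp add: G_def)
  have P: "penalty \<mu> u u = \<mu> * J" using penalty_eq[OF broken_poly_C1[OF u]] by (simp add: J_def)
  have "a0 / 2 * G + \<mu> / 2 * J \<le> dg_form A \<theta> \<mu> T u u"
    using \<theta>
  proof
    assume "\<theta> = 1"
    then have "dg_form A \<theta> \<mu> T u u = diffusion A u u + \<mu> * J" by (simp add: dg_form_split P)
    moreover have "a0 / 2 * G \<le> a0 * G" "\<mu> / 2 * J \<le> \<mu> * J" using nn a0(1) \<mu> by simp_all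
    ultimately show ?thesis using D by linarith
  next
    assume th: "\<theta> = -1"
    \<comment> \<open>Half of the diffusion absorbs the gradients; half of the penalty absorbs the jumps as soon as \<open>\<mu> / 2 \<ge> 1 / s\<close>, which is the threshold for \<open>\<mu>\<close>.\<close>
    define s where "s = a0 / (2 * (c5 + 1))"
    have s: "s > 0" using a0(1) c5_nonneg by (simp add: s_def)
    have "s * c5 \<le> s * (c5 + 1)" using s by simp
    also have "s * (c5 + 1) = a0 / 2"
    proof -
      have "a0 / (2 * k) * k = a0 / 2" if "k > 0" for k :: real using that by simp
      from this[of "c5 + 1"] show ?thesis using c5_nonneg by (simp only: s_def)
    qed
    finally have sc: "s * c5 * G \<le> a0 / 2 * G" using nn by (intro mult_right_mono)
    have "inverse s = 2 * (c5 + 1) / a0" by (simp add: s_def)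
    then have "inverse s \<le> \<mu> / 2" using \<mu>(2)[OF th] by (simp add: field_simps)
    then have si: "inverse s * J \<le> \<mu> / 2 * J" using nn by (intro mult_right_mono)
    have "2 * \<bar>consistency A u u\<bar> \<le> s * c5 * G + inverse s * J"
      using consistency_le[OF u u s] by (simp add: G_def J_def mult_ac)
    moreover have "dg_form A \<theta> \<mu> T u u = diffusion A u u - 2 * consistency A u u + \<mu> * J"
      by (simp add: dg_form_split P th)
    ultimately show ?thesis using D sc si by (simp add: abs_le_iff)
  qed
  moreover have "min (a0 / 2) (\<mu> / 2) * G \<le> a0 / 2 * G" "min (a0 / 2) (\<mu> / 2) * J \<le> \<mu> / 2 * J"
    using nn by (intro mult_right_mono; simp)+
  ultimately show ?thesis by (simp add: dg_energy_def G_def J_def distrib_left)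
qed

section \<open>Comparison of the reconstruction with piecewise constants\<close>

text \<open>
  Two broken functions that are close on the elements have comparable jumps. This is used in both
  directions, between a piecewise constant function and its reconstruction.
\<close>

lemma jump_energy_le:
  assumes u: "broken_poly u" and e: "e \<in> faces T" and w: "broken_poly w"
    and D: "\<And>K x. K \<in> adjacent T e \<Longrightarrow> x \<in> e \<Longrightarrow> (w K x - u K x)\<^sup>2 \<le> D K"
  shows "jump_energy w e \<le> 2 * jump_energy u e + 4 * ca * r ^ (CARD('d) - 2) * (\<Sum>K\<in>adjacent T e. D K)"
proof -
  obtain K0 where K0: "K0 \<in> adjacent T e" using e faces_iff by blast
  define z where "z = (\<lambda>K x. - 1 * u K x + w K x)"
  have uC: "broken_C1 u" "broken_C1 w" using u w broken_poly_C1 by auto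
  have zC: "broken_C1 z" unfolding z_def by (rule broken_C1_comb[OF uC])
  let ?d = "diameter e"
  have dr: "r \<le> ?d" by (rule facet_geometry(4)[OF K0])
  have dpos: "?d > 0" by (rule diameter_pos[OF K0])
  let ?S = "\<Sum>K\<in>adjacent T e. D K"
  have ex: "e \<noteq> {}" by (rule facet_facts(3)[OF K0])
  have S0: "?S \<ge> 0"
  proof (rule sum_nonneg)
    fix K assume "K \<in> adjacent T e"
    then show "0 \<le> D K" using D ex by (meson all_not_in_conv order_trans zero_le_power2)
  qed
  have split: "(norm (jump T e w x))\<^sup>2 \<le> 2 * (norm (jump T e u x))\<^sup>2 + 2 * (norm (jump T e z x))\<^sup>2" for x
  proof -
    have "jump T e w x = jump T e u x + jump T e z x"
      using jump_add[of e u z x] by (simp add: z_def)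
    then have "norm (jump T e w x) \<le> norm (jump T e u x) + norm (jump T e z x)" by (simp add: norm_triangle_ineq)
    then have "(norm (jump T e w x))\<^sup>2 \<le> (norm (jump T e u x) + norm (jump T e z x))\<^sup>2" by (rule power_mono) simp
    also have "\<dots> \<le> 2 * (norm (jump T e u x))\<^sup>2 + 2 * (norm (jump T e z x))\<^sup>2"
      using sum_squares_bound[of "norm (jump T e u x)" "norm (jump T e z x)"] by (simp add: power2_sum)
    finally show ?thesis .
  qed
  have cz: "continuous_on UNIV (\<lambda>x. 2 * (inverse ?d * (norm (jump T e z x))\<^sup>2))"
    and cu: "continuous_on UNIV (\<lambda>x. inverse ?d * (norm (jump T e u x))\<^sup>2)"
    and cw: "continuous_on UNIV (\<lambda>x. inverse ?d * (norm (jump T e w x))\<^sup>2)"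
    by (intro continuous_intros continuous_jump zC uC)+
  have "jump_energy w e \<le> surface_integral e (\<lambda>x. 2 * (inverse ?d * (norm (jump T e u x))\<^sup>2) + 2 * (inverse ?d * (norm (jump T e z x))\<^sup>2))"
    unfolding jump_energy_def
  proof (rule surface_integral_mono[OF K0 cw])
    show "continuous_on UNIV (\<lambda>x. 2 * (inverse ?d * (norm (jump T e u x))\<^sup>2) + 2 * (inverse ?d * (norm (jump T e z x))\<^sup>2))"
      by (intro continuous_on_add continuous_on_mult continuous_on_const cu cz)
    show "inverse ?d * (norm (jump T e w x))\<^sup>2 \<le> 2 * (inverse ?d * (norm (jump T e u x))\<^sup>2) + 2 * (inverse ?d * (norm (jump T e z x))\<^sup>2)" for x
      using mult_left_mono[OF split[of x], of "inverse ?d"] dpos by (simp add: distrib_left mult.left_commute)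
  qed
  also have "\<dots> = 2 * jump_energy u e + surface_integral e (\<lambda>x. 2 * (inverse ?d * (norm (jump T e z x))\<^sup>2))"
    unfolding jump_energy_def by (rule surface_integral_comb[OF K0 cu cz])
  also have "surface_integral e (\<lambda>x. 2 * (inverse ?d * (norm (jump T e z x))\<^sup>2)) \<le> ca * (4 * (r ^ (CARD('d) - 2) * ?S))"
  proof (rule facet_bound_scale[OF K0 cz])
    show "0 \<le> 4 * (r ^ (CARD('d) - 2) * ?S)" using S0 r_pos by simp
    fix x assume x: "x \<in> e"
    have "(norm (jump T e z x))\<^sup>2 \<le> 2 * (\<Sum>K\<in>adjacent T e. (z K x)\<^sup>2)" by (rule norm_jump_le)
    also have "\<dots> \<le> 2 * ?S" using D x by (intro mult_left_mono sum_mono) (auto simp: z_def)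
    finally have jz: "(norm (jump T e z x))\<^sup>2 \<le> 2 * ?S" .
    have "r ^ (CARD('d) - 1) * (2 * (inverse ?d * (norm (jump T e z x))\<^sup>2)) = 2 * r ^ (CARD('d) - 2) * ((r * inverse ?d) * (norm (jump T e z x))\<^sup>2)"
      unfolding r_power(3) by (simp only: mult_ac)
    also have "\<dots> \<le> 2 * r ^ (CARD('d) - 2) * (1 * (2 * ?S))"
    proof (intro mult_left_mono mult_mono jz)
      show "r * inverse ?d \<le> 1" using dr dpos by (simp add: field_simps)
    qed (use r_pos S0 in auto)
    finally show "r ^ (CARD('d) - 1) * (2 * (inverse ?d * (norm (jump T e z x))\<^sup>2)) \<le> 4 * (r ^ (CARD('d) - 2) * ?S)"
      by (simp add: mult.assoc)
  qed
  finally show ?thesis by (simp add: mult_ac)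
qed

lemma broken_poly_const: "broken_poly (piecewise_const v)"
  by (simp add: broken_poly_def piecewise_const_def poly_space_const)

lemma sum_jump_energy_le:
  assumes u: "broken_poly u" and w: "broken_poly w"
    and D: "\<And>K x. K \<in> T \<Longrightarrow> x \<in> K \<Longrightarrow> (w K x - u K x)\<^sup>2 \<le> D K"
  shows "(\<Sum>e\<in>faces T. jump_energy w e) \<le> 2 * (\<Sum>e\<in>faces T. jump_energy u e)
    + 4 * ca * (real CARD('d) + 1) * (r ^ (CARD('d) - 2) * (\<Sum>K\<in>T. D K))"
proof -
  have D0: "D K \<ge> 0" if "K \<in> T" for K
  proof -
    from element_facts(8)[OF that] obtain x where "x \<in> K" by blast
    from D[OF that this] show ?thesis by (meson order_trans zero_le_power2)
  qed
  have "(\<Sum>e\<in>faces T. jump_energy w e) \<le> (\<Sum>e\<in>faces T. 2 * jump_energy u e + 4 * ca * r ^ (CARD('d) - 2) * (\<Sum>K\<in>adjacent T e. D K))"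
  proof (rule sum_mono)
    fix e assume e: "e \<in> faces T"
    show "jump_energy w e \<le> 2 * jump_energy u e + 4 * ca * r ^ (CARD('d) - 2) * (\<Sum>K\<in>adjacent T e. D K)"
    proof (rule jump_energy_le[OF u e w])
      fix K x assume K: "K \<in> adjacent T e" and "x \<in> e"
      then have "x \<in> K" using facet_facts(2)[OF K] by blast
      then show "(w K x - u K x)\<^sup>2 \<le> D K" by (rule D[OF adjacentD(1)[OF K]])
    qed
  qed
  also have "\<dots> = 2 * (\<Sum>e\<in>faces T. jump_energy u e) + 4 * ca * r ^ (CARD('d) - 2) * (\<Sum>e\<in>faces T. \<Sum>K\<in>adjacent T e. D K)"
    by (simp only: sum.distrib sum_distrib_left)
  also have "\<dots> \<le> 2 * (\<Sum>e\<in>faces T. jump_energy u e) + 4 * ca * r ^ (CARD('d) - 2) * ((real CARD('d) + 1) * (\<Sum>K\<in>T. D K))"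
    using ca_nonneg r_pos D0 by (intro add_left_mono mult_left_mono sum_faces_adjacent_le) auto
  finally show ?thesis by (simp only: mult_ac)
qed

text \<open>
  On an element, the reconstruction differs from its value at the barycenter by at most \<open>h\<close> times
  the largest gradient, which the inverse inequality bounds by the gradient energy.
\<close>

lemma const_energy_le:
  assumes u: "broken_poly u" and v: "\<And>K. K \<in> T \<Longrightarrow> u K (barycenter K) = v K"
  shows "(\<Sum>e\<in>faces T. jump_energy (piecewise_const v) e)
    \<le> (2 + 4 * ca * (real CARD('d) + 1) * (4 * C\<sigma>\<^sup>2 * C1)) * dg_energy u"
proof -
  \<comment> \<open>The squared diameter times the inverse estimate of the squared gradient.\<close>
  define D where "D K = h\<^sup>2 * (C1 * grad_energy u K / r ^ CARD('d))" for K
  have rp: "r ^ CARD('d) > 0" using r_pos by simp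
  have D: "(piecewise_const v K x - u K x)\<^sup>2 \<le> D K" if K: "K \<in> T" and x: "x \<in> K" for K x
  proof -
    let ?b = "sqrt (C1 * grad_energy u K / r ^ CARD('d))"
    have q0: "0 \<le> C1 * grad_energy u K / r ^ CARD('d)" using C1 grad_energy_nonneg rp by simp
    have g: "norm (grad (u K) z) \<le> ?b" if "z \<in> K" for z
      using grad_inverse_element[OF K u that] rp
      by (intro real_le_rsqrt) (simp add: pos_le_divide_eq mult.commute)
    have "\<bar>u K (barycenter K) - u K x\<bar> \<le> ?b * norm (barycenter K - x)"
      using u K by (intro C1_fun_lipschitz[OF C1_fun_poly element_facts(1)[OF K] barycenter_in_element[OF K] x g])
        (auto simp: broken_poly_def)
    also have "\<dots> \<le> ?b * h"
      using dist_element_le[OF K barycenter_in_element[OF K] x] q0 by (intro mult_left_mono) (auto simp: dist_norm)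
    finally have "\<bar>piecewise_const v K x - u K x\<bar> \<le> ?b * h" using v[OF K] by (simp add: piecewise_const_def)
    then have "\<bar>piecewise_const v K x - u K x\<bar>\<^sup>2 \<le> (?b * h)\<^sup>2" by (rule power_mono) simp
    then show ?thesis using q0 by (simp add: D_def power_mult_distrib mult.commute)
  qed
  have "r ^ (CARD('d) - 2) * D K = 4 * C\<sigma>\<^sup>2 * C1 * grad_energy u K" for K
  proof -
    have "r ^ (CARD('d) - 2) * D K = (r\<^sup>2 * r ^ (CARD('d) - 2)) / r ^ CARD('d) * ((2 * C\<sigma>)\<^sup>2 * (C1 * grad_energy u K))"
      by (simp add: D_def h_eq power_mult_distrib)
    also have "(r\<^sup>2 * r ^ (CARD('d) - 2)) / r ^ CARD('d) = 1" using r_pos unfolding r_power(2)[symmetric] by simp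
    finally show ?thesis by (simp add: power_mult_distrib)
  qed
  then have S: "r ^ (CARD('d) - 2) * (\<Sum>K\<in>T. D K) = 4 * C\<sigma>\<^sup>2 * C1 * (\<Sum>K\<in>T. grad_energy u K)"
    by (simp add: sum_distrib_left)
  let ?J = "\<Sum>e\<in>faces T. jump_energy u e" and ?G = "\<Sum>K\<in>T. grad_energy u K" and ?c = "4 * ca * (real CARD('d) + 1) * (4 * C\<sigma>\<^sup>2 * C1)"
  have nn: "?G \<ge> 0" "?J \<ge> 0" "?c \<ge> 0"
    using broken_poly_C1[OF u] ca_nonneg C1 by (auto intro!: sum_nonneg grad_energy_nonneg jump_energy_nonneg mult_nonneg_nonneg)
  have "(\<Sum>e\<in>faces T. jump_energy (piecewise_const v) e) \<le> 2 * ?J + 4 * ca * (real CARD('d) + 1) * (r ^ (CARD('d) - 2) * (\<Sum>K\<in>T. D K))"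
    by (rule sum_jump_energy_le[OF u broken_poly_const D])
  also have "\<dots> = 2 * ?J + ?c * ?G" unfolding S by (simp add: mult_ac)
  also have "\<dots> \<le> (2 + ?c) * (?G + ?J)"
    using nn mult_nonneg_nonneg[OF nn(3,2)] by (simp add: distrib_left distrib_right)
  finally show ?thesis by (simp add: dg_energy_def)
qed

text \<open>
  The gradient of \<open>u\<close> is that of \<open>u - v K\<close>, so the inverse inequality and the stability of the
  reconstruction bound both parts of the energy by differences of values in the patch, and the
  discrete Poincare inequality bounds these by jumps.
\<close>

lemma reconstruction_energy_le:
  assumes u: "\<And>K. K \<in> T \<Longrightarrow> reconstructs K v (u K)"
  shows "dg_energy u \<le> ((unit_ball_vol CARD('d) * (2 * C\<sigma>) ^ CARD('d) * C2\<^sup>2 + 4 * ca * (real CARD('d) + 1))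
      * (8 * C\<sigma> / unit_ball_vol CARD('d) * near_bound nS ^ 6) + 2)
    * (Lambda_bar T nS m)\<^sup>2 * (\<Sum>e\<in>faces T. jump_energy (piecewise_const v) e)"
proof -
  let ?L = "Lambda_bar T nS m" and ?\<omega> = "unit_ball_vol (real CARD('d))"
  let ?J = "\<Sum>e\<in>faces T. jump_energy (piecewise_const v) e"
  define D0 where "D0 K = (\<Sum>K'\<in>patch T nS K. (v K' - v K)\<^sup>2)" for K
  define D where "D K = ?L\<^sup>2 * D0 K" for K
  define \<Sigma> where "\<Sigma> = r ^ (CARD('d) - 2) * (\<Sum>K\<in>T. D0 K)"
  have D00: "D0 K \<ge> 0" for K unfolding D0_def by (intro sum_nonneg) simp
  have D_nn: "D K \<ge> 0" for K unfolding D_def using D00 by simp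
  have \<Sigma>0: "\<Sigma> \<ge> 0" unfolding \<Sigma>_def using r_pos D00 by (simp add: sum_nonneg)
  have up: "broken_poly u" using u by (auto simp: broken_poly_def reconstructs_def)
  have \<omega>: "?\<omega> > 0" by simp
  have J0: "?J \<ge> 0" by (intro sum_nonneg jump_energy_nonneg broken_C1_const)
  have diff: "(u K x - v K)\<^sup>2 \<le> D K" if "K \<in> T" "x \<in> K" for K x
    unfolding D_def D0_def
    by (rule reconstruction_stable[OF that(1) u[OF that(1)]]) (use that patch_mesh(2)[OF that(1)] in blast)
  have G: "grad_energy u K \<le> ?\<omega> * (2 * C\<sigma>) ^ CARD('d) * C2\<^sup>2 * (r ^ (CARD('d) - 2) * D K)" if K: "K \<in> T" for K
  proof -
    define q where "q = (\<lambda>x. 1 * u K x + - v K)"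
    have uK: "u K \<in> poly_space m" using up K by (simp add: broken_poly_def)
    have q: "q \<in> poly_space m" unfolding q_def by (intro poly_space_comb poly_space_const uK)
    have C1u: "C1_fun (u K)" by (rule C1_fun_poly[OF uK])
    have gq: "grad (u K) x = grad q x" for x
      unfolding q_def grad_comb[OF C1u C1_fun_const] using grad_eq[OF GDERIV_const, of "- v K" x] by simp
    obtain c where c: "cball c r \<subseteq> K" "K \<subseteq> cball c (2 * C\<sigma> * r)" by (rule element_between_balls[OF K]) (rule that)
    have "(norm (grad (u K) x))\<^sup>2 \<le> C2\<^sup>2 * D K / r\<^sup>2" if x: "x \<in> K" for x
    proof -
      have "\<bar>q y\<bar> \<le> sqrt (D K)" if "y \<in> cball c r" for y
        using diff[OF K, of y] that c(1) by (intro real_le_rsqrt) (auto simp: q_def)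
      then have "r * norm (grad q x) \<le> C2 * sqrt (D K)"
        using x c(2) by (intro inverse_sup[OF q r_pos]) auto
      then have "(r * norm (grad q x))\<^sup>2 \<le> (C2 * sqrt (D K))\<^sup>2" using r_pos by (intro power_mono) auto
      then have "r\<^sup>2 * (norm (grad q x))\<^sup>2 \<le> C2\<^sup>2 * D K" using D_nn by (simp add: power_mult_distrib)
      then show ?thesis using r_pos by (simp add: gq pos_le_divide_eq mult.commute)
    qed
    then have "grad_energy u K \<le> (LINT x:K|lborel. C2\<^sup>2 * D K / r\<^sup>2)"
      unfolding grad_energy_def
    proof (intro set_integral_mono)
      have "continuous_on UNIV (grad (u K))" using C1u by (simp add: C1_fun_def)
      then show "set_integrable lborel K (\<lambda>x. (norm (grad (u K) x))\<^sup>2)"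
        by (intro element_integrable[OF K] continuous_on_power continuous_on_norm)
    qed (rule element_integrable[OF K continuous_on_const])
    also have "\<dots> = measure lborel K * (C2\<^sup>2 * D K / r\<^sup>2)" by (simp add: set_lebesgue_integral_def)
    also have "\<dots> \<le> (?\<omega> * h ^ CARD('d)) * (C2\<^sup>2 * D K / r\<^sup>2)"
      using element_volume_le[OF K] D_nn by (intro mult_right_mono) auto
    also have "\<dots> = ?\<omega> * (2 * C\<sigma>) ^ CARD('d) * C2\<^sup>2 * ((r\<^sup>2 * r ^ (CARD('d) - 2)) / r\<^sup>2 * D K)"
      unfolding h_eq power_mult_distrib[of "2 * C\<sigma>" r] r_power(2) by simp
    also have "(r\<^sup>2 * r ^ (CARD('d) - 2)) / r\<^sup>2 = r ^ (CARD('d) - 2)" using r_pos by simp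
    finally show ?thesis .
  qed
  have DS: "r ^ (CARD('d) - 2) * (\<Sum>K\<in>T. D K) = ?L\<^sup>2 * \<Sigma>"
    by (simp add: D_def \<Sigma>_def sum_distrib_left[symmetric] mult.left_commute)
  have "(\<Sum>K\<in>T. grad_energy u K) \<le> (\<Sum>K\<in>T. ?\<omega> * (2 * C\<sigma>) ^ CARD('d) * C2\<^sup>2 * (r ^ (CARD('d) - 2) * D K))"
    by (rule sum_mono[OF G])
  also have "\<dots> = ?\<omega> * (2 * C\<sigma>) ^ CARD('d) * C2\<^sup>2 * (?L\<^sup>2 * \<Sigma>)"
    unfolding DS[symmetric] by (simp only: sum_distrib_left)
  finally have GG: "(\<Sum>K\<in>T. grad_energy u K) \<le> ?\<omega> * (2 * C\<sigma>) ^ CARD('d) * C2\<^sup>2 * (?L\<^sup>2 * \<Sigma>)" .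
  have "(\<Sum>e\<in>faces T. jump_energy u e) \<le> 2 * ?J + 4 * ca * (real CARD('d) + 1) * (r ^ (CARD('d) - 2) * (\<Sum>K\<in>T. D K))"
    by (rule sum_jump_energy_le[OF broken_poly_const up]) (simp add: piecewise_const_def diff)
  then have JJ: "(\<Sum>e\<in>faces T. jump_energy u e) \<le> 2 * ?J + 4 * ca * (real CARD('d) + 1) * (?L\<^sup>2 * \<Sigma>)"
    unfolding DS .
  have sj: "r ^ (CARD('d) - 2) * sq_jump v e \<le> 4 * C\<sigma> / ?\<omega> * jump_energy (piecewise_const v) e" if e: "e \<in> faces T" for e
  proof -
    obtain K where K: "K \<in> adjacent T e" using e faces_iff by blast
    have dpos: "diameter e > 0" by (rule diameter_pos[OF K])
    have d: "diameter e \<le> 2 * C\<sigma> * r" using facet_geometry(5)[OF K] h_eq by simp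
    have "?\<omega> / 2 * (r * r ^ (CARD('d) - 2)) \<le> area e" using facet_geometry(2)[OF K] unfolding r_power(3) .
    then have ar: "r * r ^ (CARD('d) - 2) \<le> 2 / ?\<omega> * area e" using \<omega> by (simp add: field_simps)
    have "diameter e * r ^ (CARD('d) - 2) \<le> (2 * C\<sigma> * r) * r ^ (CARD('d) - 2)"
      using d r_pos by (intro mult_right_mono) auto
    also have "\<dots> = 2 * C\<sigma> * (r * r ^ (CARD('d) - 2))" by (simp add: mult_ac)
    also have "\<dots> \<le> 2 * C\<sigma> * (2 / ?\<omega> * area e)" using ar C\<sigma> by (intro mult_left_mono) auto
    finally have "r ^ (CARD('d) - 2) \<le> inverse (diameter e) * (4 * C\<sigma> / ?\<omega> * area e)"
      using dpos by (simp add: field_simps)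
    then have "r ^ (CARD('d) - 2) * sq_jump v e \<le> inverse (diameter e) * (4 * C\<sigma> / ?\<omega> * area e) * sq_jump v e"
      using sq_jump_nonneg by (rule mult_right_mono)
    then show ?thesis by (simp add: jump_energy_const mult_ac)
  qed
  have "\<Sigma> \<le> r ^ (CARD('d) - 2) * (2 * near_bound nS ^ 6 * (\<Sum>e\<in>faces T. sq_jump v e))"
    unfolding \<Sigma>_def D0_def using r_pos patch_stops
    by (intro mult_left_mono sum_patch_differences_le) auto
  also have "\<dots> = 2 * near_bound nS ^ 6 * (\<Sum>e\<in>faces T. r ^ (CARD('d) - 2) * sq_jump v e)"
    unfolding sum_distrib_left by (simp only: mult_ac)
  also have "\<dots> \<le> 2 * near_bound nS ^ 6 * (\<Sum>e\<in>faces T. 4 * C\<sigma> / ?\<omega> * jump_energy (piecewise_const v) e)"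
    using near_bound_ge_1[of nS] by (intro mult_left_mono sum_mono sj) auto
  also have "\<dots> = 8 * C\<sigma> / ?\<omega> * near_bound nS ^ 6 * ?J"
    by (simp only: sum_distrib_left[symmetric]) (simp add: mult_ac)
  finally have \<Sigma>J: "\<Sigma> \<le> 8 * C\<sigma> / ?\<omega> * near_bound nS ^ 6 * ?J" .
  let ?c = "?\<omega> * (2 * C\<sigma>) ^ CARD('d) * C2\<^sup>2 + 4 * ca * (real CARD('d) + 1)"
  have c0: "?c \<ge> 0" using C\<sigma> ca_nonneg \<omega> by simp
  have L1: "?L\<^sup>2 \<ge> 1" using Lambda_bar_ge_1 by simp
  have "dg_energy u \<le> ?c * (?L\<^sup>2 * \<Sigma>) + 2 * ?J"
    using GG JJ by (simp add: dg_energy_def distrib_right)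
  also have "\<dots> \<le> ?c * (?L\<^sup>2 * (8 * C\<sigma> / ?\<omega> * near_bound nS ^ 6 * ?J)) + 2 * (?L\<^sup>2 * ?J)"
  proof (intro add_mono mult_left_mono c0 \<Sigma>J)
    show "?J \<le> ?L\<^sup>2 * ?J" using mult_right_mono[OF L1 J0] by simp
  qed auto
  also have "\<dots> = (?c * (8 * C\<sigma> / ?\<omega> * near_bound nS ^ 6) + 2) * ?L\<^sup>2 * ?J"
  proof -
    have "c * (L * (k * J)) + 2 * (L * J) = (c * k + 2) * L * J" for c L k J :: real
      by (simp add: algebra_simps)
    then show ?thesis .
  qed
  finally show ?thesis .
qed

end

section \<open>Condition numbers from form bounds\<close>

lemma injective_mat_inverse:
  fixes X :: "real Matrix.mat"
  assumes X: "X \<in> carrier_mat n n" and inj: "\<And>v. v \<in> carrier_vec n \<Longrightarrow> X *\<^sub>v v = 0\<^sub>v n \<Longrightarrow> v = 0\<^sub>v n"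
  shows "the (mat_inverse X) \<in> carrier_mat n n" "X * the (mat_inverse X) = 1\<^sub>m n" "the (mat_inverse X) * X = 1\<^sub>m n"
    "invertible_mat X"
proof -
  have "Determinant.det X \<noteq> 0" using det_0_iff_vec_prod_zero_field[OF X] inj by blast
  then have "X \<in> Units (ring_mat TYPE(real) n ())" by (rule det_non_zero_imp_unit[OF X])
  then have "mat_inverse X \<noteq> None" using mat_inverse(1)[OF X, where b = "()"] by blast
  then obtain Y where Y: "mat_inverse X = Some Y" by blast
  then have Y': "X * Y = 1\<^sub>m n" "Y * X = 1\<^sub>m n" "Y \<in> carrier_mat n n" using mat_inverse(2)[OF X] by auto
  then show "the (mat_inverse X) \<in> carrier_mat n n" "X * the (mat_inverse X) = 1\<^sub>m n" "the (mat_inverse X) * X = 1\<^sub>m n"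
    using Y by simp_all
  show "invertible_mat X"
    unfolding invertible_mat_def inverts_mat_def using X Y' by (auto intro!: exI[of _ Y])
qed

text \<open>
  Both arguments are scaled to energy norm one.
\<close>

lemma scaled_form_bound:
  fixes X A0 :: "real Matrix.mat"
  assumes X: "X \<in> carrier_mat n n" and A0: "A0 \<in> carrier_mat n n"
    and pd: "\<And>v. v \<in> carrier_vec n \<Longrightarrow> v \<noteq> 0\<^sub>v n \<Longrightarrow> scalar_prod v (A0 *\<^sub>v v) > 0"
    and b: "\<And>v w. v \<in> carrier_vec n \<Longrightarrow> w \<in> carrier_vec n \<Longrightarrow>
      scalar_prod v (X *\<^sub>v w) \<le> c * (scalar_prod v (A0 *\<^sub>v v) + scalar_prod w (A0 *\<^sub>v w))"
    and v: "v \<in> carrier_vec n" and w: "w \<in> carrier_vec n"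
  shows "scalar_prod v (X *\<^sub>v w) \<le> 2 * c * energy_norm A0 v * energy_norm A0 w"
proof (cases "v = 0\<^sub>v n \<or> w = 0\<^sub>v n")
  case True
  have 0: "X *\<^sub>v 0\<^sub>v n = 0\<^sub>v n" "A0 *\<^sub>v 0\<^sub>v n = 0\<^sub>v n" using X A0 by auto
  have "scalar_prod v (X *\<^sub>v w) = 0"
    using True 0 X v w by (auto simp: mult_mat_vec_carrier)
  moreover have "energy_norm A0 v = 0 \<or> energy_norm A0 w = 0"
    using True 0 by (auto simp: energy_norm_def)
  ultimately show ?thesis by auto
next
  case False
  define a where "a = energy_norm A0 v"
  define e where "e = energy_norm A0 w"
  have qa: "scalar_prod v (A0 *\<^sub>v v) = a\<^sup>2" "a > 0" and qe: "scalar_prod w (A0 *\<^sub>v w) = e\<^sup>2" "e > 0"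
    using pd[OF v] pd[OF w] False by (auto simp: a_def e_def energy_norm_def less_imp_le)
  have sc: "scalar_prod (s \<cdot>\<^sub>v x) (Y *\<^sub>v (t \<cdot>\<^sub>v y)) = s * t * scalar_prod x (Y *\<^sub>v y)"
    if "Y \<in> carrier_mat n n" "x \<in> carrier_vec n" "y \<in> carrier_vec n" for s t x y and Y :: "real Matrix.mat"
  proof -
    have "Y *\<^sub>v y \<in> carrier_vec n" using that by (simp add: mult_mat_vec_carrier)
    then show ?thesis using that by (simp add: mult_mat_vec)
  qed
  define v' where "v' = (1 / a) \<cdot>\<^sub>v v"
  define w' where "w' = (1 / e) \<cdot>\<^sub>v w"
  have c: "v' \<in> carrier_vec n" "w' \<in> carrier_vec n" using v w by (auto simp: v'_def w'_def)
  have "scalar_prod v' (A0 *\<^sub>v v') = 1" "scalar_prod w' (A0 *\<^sub>v w') = 1"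
    unfolding v'_def w'_def sc[OF A0 v v] sc[OF A0 w w] qa(1) qe(1)
    using qa(2) qe(2) by (simp_all add: power2_eq_square)
  then have "scalar_prod v' (X *\<^sub>v w') \<le> 2 * c" using b[OF c] by simp
  then have "1 / a * (1 / e) * scalar_prod v (X *\<^sub>v w) \<le> 2 * c" unfolding v'_def w'_def sc[OF X v w] .
  then show ?thesis using qa(2) qe(2) by (simp add: a_def[symmetric] e_def[symmetric] field_simps)
qed

text \<open>
  With \<open>B = A\<^sub>0\<^sup>-\<^sup>1 M\<close> the identity \<open>A\<^sub>0 B v = M v\<close> gives \<open>\<parallel>B v\<parallel>\<^sup>2 = (B v)\<^sup>T M v \<le> 2 c \<parallel>B v\<parallel> \<parallel>v\<parallel>\<close> and, by coercivity,
  \<open>k \<parallel>v\<parallel>\<^sup>2 \<le> v\<^sup>T A\<^sub>0 B v \<le> \<parallel>v\<parallel> \<parallel>B v\<parallel>\<close> in the energy norm of \<open>A\<^sub>0\<close>.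
\<close>

lemma condition_number_le:
  fixes A0 M :: "real Matrix.mat"
  assumes A0: "A0 \<in> carrier_mat n n" and M: "M \<in> carrier_mat n n" and n: "n > 0"
    and sym: "\<And>v w. v \<in> carrier_vec n \<Longrightarrow> w \<in> carrier_vec n \<Longrightarrow> scalar_prod v (A0 *\<^sub>v w) = scalar_prod w (A0 *\<^sub>v v)"
    and pd: "\<And>v. v \<in> carrier_vec n \<Longrightarrow> v \<noteq> 0\<^sub>v n \<Longrightarrow> scalar_prod v (A0 *\<^sub>v v) > 0"
    and bound: "\<And>v w. v \<in> carrier_vec n \<Longrightarrow> w \<in> carrier_vec n \<Longrightarrow>
      scalar_prod v (M *\<^sub>v w) \<le> c * (scalar_prod v (A0 *\<^sub>v v) + scalar_prod w (A0 *\<^sub>v w))"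
    and coer: "\<And>v. v \<in> carrier_vec n \<Longrightarrow> k * scalar_prod v (A0 *\<^sub>v v) \<le> scalar_prod v (M *\<^sub>v v)" and k: "k > 0"
  shows "invertible_mat A0" "invertible_mat (preconditioned A0 M)" "condition_number A0 (preconditioned A0 M) \<le> 2 * c / k"
proof -
  let ?E = "energy_norm A0" and ?B = "preconditioned A0 M"
  have E0: "?E v \<ge> 0" if "v \<in> carrier_vec n" for v
    using pd[OF that] A0 that by (cases "v = 0\<^sub>v n") (auto simp: energy_norm_def less_imp_le)
  have Epos: "?E v > 0" if "v \<in> carrier_vec n" "v \<noteq> 0\<^sub>v n" for v using pd[OF that] by (simp add: energy_norm_def)
  have E2: "scalar_prod v (A0 *\<^sub>v v) = (?E v)\<^sup>2" if "v \<in> carrier_vec n" for v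
    using pd[OF that] A0 that by (cases "v = 0\<^sub>v n") (auto simp: energy_norm_def less_imp_le)
  have injA: "v = 0\<^sub>v n" if "v \<in> carrier_vec n" "A0 *\<^sub>v v = 0\<^sub>v n" for v
    using pd[OF that(1)] that by (metis less_irrefl scalar_prod_right_zero)
  note invA = injective_mat_inverse[OF A0 injA]
  show "invertible_mat A0" by (rule invA(4))
  have B: "?B \<in> carrier_mat n n" using invA(1) M by (simp add: preconditioned_def)
  have A0B: "A0 *\<^sub>v (?B *\<^sub>v v) = M *\<^sub>v v" if v: "v \<in> carrier_vec n" for v
  proof -
    have "A0 *\<^sub>v (?B *\<^sub>v v) = (A0 * ?B) *\<^sub>v v" using assoc_mult_mat_vec[OF A0 B v] by simp
    also have "A0 * ?B = (A0 * the (mat_inverse A0)) * M"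
      unfolding preconditioned_def using assoc_mult_mat[OF A0 invA(1) M] by simp
    also have "\<dots> = M" using invA(2) M by simp
    finally show ?thesis .
  qed
  have Bc: "?B *\<^sub>v v \<in> carrier_vec n" if "v \<in> carrier_vec n" for v using B that by (rule mult_mat_vec_carrier)
  have Mb: "scalar_prod v (M *\<^sub>v w) \<le> 2 * c * ?E v * ?E w" if "v \<in> carrier_vec n" "w \<in> carrier_vec n" for v w
    by (rule scaled_form_bound[OF M A0 pd bound that])
  have CS: "scalar_prod v (A0 *\<^sub>v w) \<le> ?E v * ?E w" if v: "v \<in> carrier_vec n" and w: "w \<in> carrier_vec n" for v w
  proof -
    have "scalar_prod v (A0 *\<^sub>v w) \<le> 1 / 2 * (scalar_prod v (A0 *\<^sub>v v) + scalar_prod w (A0 *\<^sub>v w))"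
      if v: "v \<in> carrier_vec n" and w: "w \<in> carrier_vec n" for v w
    proof -
      \<comment> \<open>The quadratic form is nonnegative at \<open>v - w\<close>.\<close>
      define z where "z = v + (-1) \<cdot>\<^sub>v w"
      have wc: "(-1) \<cdot>\<^sub>v w \<in> carrier_vec n" using w by simp
      have z: "z \<in> carrier_vec n" using v w by (simp add: z_def)
      have Ac: "A0 *\<^sub>v v \<in> carrier_vec n" "A0 *\<^sub>v w \<in> carrier_vec n" using A0 v w by (auto intro: mult_mat_vec_carrier)
      have Az: "A0 *\<^sub>v z = A0 *\<^sub>v v + (-1) \<cdot>\<^sub>v (A0 *\<^sub>v w)"
        unfolding z_def using mult_add_distrib_mat_vec[OF A0 v wc] mult_mat_vec[OF A0 w] by simp
      have lin: "scalar_prod x (A0 *\<^sub>v z) = scalar_prod x (A0 *\<^sub>v v) - scalar_prod x (A0 *\<^sub>v w)" if x: "x \<in> carrier_vec n" for x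
        unfolding Az using scalar_prod_add_distrib[OF x Ac(1), of "(-1) \<cdot>\<^sub>v (A0 *\<^sub>v w)"] Ac x by simp
      have "0 \<le> scalar_prod z (A0 *\<^sub>v z)" using E2[OF z] by simp
      also have "\<dots> = scalar_prod z (A0 *\<^sub>v v) - scalar_prod z (A0 *\<^sub>v w)" by (rule lin[OF z])
      also have "scalar_prod z (A0 *\<^sub>v v) = scalar_prod v (A0 *\<^sub>v v) - scalar_prod v (A0 *\<^sub>v w)"
        using sym[OF z v] lin[OF v] by simp
      also have "scalar_prod z (A0 *\<^sub>v w) = scalar_prod w (A0 *\<^sub>v v) - scalar_prod w (A0 *\<^sub>v w)"
        using sym[OF z w] lin[OF w] by simp
      also have "scalar_prod w (A0 *\<^sub>v v) = scalar_prod v (A0 *\<^sub>v w)" by (rule sym[OF w v])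
      finally show ?thesis by simp
    qed
    from scaled_form_bound[OF A0 A0 pd this v w] show ?thesis by simp
  qed
  have up: "?E (?B *\<^sub>v w) \<le> 2 * c * ?E w" if w: "w \<in> carrier_vec n" for w
  proof (cases "?B *\<^sub>v w = 0\<^sub>v n")
    case True
    have "0 \<le> k * scalar_prod w (A0 *\<^sub>v w)" unfolding E2[OF w] using k by simp
    also have "\<dots> \<le> scalar_prod w (M *\<^sub>v w)" by (rule coer[OF w])
    also have "\<dots> \<le> 2 * c * ?E w * ?E w" by (rule Mb[OF w w])
    finally have c0: "0 \<le> 2 * c * ?E w * ?E w" .
    have "2 * c * ?E w \<ge> 0"
      using c0 E0[OF w] by (cases "?E w = 0") (auto simp: zero_le_mult_iff)
    then show ?thesis using True A0 by (simp add: energy_norm_def)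
  next
    case False
    have pos: "?E (?B *\<^sub>v w) > 0" by (rule Epos[OF Bc[OF w] False])
    have "(?E (?B *\<^sub>v w))\<^sup>2 = scalar_prod (?B *\<^sub>v w) (M *\<^sub>v w)" using E2[OF Bc[OF w]] A0B[OF w] by simp
    also have "\<dots> \<le> 2 * c * ?E (?B *\<^sub>v w) * ?E w" by (rule Mb[OF Bc[OF w] w])
    finally have "?E (?B *\<^sub>v w) * ?E (?B *\<^sub>v w) \<le> ?E (?B *\<^sub>v w) * (2 * c * ?E w)"
      by (simp add: power2_eq_square mult_ac)
    then show ?thesis using pos by (rule mult_left_le_imp_le)
  qed
  have low: "k * ?E w \<le> ?E (?B *\<^sub>v w)" if w: "w \<in> carrier_vec n" for w
  proof (cases "w = 0\<^sub>v n")
    case True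
    then show ?thesis using A0 E0[OF Bc[OF w]] by (simp add: energy_norm_def)
  next
    case False
    have "k * (?E w)\<^sup>2 \<le> scalar_prod w (A0 *\<^sub>v (?B *\<^sub>v w))" using coer[OF w] E2[OF w] A0B[OF w] by simp
    also have "\<dots> \<le> ?E w * ?E (?B *\<^sub>v w)" by (rule CS[OF w Bc[OF w]])
    finally have "?E w * (k * ?E w) \<le> ?E w * ?E (?B *\<^sub>v w)" by (simp add: power2_eq_square mult_ac)
    then show ?thesis using Epos[OF w False] by (rule mult_left_le_imp_le)
  qed
  have injB: "v = 0\<^sub>v n" if v: "v \<in> carrier_vec n" "?B *\<^sub>v v = 0\<^sub>v n" for v
  proof (rule ccontr)
    assume ne: "v \<noteq> 0\<^sub>v n"
    have "k * ?E v \<le> ?E (0\<^sub>v n)" using low[OF v(1)] v(2) by simp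
    also have "?E (0\<^sub>v n) = 0" using A0 by (simp add: energy_norm_def)
    finally show False using Epos[OF v(1) ne] k by (simp add: mult_le_0_iff)
  qed
  note invB = injective_mat_inverse[OF B injB]
  show "invertible_mat ?B" by (rule invB(4))
  let ?Bi = "the (mat_inverse ?B)"
  let ?V = "carrier_vec (dim_row A0) - {0\<^sub>v (dim_row A0)} :: real Matrix.vec set"
  have V: "?V = carrier_vec n - {0\<^sub>v n}" using A0 by simp
  have inv_le: "?E (?Bi *\<^sub>v z) \<le> 1 / k * ?E z" if z: "z \<in> carrier_vec n" for z
  proof -
    have Bz: "?Bi *\<^sub>v z \<in> carrier_vec n" using invB(1) z by (rule mult_mat_vec_carrier)
    have "?B *\<^sub>v (?Bi *\<^sub>v z) = z"
      using assoc_mult_mat_vec[OF B invB(1) z] invB(2) z by simp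
    then have "k * ?E (?Bi *\<^sub>v z) \<le> ?E z" using low[OF Bz] by simp
    then show ?thesis using k by (simp add: field_simps)
  qed
  have ex: "?V \<noteq> {}"
  proof -
    have "unit_vec n 0 \<in> carrier_vec n" "unit_vec n 0 \<noteq> (0\<^sub>v n :: real Matrix.vec)" using n by auto
    then show ?thesis unfolding V by blast
  qed
  have op: "energy_op_norm A0 X \<le> s \<and> 0 \<le> energy_op_norm A0 X"
    if X: "\<And>v. v \<in> carrier_vec n \<Longrightarrow> X *\<^sub>v v \<in> carrier_vec n" "\<And>v. v \<in> carrier_vec n \<Longrightarrow> ?E (X *\<^sub>v v) \<le> s * ?E v" for X s
  proof
    have le: "?E (X *\<^sub>v v) / ?E v \<le> s" if "v \<in> ?V" for v
      using X(2)[of v] Epos[of v] that unfolding V by (simp add: pos_divide_le_eq)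
    show "energy_op_norm A0 X \<le> s" unfolding energy_op_norm_def by (rule cSUP_least[OF ex le])
    obtain v where v: "v \<in> ?V" using ex by blast
    have "0 \<le> ?E (X *\<^sub>v v) / ?E v" using E0 X(1) v unfolding V by simp
    also have "\<dots> \<le> energy_op_norm A0 X"
      unfolding energy_op_norm_def using le by (intro cSUP_upper v bdd_aboveI[of _ s]) auto
    finally show "0 \<le> energy_op_norm A0 X" .
  qed
  have "energy_op_norm A0 ?B \<le> 2 * c \<and> 0 \<le> energy_op_norm A0 ?B" by (rule op[OF Bc up])
  moreover have "energy_op_norm A0 ?Bi \<le> 1 / k \<and> 0 \<le> energy_op_norm A0 ?Bi"
    by (rule op[OF _ inv_le]) (rule mult_mat_vec_carrier[OF invB(1)])
  ultimately have "energy_op_norm A0 ?B * energy_op_norm A0 ?Bi \<le> 2 * c * (1 / k)" by (intro mult_mono) auto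
  then show "condition_number A0 ?B \<le> 2 * c / k" by (simp add: condition_number_def)
qed

lemma scalar_prod_mat:
  fixes F :: "nat \<times> nat \<Rightarrow> real"
  assumes "v \<in> carrier_vec n" "w \<in> carrier_vec n"
  shows "scalar_prod v (Matrix.mat n n F *\<^sub>v w) = (\<Sum>i<n. \<Sum>j<n. vec_index v i * (vec_index w j * F (i, j)))"
  using assms
  by (auto simp: scalar_prod_def mult_mat_vec_def sum_distrib_left lessThan_atLeast0 mult_ac intro!: sum.cong)

section \<open>The system matrices\<close>

context dg_mesh begin

lemma penalty_comb_right:
  assumes "broken_C1 u" "broken_C1 u'" "broken_C1 w"
  shows "penalty \<mu> w (\<lambda>K x. t * u K x + u' K x) = t * penalty \<mu> w u + penalty \<mu> w u'"
  unfolding penalty_sym[of \<mu> w] by (rule penalty_comb_left[OF assms])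

lemma bilinear_sum:
  fixes F :: "('d, real) broken \<Rightarrow> ('d, real) broken \<Rightarrow> real" and n :: nat
  assumes left: "\<And>u u' w t. broken_C1 u \<Longrightarrow> broken_C1 u' \<Longrightarrow> broken_C1 w \<Longrightarrow> F (\<lambda>K x. t * u K x + u' K x) w = t * F u w + F u' w"
    and right: "\<And>u u' w t. broken_C1 u \<Longrightarrow> broken_C1 u' \<Longrightarrow> broken_C1 w \<Longrightarrow> F w (\<lambda>K x. t * u K x + u' K x) = t * F w u + F w u'"
    and b: "\<And>i. i < n \<Longrightarrow> broken_C1 (b i)"
  shows "F (\<lambda>K x. \<Sum>i<n. v i * b i K x) (\<lambda>K x. \<Sum>i<n. w i * b i K x) = (\<Sum>i<n. \<Sum>j<n. v i * (w j * F (b i) (b j)))"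
proof -
  have z: "broken_C1 (\<lambda>K x. 0)" by (simp add: broken_C1_def C1_fun_const)
  have S: "broken_C1 (\<lambda>K x. \<Sum>i<k. v i * b i K x)" if "k \<le> n" for k and v :: "nat \<Rightarrow> real"
    using that
  proof (induction k)
    case (Suc k)
    then have "broken_C1 (\<lambda>K x. v k * b k K x + (\<Sum>i<k. v i * b i K x))"
      by (intro broken_C1_comb b) auto
    then show ?case by (simp add: add.commute)
  qed (simp add: z)
  have F0: "F (\<lambda>K x. 0) u = 0" "F u (\<lambda>K x. 0) = 0" if "broken_C1 u" for u
    using left[OF z z that, of "-1"] right[OF z z that, of "-1"] by simp_all
  have L: "F (\<lambda>K x. \<Sum>i<k. v i * b i K x) u = (\<Sum>i<k. v i * F (b i) u)" if "k \<le> n" "broken_C1 u" for k u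
    using that
  proof (induction k)
    case (Suc k)
    have "F (\<lambda>K x. v k * b k K x + (\<Sum>i<k. v i * b i K x)) u = v k * F (b k) u + F (\<lambda>K x. \<Sum>i<k. v i * b i K x) u"
      using Suc by (intro left b S) auto
    then show ?case using Suc by (simp add: add.commute)
  qed (simp add: F0)
  have R: "F u (\<lambda>K x. \<Sum>i<k. w i * b i K x) = (\<Sum>i<k. w i * F u (b i))" if "k \<le> n" "broken_C1 u" for k u
    using that
  proof (induction k)
    case (Suc k)
    have "F u (\<lambda>K x. w k * b k K x + (\<Sum>i<k. w i * b i K x)) = w k * F u (b k) + F u (\<lambda>K x. \<Sum>i<k. w i * b i K x)"
      using Suc by (intro right b S) auto
    then show ?case using Suc by (simp add: add.commute)
  qed (simp add: F0)
  have "F (\<lambda>K x. \<Sum>i<n. v i * b i K x) (\<lambda>K x. \<Sum>i<n. w i * b i K x) = (\<Sum>i<n. v i * F (b i) (\<lambda>K x. \<Sum>i<n. w i * b i K x))"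
    by (rule L[OF order_refl S[OF order_refl]])
  also have "\<dots> = (\<Sum>i<n. v i * (\<Sum>j<n. w j * F (b i) (b j)))"
    by (intro sum.cong refl) (simp add: R b)
  finally show ?thesis by (simp add: sum_distrib_left)
qed

text \<open>
  A coefficient vector stands for two broken functions: the piecewise constant function with these
  values, and its reconstruction, which is the same combination of reconstructed indicators. The two
  matrices are the Gram matrices of the corresponding forms.
\<close>

lemma condition_number_bound:
  assumes Ks: "T = set Ks" "distinct Ks" and \<theta>: "\<theta> = -1 \<or> \<theta> = 1"
    and \<mu>: "\<mu> > 0" "\<theta> = -1 \<Longrightarrow> \<mu> \<ge> 4 * (c5 + 1) / a0"
    and c6: "c6 = a1 + c5 + 1 + \<mu>" and c7: "c7 = min (a0 / 2) (\<mu> / 2)"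
    and c8: "c8 = 2 + 4 * ca * (real CARD('d) + 1) * (4 * C\<sigma>\<^sup>2 * C1)"
    and c9: "c9 = (unit_ball_vol CARD('d) * (2 * C\<sigma>) ^ CARD('d) * C2\<^sup>2 + 4 * ca * (real CARD('d) + 1))
      * (8 * C\<sigma> / unit_ball_vol CARD('d) * (((real nS + 3) * (2 * C\<sigma>)) ^ CARD('d)) ^ 6) + 2"
  shows "let A0 = matrix_dg0 Ks; B = preconditioned A0 (matrix_dg A \<theta> \<mu> nS m Ks)
    in invertible_mat A0 \<and> invertible_mat B \<and>
       condition_number A0 B \<le> 2 * c6 * c9 * c8 / c7 * (Lambda_bar (set Ks) nS m)\<^sup>2"
proof -
  define n where "n = length Ks"
  let ?A0 = "matrix_dg0 Ks" and ?M = "matrix_dg A \<theta> \<mu> nS m Ks" and ?L = "Lambda_bar T nS m"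
  define val :: "real Matrix.vec \<Rightarrow> (real ^ 'd) set \<Rightarrow> real" where
    "val v K = (\<Sum>i<n. vec_index v i * (if K = Ks ! i then 1 else 0))" for v K
  define b where "b i = element_indicator (Ks ! i)" for i
  define \<beta> where "\<beta> i = reconstruction T nS m (b i)" for i
  define R where "R v = (\<lambda>K x. \<Sum>i<n. vec_index v i * \<beta> i K x)" for v
  let ?q = "\<lambda>v. \<Sum>e\<in>faces T. jump_energy (piecewise_const (val v)) e"
  have n0: "n > 0" using mesh_nonempty Ks(1) by (simp add: n_def)
  have bC: "broken_C1 (b i)" for i
    by (auto simp: b_def element_indicator_def broken_C1_def intro: C1_fun_const)
  have rb: "reconstructs K (\<lambda>K'. if K' = Ks ! i then 1 else 0) (\<beta> i K)" if "K \<in> T" for K i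
    using local_reconstruction_reconstructs[OF that, of "b i"]
    by (simp add: \<beta>_def reconstruction_def b_def element_indicator_def)
  have \<beta>C: "broken_C1 (\<beta> i)" for i
    using rb by (auto simp: broken_C1_def reconstructs_def intro: C1_fun_poly)
  have RR: "reconstructs K (val v) (R v K)" if "K \<in> T" for K v
    unfolding val_def R_def using rb[OF that] by (intro reconstructs_sum) auto
  have Rp: "broken_poly (R v)" for v using RR by (auto simp: broken_poly_def reconstructs_def)
  have val_nth: "val v (Ks ! i) = vec_index v i" if i: "i < n" for v i
  proof -
    have "val v (Ks ! i) = (\<Sum>j<n. if j = i then vec_index v i else 0)"
      unfolding val_def using i Ks(2) by (intro sum.cong) (auto simp: n_def nth_eq_iff_index_eq)
    then show ?thesis using i by simp
  qed
  have pc: "piecewise_const (val v) = (\<lambda>K x. \<Sum>i<n. vec_index v i * b i K x)" for v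
    by (simp add: piecewise_const_def val_def b_def element_indicator_def)
  have A0c: "?A0 \<in> carrier_mat n n" and Mc: "?M \<in> carrier_mat n n"
    by (simp_all add: matrix_dg0_def matrix_dg_def n_def)
  have A0vw: "scalar_prod v (?A0 *\<^sub>v w) = penalty 1 (piecewise_const (val v)) (piecewise_const (val w))"
    if "v \<in> carrier_vec n" "w \<in> carrier_vec n" for v w
  proof -
    have "penalty 1 (\<lambda>K x. \<Sum>i<n. vec_index v i * b i K x) (\<lambda>K x. \<Sum>i<n. vec_index w i * b i K x)
        = (\<Sum>i<n. \<Sum>j<n. vec_index v i * (vec_index w j * penalty 1 (b i) (b j)))"
      by (rule bilinear_sum[OF penalty_comb_left penalty_comb_right bC])
    then show ?thesis
      unfolding pc matrix_dg0_def n_def[symmetric] scalar_prod_mat[OF that]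
      by (simp add: dg_form0_penalty b_def Ks(1)[symmetric])
  qed
  have Mvw: "scalar_prod v (?M *\<^sub>v w) = dg_form A \<theta> \<mu> T (R v) (R w)"
    if "v \<in> carrier_vec n" "w \<in> carrier_vec n" for v w
  proof -
    have "dg_form A \<theta> \<mu> T (R v) (R w) = (\<Sum>i<n. \<Sum>j<n. vec_index v i * (vec_index w j * dg_form A \<theta> \<mu> T (\<beta> i) (\<beta> j)))"
      unfolding R_def by (rule bilinear_sum[OF dg_form_comb_left dg_form_comb_right \<beta>C])
    then show ?thesis
      unfolding matrix_dg_def n_def[symmetric] scalar_prod_mat[OF that]
      by (simp add: \<beta>_def b_def Ks(1)[symmetric])
  qed
  have qv: "scalar_prod v (?A0 *\<^sub>v v) = ?q v" if "v \<in> carrier_vec n" for v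
    unfolding A0vw[OF that that] using penalty_eq[OF broken_C1_const, of 1] by simp
  have q0: "?q v \<ge> 0" for v by (intro sum_nonneg jump_energy_nonneg broken_C1_const)
  have pd: "scalar_prod v (?A0 *\<^sub>v v) > 0" if v: "v \<in> carrier_vec n" "v \<noteq> 0\<^sub>v n" for v
  proof (rule ccontr)
    assume "\<not> scalar_prod v (?A0 *\<^sub>v v) > 0"
    then have "?q v = 0" using qv[OF v(1)] q0[of v] by simp
    then have je: "jump_energy (piecewise_const (val v)) e = 0" if "e \<in> faces T" for e
      using sum_nonneg_eq_0_iff[OF finite_faces, of "jump_energy (piecewise_const (val v))"]
        jump_energy_nonneg[OF _ broken_C1_const] that by blast
    have "sq_jump (val v) e = 0" if e: "e \<in> faces T" for e
    proof -
      obtain K where K: "K \<in> adjacent T e" using e faces_iff by blast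
      have "0 < unit_ball_vol CARD('d) / 2 * r ^ (CARD('d) - 1)" using r_pos by simp
      then have "area e > 0" using facet_geometry(2)[OF K] by linarith
      then show ?thesis using je[OF e] diameter_pos[OF K] by (simp add: jump_energy_const)
    qed
    then have "val v K = 0" if "K \<in> T" for K using jumps_zero_imp_zero that by blast
    then have "vec_index v i = 0" if "i < n" for i using val_nth[OF that, of v] Ks(1) that by (simp add: n_def)
    then have "v = 0\<^sub>v n" using v(1) by (intro eq_vecI) auto
    with v(2) show False by simp
  qed
  have c6p: "c6 > 0" using a1(1) c5_nonneg \<mu>(1) by (simp add: c6)
  have c7p: "c7 > 0" using a0(1) \<mu>(1) by (simp add: c7)
  have c8p: "c8 > 0" using ca_nonneg C1 by (simp add: c8 add_pos_nonneg)
  have up: "dg_energy (R v) \<le> c9 * ?L\<^sup>2 * ?q v" for v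
    using reconstruction_energy_le[OF RR, of v] by (simp add: c9 near_bound_def)
  have low: "?q v \<le> c8 * dg_energy (R v)" for v
    unfolding c8 by (rule const_energy_le[OF Rp]) (use RR in \<open>simp add: reconstructs_def\<close>)
  have bound: "scalar_prod v (?M *\<^sub>v w) \<le> (c6 * c9 * ?L\<^sup>2) * (scalar_prod v (?A0 *\<^sub>v v) + scalar_prod w (?A0 *\<^sub>v w))"
    if v: "v \<in> carrier_vec n" and w: "w \<in> carrier_vec n" for v w
  proof -
    have "scalar_prod v (?M *\<^sub>v w) \<le> \<bar>dg_form A \<theta> \<mu> T (R v) (R w)\<bar>" by (simp add: Mvw[OF v w])
    also have "\<dots> \<le> c6 * (dg_energy (R v) + dg_energy (R w))"
      unfolding c6 using \<mu>(1) by (intro dg_form_bounded Rp \<theta>) simp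
    also have "\<dots> \<le> c6 * (c9 * ?L\<^sup>2 * ?q v + c9 * ?L\<^sup>2 * ?q w)"
      using c6p by (intro mult_left_mono add_mono up) simp
    finally show ?thesis unfolding qv[OF v] qv[OF w] by (simp add: algebra_simps)
  qed
  have coer: "(c7 / c8) * scalar_prod v (?A0 *\<^sub>v v) \<le> scalar_prod v (?M *\<^sub>v v)" if v: "v \<in> carrier_vec n" for v
  proof -
    have "(c7 / c8) * ?q v \<le> (c7 / c8) * (c8 * dg_energy (R v))"
      using low c7p c8p by (intro mult_left_mono) auto
    also have "\<dots> = c7 * dg_energy (R v)" using c8p by simp
    also have "\<dots> \<le> dg_form A \<theta> \<mu> T (R v) (R v)" unfolding c7 by (rule dg_form_coercive[OF Rp \<theta> \<mu>])
    finally show ?thesis unfolding qv[OF v] Mvw[OF v v] .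
  qed
  have sym: "scalar_prod v (?A0 *\<^sub>v w) = scalar_prod w (?A0 *\<^sub>v v)" if "v \<in> carrier_vec n" "w \<in> carrier_vec n" for v w
    unfolding A0vw[OF that] A0vw[OF that(2,1)] by (rule penalty_sym)
  have k: "c7 / c8 > 0" using c7p c8p by simp
  note final = condition_number_le[OF A0c Mc n0 sym pd bound coer k]
  have "2 * (c6 * c9 * ?L\<^sup>2) / (c7 / c8) = 2 * c6 * c9 * c8 / c7 * ?L\<^sup>2" by simp
  with final show ?thesis unfolding Let_def Ks(1)[symmetric] by (metis (lifting))
qed

end

text \<open>
  The lower bound is the minimum of the quadratic form on the unit sphere.
\<close>

lemma spd_bounds:
  fixes A :: "real ^ 'd ^ 'd"
  assumes "spd A"
  shows "\<exists>a0>0. \<forall>x. a0 * (norm x)\<^sup>2 \<le> x \<bullet> (A *v x)" "\<exists>a1\<ge>0. \<forall>x. norm (A *v x) \<le> a1 * norm x"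
proof -
  have lin: "bounded_linear ((*v) A)" by (rule matrix_vector_mul_bounded_linear)
  then obtain a1 where "\<And>x. norm (A *v x) \<le> norm x * a1" "a1 \<ge> 0"
    using bounded_linear.nonneg_bounded by blast
  then show "\<exists>a1\<ge>0. \<forall>x. norm (A *v x) \<le> a1 * norm x" by (auto simp: mult.commute)
  have ne: "sphere (0 :: real ^ 'd) 1 \<noteq> {}"
  proof -
    obtain i :: 'd where True by blast
    have "axis i 1 \<in> sphere (0 :: real ^ 'd) 1" by (simp add: norm_axis_1)
    then show ?thesis by blast
  qed
  have "continuous_on (sphere 0 1) (\<lambda>x. x \<bullet> (A *v x))"
    by (intro continuous_on_inner continuous_on_id linear_continuous_on lin)
  from continuous_attains_inf[OF compact_sphere ne this]
  obtain y where y: "y \<in> sphere 0 1" "\<And>x. x \<in> sphere 0 1 \<Longrightarrow> y \<bullet> (A *v y) \<le> x \<bullet> (A *v x)" by blast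
  have "y \<noteq> 0" using y(1) by auto
  then have pos: "y \<bullet> (A *v y) > 0" using assms by (simp add: spd_def)
  have "(y \<bullet> (A *v y)) * (norm x)\<^sup>2 \<le> x \<bullet> (A *v x)" for x
  proof (cases "x = 0")
    case False
    define z where "z = (1 / norm x) *\<^sub>R x"
    have z: "z \<in> sphere 0 1" using False by (simp add: z_def)
    have xz: "x = norm x *\<^sub>R z" using False by (simp add: z_def)
    have "x \<bullet> (A *v x) = (norm x)\<^sup>2 * (z \<bullet> (A *v z))"
      by (subst (1 2) xz) (simp add: matrix_vector_mult_scaleR power2_eq_square)
    moreover have "(norm x)\<^sup>2 * (y \<bullet> (A *v y)) \<le> (norm x)\<^sup>2 * (z \<bullet> (A *v z))"
      using y(2)[OF z] by (intro mult_left_mono) auto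
    ultimately show ?thesis by (simp add: mult.commute)
  qed simp
  with pos show "\<exists>a0>0. \<forall>x. a0 * (norm x)\<^sup>2 \<le> x \<bullet> (A *v x)" by blast
qed

theorem theorem3:
  fixes A :: "real ^ 'd ^ 'd" and m :: nat and C\<sigma> \<theta> :: real
  assumes "CARD('d) = 2 \<or> CARD('d) = 3"
    and "spd A"
    and "C\<sigma> > 0"
    and "m \<ge> 1"
    and "\<theta> = -1 \<or> \<theta> = 1"
  shows "\<exists>\<mu>0>0. \<forall>(\<Omega> :: (real ^ 'd) set) (nS :: nat) (\<mu> :: real).
    polyhedral_domain \<Omega> \<and> \<mu> > 0 \<and> (\<theta> = -1 \<longrightarrow> \<mu> \<ge> \<mu>0) \<longrightarrow>
    (\<exists>C>0. \<forall>Ks.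
       distinct Ks \<and> mesh_of \<Omega> (set Ks) \<and> quasi_uniform C\<sigma> (set Ks) \<and>
       unisolvent_patches (set Ks) nS m \<longrightarrow>
       (let A0 = matrix_dg0 Ks; B = preconditioned A0 (matrix_dg A \<theta> \<mu> nS m Ks)
        in invertible_mat A0 \<and> invertible_mat B \<and>
           condition_number A0 B \<le> C * (Lambda_bar (set Ks) nS m)\<^sup>2))"
proof -
  obtain C1 where C1: "C1 \<ge> 0" "\<And>p :: real ^ 'd \<Rightarrow> real. \<And>c r x. p \<in> poly_space m \<Longrightarrow> r > 0 \<Longrightarrow> x \<in> cball c (2 * C\<sigma> * r) \<Longrightarrow>
      r ^ CARD('d) * (norm (grad p x))\<^sup>2 \<le> C1 * (LINT x:cball c r|lborel. (norm (grad p x))\<^sup>2)"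
    using grad_inverse_L2[where 'd = 'd and m = m and R = "2 * C\<sigma>"] by blast
  obtain C2 where C2: "C2 \<ge> 0" "\<And>p :: real ^ 'd \<Rightarrow> real. \<And>c r x M. p \<in> poly_space m \<Longrightarrow> r > 0 \<Longrightarrow>
      (\<And>x. x \<in> cball c r \<Longrightarrow> \<bar>p x\<bar> \<le> M) \<Longrightarrow> x \<in> cball c (2 * C\<sigma> * r) \<Longrightarrow> r * norm (grad p x) \<le> C2 * M"
    using grad_inverse_sup[where 'd = 'd and m = m and R = "2 * C\<sigma>"] by blast
  obtain a0 where a0: "a0 > 0" "\<And>x. a0 * (norm x)\<^sup>2 \<le> x \<bullet> (A *v x)" using spd_bounds(1)[OF assms(2)] by blast
  obtain a1 where a1: "a1 \<ge> 0" "\<And>x. norm (A *v x) \<le> a1 * norm x" using spd_bounds(2)[OF assms(2)] by blast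
  define ca where "ca = unit_ball_vol CARD('d) * 3 ^ CARD('d) * (2 * C\<sigma>) ^ (CARD('d) - 1)"
  define c5 where "c5 = (real CARD('d) + 1) * (2 * C\<sigma> * a1\<^sup>2 * C1 * ca)"
  have ca0: "ca \<ge> 0" using assms(3) by (simp add: ca_def)
  have c50: "c5 \<ge> 0" using assms(3) C1(1) ca0 by (simp add: c5_def)
  \<comment> \<open>The threshold involves only the constants of the inverse and trace inequalities and of the coefficient matrix.\<close>
  define \<mu>0 where "\<mu>0 = 4 * (c5 + 1) / a0"
  have "\<mu>0 > 0" using a0(1) c50 by (simp add: \<mu>0_def)
  moreover have "\<exists>C>0. \<forall>Ks.
       distinct Ks \<and> mesh_of \<Omega> (set Ks) \<and> quasi_uniform C\<sigma> (set Ks) \<and>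
       unisolvent_patches (set Ks) nS m \<longrightarrow>
       (let A0 = matrix_dg0 Ks; B = preconditioned A0 (matrix_dg A \<theta> \<mu> nS m Ks)
        in invertible_mat A0 \<and> invertible_mat B \<and>
           condition_number A0 B \<le> C * (Lambda_bar (set Ks) nS m)\<^sup>2)"
    if h: "polyhedral_domain \<Omega> \<and> \<mu> > 0 \<and> (\<theta> = -1 \<longrightarrow> \<mu> \<ge> \<mu>0)" for \<Omega> :: "(real ^ 'd) set" and nS \<mu>
  proof -
    \<comment> \<open>In this order the constants for boundedness, for coercivity, and for the two comparisons of energies.\<close>
    define c6 where "c6 = a1 + c5 + 1 + \<mu>"
    define c7 where "c7 = min (a0 / 2) (\<mu> / 2)"
    define c8 where "c8 = 2 + 4 * ca * (real CARD('d) + 1) * (4 * C\<sigma>\<^sup>2 * C1)"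
    define c9 where "c9 = (unit_ball_vol CARD('d) * (2 * C\<sigma>) ^ CARD('d) * C2\<^sup>2 + 4 * ca * (real CARD('d) + 1))
      * (8 * C\<sigma> / unit_ball_vol CARD('d) * (((real nS + 3) * (2 * C\<sigma>)) ^ CARD('d)) ^ 6) + 2"
    have "c6 > 0" using a1(1) c50 h by (simp add: c6_def)
    moreover have "c7 > 0" using a0(1) h by (simp add: c7_def)
    moreover have "c8 > 0" using ca0 C1(1) by (simp add: c8_def add_pos_nonneg)
    moreover have "c9 > 0"
      unfolding c9_def using assms(3) ca0 by (intro add_nonneg_pos mult_nonneg_nonneg add_nonneg_nonneg divide_nonneg_nonneg) auto
    ultimately have pos: "2 * c6 * c9 * c8 / c7 > 0" by simp
    have "let A0 = matrix_dg0 Ks; B = preconditioned A0 (matrix_dg A \<theta> \<mu> nS m Ks)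
        in invertible_mat A0 \<and> invertible_mat B \<and>
           condition_number A0 B \<le> 2 * c6 * c9 * c8 / c7 * (Lambda_bar (set Ks) nS m)\<^sup>2"
      if Ks: "distinct Ks \<and> mesh_of \<Omega> (set Ks) \<and> quasi_uniform C\<sigma> (set Ks) \<and> unisolvent_patches (set Ks) nS m" for Ks
    proof -
      interpret dg_mesh \<Omega> "set Ks" C\<sigma> nS m A C1 C2 a0 a1 ca c5
      proof unfold_locales
        show "polyhedral_domain \<Omega>" "mesh_of \<Omega> (set Ks)" "quasi_uniform C\<sigma> (set Ks)" "unisolvent_patches (set Ks) nS m" "C\<sigma> > 0"
          using h Ks assms(3) by auto
        show "2 \<le> CARD('d)" using assms(1) by auto
      qed (fact C1 C2 a0 a1 ca_def c5_def)+
      show ?thesis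
        by (rule condition_number_bound[OF refl _ assms(5) _ _ c6_def c7_def c8_def c9_def])
           (use Ks h in \<open>auto simp: \<mu>0_def\<close>)
    qed
    with pos show ?thesis by blast
  qed
  ultimately show ?thesis by blast
qed

end
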